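(* Let $(M,g)$ be a compact Riemannian manifold of dimension $d\ge2$ and let $\mu$ be an admissible measure on $M$. Then $$0=\lambda_0(M,g,\mu)<\lambda_1(M,g,\mu)\le\lambda_2(M,g,\mu)\le\dots\nearrow\infty,$$ i.e. the first eigenvalue is positive, the multiplicity of each eigenvalue is finite, and the eigenvalues tend to $+\infty$. Moreover, there exists an orthogonal basis (of $L^2(M,\mu)$) of eigenfunctions $f_j\in\mathcal W^{1,2}(M,\mu)$ satisfying $$\int_M\nabla f_j\cdot\nabla u\,dv_g=\lambda_j(M,g,\mu)\int_M f_ju\,d\mu\qquad\text{for all }u\in\mathcal W^{1,2}(M,\mu).$$
   Context: Manifolds are connected and may have Lipschitz boundary. $dv_g$ is the volume measure. For a Radon measure $\mu$ on $M$, $\mathcal W^{1,2}(M,\mu)$ is the completion of $C^\infty(M)$ for the norm $\|u\|^2=\int_M|u|^2\,d\mu+\int_M|\nabla u|_g^2\,dv_g$, with natural map $\tau_2^\mu:\mathcal W^{1,2}(M,\mu)\to L^2(M,\mu)$. With $m_{f,\mu}=\mu(M)^{-1}\int_M f\,d\mu$, $\mu$ supports a $2$-Poincaré inequality if there is $K>0$ with $\int_M(f-m_{f,\mu})^2\,d\mu\le K\int_M|\nabla f|^2\,dv_g$ for all $f\in\mathcal W^{1,2}(M,\mu)$. $\mu$ is admissible if it is not supported on a single point, supports a $2$-Poincaré inequality, and $\tau_2^\mu$ is compact. Variational eigenvalues: $\lambda_k(M,g,\mu):=\inf_{F_{k+1}}\sup_{f\in F_{k+1}\setminus\{0\}}\frac{\int_M|\nabla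 f|_g^2dv_g}{\int_M f^2d\mu}$, the infimum being over $(k+1)$-dimensional subspaces $F_{k+1}\subset C^\infty(M)$ that remain $(k+1)$-dimensional in $L^2(M,\mu)$. *)

theory Defs
  imports "HOL-Analysis.Analysis" "HOL-Library.Function_Algebras"
begin

section \<open>Smooth functions on Lipschitz domains of Euclidean space\<close>

text \<open>The sets \<open>U\<close> below are meant to be open.\<close>

primrec Ck_on :: "nat \<Rightarrow> (real^'n) set \<Rightarrow> (real^'n \<Rightarrow> real) \<Rightarrow> bool" where
  "Ck_on 0 U f \<longleftrightarrow> continuous_on U f"
| "Ck_on (Suc k) U f \<longleftrightarrow> (\<forall>x\<in>U. f differentiable (at x)) \<and>
     (\<forall>i. Ck_on k U (\<lambda>x. frechet_derivative f (at x) (axis i 1)))"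

text \<open>Smoothness on an arbitrary set means local extendability to a smooth function on an
  open set, so that it is smoothness up to the boundary.\<close>

definition smooth_on_set :: "(real^'n) set \<Rightarrow> (real^'n \<Rightarrow> real) \<Rightarrow> bool" where
  "smooth_on_set S f \<longleftrightarrow>
     (\<forall>x\<in>S. \<exists>U F. open U \<and> x \<in> U \<and> (\<forall>k. Ck_on k U F) \<and> (\<forall>y\<in>S \<inter> U. F y = f y))"

text \<open>Every point of \<open>S\<close> has a neighbourhood in which \<open>S\<close> is the closed epigraph, in the direction
  of some unit vector \<open>v\<close>, of a Lipschitz function of the variables orthogonal to \<open>v\<close>.
  Interior points satisfy this with \<open>h\<close> a sufficiently negative constant, so open sets are
  included.\<close>

definition lipschitz_domain :: "(real^'n) set \<Rightarrow> bool" where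
  "lipschitz_domain S \<longleftrightarrow>
     (\<forall>x\<in>S. \<exists>W v h L. open W \<and> x \<in> W \<and> norm v = 1 \<and>
        L-lipschitz_on UNIV h \<and> (\<forall>y t. h (y + t *\<^sub>R v) = h y) \<and>
        S \<inter> W = {y \<in> W. (h y :: real) \<le> y \<bullet> v})"

section \<open>Riemannian manifolds with Lipschitz boundary\<close>

text \<open>The manifold is the whole type \<open>'a\<close>; its dimension is \<open>CARD('n)\<close>.
  A chart is a pair of its domain and its coordinate map. A metric
  assigns to every chart its coordinate matrix, as a function of the coordinates.\<close>

type_synonym ('a, 'n) chart = "'a set \<times> ('a \<Rightarrow> real^'n)"
type_synonym ('a, 'n) metric = "('a, 'n) chart \<Rightarrow> real^'n \<Rightarrow> real^'n^'n"

abbreviation chart_image :: "('a, 'n) chart \<Rightarrow> (real^'n) set" where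
  "chart_image c \<equiv> snd c ` fst c"

abbreviation chart_inv :: "('a, 'n) chart \<Rightarrow> real^'n \<Rightarrow> 'a" where
  "chart_inv c \<equiv> inv_into (fst c) (snd c)"

definition is_chart :: "('a::topological_space, 'n::finite) chart \<Rightarrow> bool" where
  "is_chart c \<longleftrightarrow> open (fst c) \<and>
     homeomorphism (fst c) (chart_image c) (snd c) (chart_inv c) \<and>
     lipschitz_domain (chart_image c)"

abbreviation overlap :: "('a, 'n) chart \<Rightarrow> ('a, 'n) chart \<Rightarrow> (real^'n) set" where
  "overlap c c' \<equiv> snd c ` (fst c \<inter> fst c')"

abbreviation transition :: "('a, 'n) chart \<Rightarrow> ('a, 'n) chart \<Rightarrow> real^'n \<Rightarrow> real^'n" where
  "transition c c' \<equiv> snd c' \<circ> chart_inv c"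

definition smooth_atlas :: "('a::topological_space, 'n::finite) chart set \<Rightarrow> bool" where
  "smooth_atlas A \<longleftrightarrow> (\<forall>c\<in>A. is_chart c) \<and> (\<Union>c\<in>A. fst c) = UNIV \<and>
     (\<forall>c\<in>A. \<forall>c'\<in>A. \<forall>i. smooth_on_set (overlap c c') (\<lambda>x. transition c c' x $ i))"

text \<open>The last clause is the transformation law of a covariant 2-tensor.\<close>

definition riemannian_metric :: "('a, 'n::finite) chart set \<Rightarrow> ('a, 'n) metric \<Rightarrow> bool" where
  "riemannian_metric A g \<longleftrightarrow>
     (\<forall>c\<in>A. (\<forall>i j. smooth_on_set (chart_image c) (\<lambda>x. g c x $ i $ j)) \<and>
        (\<forall>x\<in>chart_image c. transpose (g c x) = g c x \<and> (\<forall>v. v \<noteq> 0 \<longrightarrow> 0 < v \<bullet> (g c x *v v)))) \<and>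
     (\<forall>c\<in>A. \<forall>c'\<in>A. \<forall>x\<in>overlap c c'.
        (let J = matrix (frechet_derivative (transition c c') (at x within overlap c c'))
         in g c x = transpose J ** g c' (transition c c' x) ** J))"

definition riemannian_manifold ::
  "('a::{t2_space, second_countable_topology}, 'n::finite) chart set \<Rightarrow> ('a, 'n) metric \<Rightarrow> bool" where
  "riemannian_manifold A g \<longleftrightarrow>
     connected (UNIV :: 'a set) \<and> smooth_atlas A \<and> riemannian_metric A g"

definition smooth_functions :: "('a, 'n::finite) chart set \<Rightarrow> ('a \<Rightarrow> real) set" where
  "smooth_functions A = {u. \<forall>c\<in>A. smooth_on_set (chart_image c) (u \<circ> chart_inv c)}"

definition riemannian_volume ::
  "('a::topological_space, 'n::finite) chart set \<Rightarrow> ('a, 'n) metric \<Rightarrow> 'a measure" where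
  "riemannian_volume A g = (THE v. sets v = sets borel \<and>
     (\<forall>c\<in>A. \<forall>B\<in>sets borel. B \<subseteq> fst c \<longrightarrow>
        emeasure v B = (\<integral>\<^sup>+x\<in>snd c ` B. ennreal (sqrt (det (g c x))) \<partial>lborel)))"

definition chart_differential ::
  "('a, 'n::finite) chart \<Rightarrow> ('a \<Rightarrow> real) \<Rightarrow> 'a \<Rightarrow> real^'n" where
  "chart_differential c u p =
     (\<chi> i. frechet_derivative (u \<circ> chart_inv c) (at (snd c p) within chart_image c) (axis i 1))"

definition chart_gradient ::
  "('a, 'n::finite) metric \<Rightarrow> ('a, 'n) chart \<Rightarrow> ('a \<Rightarrow> real) \<Rightarrow> 'a \<Rightarrow> real^'n" where
  "chart_gradient g c u p = matrix_inv (g c (snd c p)) *v chart_differential c u p"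

text \<open>\<open>\<langle>\<nabla>u, \<nabla>w\<rangle>\<^sub>g\<close> at \<open>p\<close>, computed in any chart around \<open>p\<close>; by the tensor law
  the value does not depend on the chart.\<close>

definition gradient_inner ::
  "('a, 'n::finite) chart set \<Rightarrow> ('a, 'n) metric \<Rightarrow> ('a \<Rightarrow> real) \<Rightarrow> ('a \<Rightarrow> real) \<Rightarrow> 'a \<Rightarrow> real" where
  "gradient_inner A g u w p =
     (let c = (SOME c. c \<in> A \<and> p \<in> fst c)
      in chart_gradient g c u p \<bullet> (g c (snd c p) *v chart_gradient g c w p))"

definition dirichlet_form ::
  "('a::topological_space, 'n::finite) chart set \<Rightarrow> ('a, 'n) metric \<Rightarrow>
     ('a \<Rightarrow> real) \<Rightarrow> ('a \<Rightarrow> real) \<Rightarrow> real" where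
  "dirichlet_form A g u w = (\<integral>p. gradient_inner A g u w p \<partial>(riemannian_volume A g))"

section \<open>Radon measures and \<open>L\<^sup>2\<close>\<close>

definition radon_measure :: "('a::topological_space) measure \<Rightarrow> bool" where
  "radon_measure \<mu> \<longleftrightarrow> sets \<mu> = sets borel \<and>
     (\<forall>K. compact K \<longrightarrow> emeasure \<mu> K < \<infinity>) \<and>
     (\<forall>B\<in>sets borel. emeasure \<mu> B = (SUP K\<in>{K. compact K \<and> K \<subseteq> B}. emeasure \<mu> K))"

text \<open>Elements of \<open>L\<^sup>2(M, \<mu>)\<close> are represented by functions; all notions below are invariant under
  changes on null sets.\<close>

definition L2 :: "'a measure \<Rightarrow> ('a \<Rightarrow> real) set" where
  "L2 \<mu> = {f \<in> borel_measurable \<mu>. integrable \<mu> (\<lambda>x. (f x)\<^sup>2)}"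

definition L2_tendsto :: "'a measure \<Rightarrow> (nat \<Rightarrow> 'a \<Rightarrow> real) \<Rightarrow> ('a \<Rightarrow> real) \<Rightarrow> bool" where
  "L2_tendsto \<mu> s f \<longleftrightarrow> (\<lambda>n. \<integral>x. (s n x - f x)\<^sup>2 \<partial>\<mu>) \<longlonglongrightarrow> 0"

definition L2_orthogonal_basis :: "'a measure \<Rightarrow> (nat \<Rightarrow> 'a \<Rightarrow> real) \<Rightarrow> bool" where
  "L2_orthogonal_basis \<mu> f \<longleftrightarrow>
     (\<forall>j. f j \<in> L2 \<mu> \<and> (\<integral>x. (f j x)\<^sup>2 \<partial>\<mu>) \<noteq> 0) \<and>
     (\<forall>i j. i \<noteq> j \<longrightarrow> (\<integral>x. f i x * f j x \<partial>\<mu>) = 0) \<and>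
     (\<forall>h\<in>L2 \<mu>. \<forall>e>0. \<exists>n c. (\<integral>x. (h x - (\<Sum>j<n. c j * f j x))\<^sup>2 \<partial>\<mu>) < e)"

text \<open>\<open>B\<close> is a basis of the image in \<open>L\<^sup>2(M, \<mu>)\<close> of a space \<open>F\<close> of functions: linear independence
  and spanning are understood modulo \<open>\<mu>\<close>-almost everywhere equality.\<close>

definition L2_basis_of :: "'a measure \<Rightarrow> ('a \<Rightarrow> real) set \<Rightarrow> ('a \<Rightarrow> real) set \<Rightarrow> bool" where
  "L2_basis_of \<mu> F B \<longleftrightarrow> finite B \<and> B \<subseteq> F \<and>
     (\<forall>c. (AE x in \<mu>. (\<Sum>b\<in>B. c b * b x) = 0) \<longrightarrow> (\<forall>b\<in>B. c b = 0)) \<and>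
     (\<forall>f\<in>F. \<exists>c. AE x in \<mu>. f x = (\<Sum>b\<in>B. c b * b x))"

section \<open>The Sobolev space \<open>W\<^sup>1\<^sup>,\<^sup>2(M, \<mu>)\<close>\<close>

definition sobolev_norm_smooth ::
  "('a::topological_space, 'n::finite) chart set \<Rightarrow> ('a, 'n) metric \<Rightarrow> 'a measure \<Rightarrow>
     ('a \<Rightarrow> real) \<Rightarrow> real" where
  "sobolev_norm_smooth A g \<mu> u = sqrt ((\<integral>x. (u x)\<^sup>2 \<partial>\<mu>) + dirichlet_form A g u u)"

text \<open>The completion, as Cauchy sequences modulo null sequences.\<close>

definition sobolev_cauchy ::
  "('a::topological_space, 'n::finite) chart set \<Rightarrow> ('a, 'n) metric \<Rightarrow> 'a measure \<Rightarrow>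
     (nat \<Rightarrow> 'a \<Rightarrow> real) set" where
  "sobolev_cauchy A g \<mu> = {s. range s \<subseteq> smooth_functions A \<and>
     (\<forall>e>0. \<exists>N. \<forall>m\<ge>N. \<forall>n\<ge>N. sobolev_norm_smooth A g \<mu> (\<lambda>x. s m x - s n x) < e)}"

definition sobolev_null_rel ::
  "('a::topological_space, 'n::finite) chart set \<Rightarrow> ('a, 'n) metric \<Rightarrow> 'a measure \<Rightarrow>
     ((nat \<Rightarrow> 'a \<Rightarrow> real) \<times> (nat \<Rightarrow> 'a \<Rightarrow> real)) set" where
  "sobolev_null_rel A g \<mu> = {(s, t). s \<in> sobolev_cauchy A g \<mu> \<and> t \<in> sobolev_cauchy A g \<mu> \<and>
     (\<lambda>n. sobolev_norm_smooth A g \<mu> (\<lambda>x. s n x - t n x)) \<longlonglongrightarrow> 0}"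

type_synonym 'a sobolev = "(nat \<Rightarrow> 'a \<Rightarrow> real) set"

definition sobolev_space ::
  "('a::topological_space, 'n::finite) chart set \<Rightarrow> ('a, 'n) metric \<Rightarrow> 'a measure \<Rightarrow>
     'a sobolev set" where
  "sobolev_space A g \<mu> = sobolev_cauchy A g \<mu> // sobolev_null_rel A g \<mu>"

text \<open>Continuous extensions to the completion of the norm, of the Dirichlet form, and of the
  map \<open>C\<^sup>\<infinity>(M) \<rightarrow> L\<^sup>2(M, \<mu>)\<close>; for the latter a representing function is chosen.\<close>

definition sobolev_norm ::
  "('a::topological_space, 'n::finite) chart set \<Rightarrow> ('a, 'n) metric \<Rightarrow> 'a measure \<Rightarrow>
     'a sobolev \<Rightarrow> real" where
  "sobolev_norm A g \<mu> X = (THE l. \<forall>s\<in>X. (\<lambda>n. sobolev_norm_smooth A g \<mu> (s n)) \<longlonglongrightarrow> l)"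

definition sobolev_dirichlet ::
  "('a::topological_space, 'n::finite) chart set \<Rightarrow> ('a, 'n) metric \<Rightarrow>
     'a sobolev \<Rightarrow> 'a sobolev \<Rightarrow> real" where
  "sobolev_dirichlet A g X Y =
     (THE l. \<forall>s\<in>X. \<forall>t\<in>Y. (\<lambda>n. dirichlet_form A g (s n) (t n)) \<longlonglongrightarrow> l)"

definition tau :: "'a measure \<Rightarrow> 'a sobolev \<Rightarrow> 'a \<Rightarrow> real" where
  "tau \<mu> X = (SOME f. f \<in> L2 \<mu> \<and> (\<forall>s\<in>X. L2_tendsto \<mu> s f))"

section \<open>Admissible measures\<close>

text \<open>The zero measure counts as supported on a point, so an admissible measure is nonzero.\<close>

definition supported_on_point :: "('a::topological_space) measure \<Rightarrow> bool" where
  "supported_on_point \<mu> \<longleftrightarrow> (\<exists>p. emeasure \<mu> (UNIV - {p}) = 0)"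

definition mean_value :: "'a measure \<Rightarrow> ('a \<Rightarrow> real) \<Rightarrow> real" where
  "mean_value \<mu> f = inverse (measure \<mu> (space \<mu>)) * (\<integral>x. f x \<partial>\<mu>)"

definition supports_poincare ::
  "('a::topological_space, 'n::finite) chart set \<Rightarrow> ('a, 'n) metric \<Rightarrow> 'a measure \<Rightarrow> bool" where
  "supports_poincare A g \<mu> \<longleftrightarrow> (\<exists>K>0. \<forall>X\<in>sobolev_space A g \<mu>.
     (\<integral>x. (tau \<mu> X x - mean_value \<mu> (tau \<mu> X))\<^sup>2 \<partial>\<mu>) \<le> K * sobolev_dirichlet A g X X)"

definition tau_compact ::
  "('a::topological_space, 'n::finite) chart set \<Rightarrow> ('a, 'n) metric \<Rightarrow> 'a measure \<Rightarrow> bool" where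
  "tau_compact A g \<mu> \<longleftrightarrow> (\<forall>X :: nat \<Rightarrow> 'a sobolev. (\<forall>n. X n \<in> sobolev_space A g \<mu>) \<and>
       (\<exists>C. \<forall>n. sobolev_norm A g \<mu> (X n) \<le> C) \<longrightarrow>
     (\<exists>(r :: nat \<Rightarrow> nat) f. strict_mono r \<and> f \<in> L2 \<mu> \<and> L2_tendsto \<mu> (\<lambda>n. tau \<mu> (X (r n))) f))"

definition admissible ::
  "('a::topological_space, 'n::finite) chart set \<Rightarrow> ('a, 'n) metric \<Rightarrow> 'a measure \<Rightarrow> bool" where
  "admissible A g \<mu> \<longleftrightarrow>
     radon_measure \<mu> \<and> \<not> supported_on_point \<mu> \<and> supports_poincare A g \<mu> \<and> tau_compact A g \<mu>"

section \<open>Variational eigenvalues\<close>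

interpretation fun_vs: vector_space "\<lambda>(r::real) (f::'a \<Rightarrow> real) x. r * f x"
  by unfold_locales (auto simp: fun_eq_iff algebra_simps)

text \<open>The \<open>m\<close>-dimensional subspaces of \<open>C\<^sup>\<infinity>(M)\<close> whose image in \<open>L\<^sup>2(M, \<mu>)\<close> is \<open>m\<close>-dimensional. As
  \<open>fun_vs.dim\<close> is 0 for infinite-dimensional spaces, this is meant for \<open>m > 0\<close>.\<close>

definition test_spaces ::
  "('a, 'n::finite) chart set \<Rightarrow> 'a measure \<Rightarrow> nat \<Rightarrow> ('a \<Rightarrow> real) set set" where
  "test_spaces A \<mu> m = {F. F \<subseteq> smooth_functions A \<and> fun_vs.subspace F \<and> fun_vs.dim F = m \<and>
     (\<exists>B. L2_basis_of \<mu> F B \<and> card B = m)}"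

definition eigenvalue ::
  "('a::topological_space, 'n::finite) chart set \<Rightarrow> ('a, 'n) metric \<Rightarrow> 'a measure \<Rightarrow> nat \<Rightarrow> ereal"
  where
  "eigenvalue A g \<mu> k = (INF F\<in>test_spaces A \<mu> (k + 1). SUP f\<in>F - {0}.
     ereal (dirichlet_form A g f f / (\<integral>x. (f x)\<^sup>2 \<partial>\<mu>)))"

definition eigenspace ::
  "('a::topological_space, 'n::finite) chart set \<Rightarrow> ('a, 'n) metric \<Rightarrow> 'a measure \<Rightarrow> real \<Rightarrow>
     'a sobolev set" where
  "eigenspace A g \<mu> l = {X \<in> sobolev_space A g \<mu>. \<forall>Y\<in>sobolev_space A g \<mu>.
     sobolev_dirichlet A g X Y = l * (\<integral>x. tau \<mu> X x * tau \<mu> Y x \<partial>\<mu>)}"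

end

theory Submission
  imports Defs
begin

text \<open>Write \<open>a\<close> for the Dirichlet form and \<open>b\<close> for the \<open>L\<^sup>2(M, \<mu>)\<close> inner product, both extended to Cauchy
  sequences of smooth functions. Compactness of \<open>\<tau>\<close> makes a minimizing sequence of the Rayleigh quotient
  \<open>a / b\<close> on the \<open>b\<close>-complement of the eigenfunctions found so far converge after passing to a
  subsequence, which produces \<open>b\<close>-orthonormal eigenfunctions \<open>e\<^sub>j\<close> with eigenvalues \<open>\<nu>\<^sub>j\<close>, and forces
  \<open>\<nu>\<^sub>j \<rightarrow> \<infinity>\<close>. The remainder of the expansion of \<open>w\<close> in the first \<open>n\<close> of them has squared \<open>b\<close>-norm at
  most \<open>a(w, w) / \<nu>\<^sub>n\<close>, which gives completeness. A \<open>(k+1)\<close>-dimensional test space contains a nonzero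
  function \<open>b\<close>-orthogonal to \<open>e\<^sub>0, \<dots>, e\<^sub>k\<^sub>-\<^sub>1\<close>, and conversely the span of \<open>e\<^sub>0, \<dots>, e\<^sub>k\<close> is a limit of test spaces,
  so the variational eigenvalues are the \<open>\<nu>\<^sub>k\<close>.

  In dimension at least 2 points have capacity zero, so the Poincare inequality excludes atoms of
  \<open>\<mu>\<close>; hence the support is infinite and smooth functions are infinite-dimensional in \<open>L\<^sup>2(M, \<mu>)\<close>. The
  Poincare inequality also makes eigenfunctions for the eigenvalue 0 constant, whence \<open>\<nu>\<^sub>1 > 0\<close>.\<close>

text \<open>The forms are only semidefinite: \<open>a\<close> kills constants, and \<open>b\<close>
  may have a large kernel, as for a measure carried by the boundary. So the Hilbert space argument
  runs on raw Cauchy sequences with seminorms, and equivalence classes enter only when the result is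
  read back into the definitions. The volume is a definite description; its existence and
  uniqueness, hence the change of variables between charts, come before any use of the Dirichlet
  form. Eigenfunctions are limits of smooth functions and need not be smooth, so the infimum over
  test spaces need not be attained and the upper bound carries an error \<delta>. Expansion reaches
  only the image of \<tau>; density of smooth functions in L2 carries it to the whole space. If a
  point has mass m and the total mass is T, testing the Poincare inequality with functions that are
  1 at the point, tend to 0 elsewhere and have vanishing energy leaves m - m^2 / T \<le> 0, which
  excludes 0 < m < T.\<close>

instantiation "fun" :: (type, real_vector) real_vector
begin

definition "c *\<^sub>R f = (\<lambda>x. c *\<^sub>R f x)"

instance
  by standard (simp_all add: scaleR_fun_def fun_eq_iff scaleR_add_right scaleR_add_left)

end

lemma scaleR_fun_apply [simp]: "(c *\<^sub>R f) x = c *\<^sub>R f x"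
  by (simp add: scaleR_fun_def)

lemma sum_fun_apply: "(\<Sum>i\<in>I. f i) x = (\<Sum>i\<in>I. f i x)"
  by (induction I rule: infinite_finite_induct) auto

section \<open>Positive semidefinite forms\<close>

text \<open>An explicit carrier instead of a type lets one development serve smooth functions, L2,
  Cauchy sequences of smooth functions, and Cauchy sequences of those. Without definiteness,
  \<open>nrm\<close> below is a seminorm, and vanishing of the form takes the place of
  equality.\<close>

locale psd_form =
  fixes V :: "'v::real_vector set" and f :: "'v \<Rightarrow> 'v \<Rightarrow> real"
  assumes subspace: "subspace V"
    and add_left: "\<lbrakk>x \<in> V; y \<in> V; z \<in> V\<rbrakk> \<Longrightarrow> f (x + y) z = f x z + f y z"
    and scale_left: "\<lbrakk>x \<in> V; z \<in> V\<rbrakk> \<Longrightarrow> f (c *\<^sub>R x) z = c * f x z"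
    and sym: "\<lbrakk>x \<in> V; z \<in> V\<rbrakk> \<Longrightarrow> f x z = f z x"
    and nonneg: "x \<in> V \<Longrightarrow> 0 \<le> f x x"
begin

lemma mem_simps [simp]:
  "0 \<in> V" "\<lbrakk>x \<in> V; y \<in> V\<rbrakk> \<Longrightarrow> x + y \<in> V" "\<lbrakk>x \<in> V; y \<in> V\<rbrakk> \<Longrightarrow> x - y \<in> V"
  "x \<in> V \<Longrightarrow> c *\<^sub>R x \<in> V"
  using subspace by (auto simp: subspace_0 subspace_add subspace_diff subspace_scale)

lemma mem_sum [simp]: "(\<And>i. i \<in> I \<Longrightarrow> w i \<in> V) \<Longrightarrow> (\<Sum>i\<in>I. w i) \<in> V"
  using subspace by (rule subspace_sum)

lemma add_right: "\<lbrakk>x \<in> V; y \<in> V; z \<in> V\<rbrakk> \<Longrightarrow> f z (x + y) = f z x + f z y"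
  by (metis add_left mem_simps(2) sym)

lemma scale_right: "\<lbrakk>x \<in> V; z \<in> V\<rbrakk> \<Longrightarrow> f z (c *\<^sub>R x) = c * f z x"
  by (metis scale_left mem_simps(4) sym)

lemma diff_left: "\<lbrakk>x \<in> V; y \<in> V; z \<in> V\<rbrakk> \<Longrightarrow> f (x - y) z = f x z - f y z"
  using add_left[of "x - y" y z] by simp

lemma diff_right: "\<lbrakk>x \<in> V; y \<in> V; z \<in> V\<rbrakk> \<Longrightarrow> f z (x - y) = f z x - f z y"
  using add_right[of "x - y" y z] by simp

lemma zero_left [simp]: "z \<in> V \<Longrightarrow> f 0 z = 0"
  using diff_left[of 0 0 z] by simp

lemma zero_right [simp]: "z \<in> V \<Longrightarrow> f z 0 = 0"
  using diff_right[of 0 0 z] by simp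

lemma sum_left: "\<lbrakk>\<And>i. i \<in> I \<Longrightarrow> w i \<in> V; z \<in> V\<rbrakk> \<Longrightarrow> f (\<Sum>i\<in>I. w i) z = (\<Sum>i\<in>I. f (w i) z)"
  by (induction I rule: infinite_finite_induct) (auto simp: add_left)

lemma sum_right: "\<lbrakk>\<And>i. i \<in> I \<Longrightarrow> w i \<in> V; z \<in> V\<rbrakk> \<Longrightarrow> f z (\<Sum>i\<in>I. w i) = (\<Sum>i\<in>I. f z (w i))"
  by (induction I rule: infinite_finite_induct) (auto simp: add_right)

lemmas expand = add_left add_right diff_left diff_right scale_left scale_right

lemma square_add_scale:
  assumes "x \<in> V" "y \<in> V"
  shows "f (x + t *\<^sub>R y) (x + t *\<^sub>R y) = f x x + 2 * t * f x y + t\<^sup>2 * f y y"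
  using assms sym[of y x] by (simp add: expand power2_eq_square algebra_simps)

lemma lincomb:
  assumes "\<And>i. i \<in> I \<Longrightarrow> w i \<in> V"
  shows "f (\<Sum>i\<in>I. c i *\<^sub>R w i) (\<Sum>i\<in>I. d i *\<^sub>R w i) = (\<Sum>i\<in>I. \<Sum>j\<in>I. c i * d j * f (w i) (w j))"
proof -
  have "f (\<Sum>i\<in>I. c i *\<^sub>R w i) (\<Sum>j\<in>I. d j *\<^sub>R w j) = (\<Sum>i\<in>I. c i * (\<Sum>j\<in>I. d j * f (w i) (w j)))"
    using assms by (subst sum_left) (simp_all add: sum_right scale_left scale_right sum_distrib_left mult.left_commute)
  then show ?thesis by (simp add: sum_distrib_left mult.assoc)
qed

end

text \<open>The first-order condition at a minimum: the polynomial is the variation of a nonnegative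
  form around a zero, and \<open>p\<close> is half its slope there.\<close>

lemma nonneg_quadratic_linear_zero:
  fixes p r :: real
  assumes "\<And>t. 0 \<le> 2 * t * p + t\<^sup>2 * r"
  shows "p = 0"
proof (rule ccontr)
  assume p: "p \<noteq> 0"
  \<comment> \<open>A strictly positive bound on \<open>r\<close>, so that
    \<open>t = - p / R\<close> is a legitimate test value whatever the sign of
    \<open>r\<close>.\<close>
  define R where "R = \<bar>r\<bar> + 1"
  have R: "R > 0" "r \<le> R" by (auto simp: R_def)
  have "0 \<le> 2 * (- p / R) * p + (- p / R)\<^sup>2 * r" by (rule assms)
  also have "\<dots> \<le> 2 * (- p / R) * p + (- p / R)\<^sup>2 * R"
    using R by (intro add_left_mono mult_left_mono) auto
  also have "\<dots> = - (p\<^sup>2 / R)"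
    using R by (simp add: power2_eq_square field_simps)
  finally have "p\<^sup>2 / R \<le> 0" by simp
  moreover have "p\<^sup>2 / R > 0" using p R by simp
  ultimately show False by simp
qed

context psd_form
begin

lemma cauchy_schwarz:
  assumes "x \<in> V" "y \<in> V"
  shows "(f x y)\<^sup>2 \<le> f x x * f y y"
proof (cases "f y y = 0")
  case True
  have "f x y = 0"
  proof (rule ccontr)
    assume "f x y \<noteq> 0"
    \<comment> \<open>Without a quadratic term the expression is affine in \<open>t\<close>; this
      \<open>t\<close> gives it the value -1.\<close>
    define t where "t = - (f x x + 1) / (2 * f x y)"
    have "0 \<le> f (x + t *\<^sub>R y) (x + t *\<^sub>R y)" using assms by (intro nonneg) auto
    also have "\<dots> = f x x + 2 * t * f x y" using assms True by (simp add: square_add_scale)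
    also have "2 * t * f x y = - (f x x + 1)" using \<open>f x y \<noteq> 0\<close> by (simp add: t_def)
    also have "f x x + - (f x x + 1) = -1" by simp
    finally show False by simp
  qed
  then show ?thesis using True by simp
next
  case False
  then have pos: "f y y > 0" using nonneg[OF assms(2)] by simp
  \<comment> \<open>The minimizer of the quadratic in \<open>t\<close>.\<close>
  define t where "t = - f x y / f y y"
  have "0 \<le> f (x + t *\<^sub>R y) (x + t *\<^sub>R y)" using assms by (intro nonneg) auto
  also have "\<dots> = f x x + 2 * t * f x y + t\<^sup>2 * f y y" using assms by (rule square_add_scale)
  also have "\<dots> = f x x - (f x y)\<^sup>2 / f y y"
    using pos by (simp add: t_def power2_eq_square field_simps)
  finally show ?thesis using pos by (simp add: field_simps)
qed

definition nrm where "nrm x = sqrt (f x x)"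

lemma nrm_nonneg [simp]: "x \<in> V \<Longrightarrow> 0 \<le> nrm x"
  by (simp add: nrm_def nonneg)

lemma nrm_square: "x \<in> V \<Longrightarrow> (nrm x)\<^sup>2 = f x x"
  by (simp add: nrm_def nonneg)

lemma abs_le_nrm: "\<lbrakk>x \<in> V; y \<in> V\<rbrakk> \<Longrightarrow> \<bar>f x y\<bar> \<le> nrm x * nrm y"
  unfolding nrm_def real_sqrt_mult[symmetric] by (intro real_le_rsqrt) (simp add: cauchy_schwarz)

lemma nrm_scale: "x \<in> V \<Longrightarrow> nrm (c *\<^sub>R x) = \<bar>c\<bar> * nrm x"
  by (simp add: nrm_def expand mult.assoc[symmetric] real_sqrt_mult)

lemma nrm_triangle:
  assumes "x \<in> V" "y \<in> V"
  shows "nrm (x + y) \<le> nrm x + nrm y"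
proof -
  have "(nrm (x + y))\<^sup>2 = f x x + 2 * f x y + f y y"
    using assms square_add_scale[of x y 1] by (simp add: nrm_square)
  also have "\<dots> \<le> (nrm x)\<^sup>2 + 2 * (nrm x * nrm y) + (nrm y)\<^sup>2"
    using assms abs_le_nrm[of x y] by (simp add: nrm_square)
  also have "\<dots> = (nrm x + nrm y)\<^sup>2" by (simp add: power2_sum)
  finally show ?thesis using assms by (simp add: power2_le_iff_abs_le abs_le_square_iff[symmetric])
qed

lemma nrm_minus_commute: "\<lbrakk>x \<in> V; y \<in> V\<rbrakk> \<Longrightarrow> nrm (x - y) = nrm (y - x)"
  using nrm_scale[of "x - y" "-1"] by simp

lemma nrm_triangle_diff: "\<lbrakk>x \<in> V; y \<in> V; z \<in> V\<rbrakk> \<Longrightarrow> nrm (x - z) \<le> nrm (x - y) + nrm (y - z)"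
  using nrm_triangle[of "x - y" "y - z"] by simp

lemma nrm_reverse_triangle: "\<lbrakk>x \<in> V; y \<in> V\<rbrakk> \<Longrightarrow> \<bar>nrm x - nrm y\<bar> \<le> nrm (x - y)"
  using nrm_triangle[of "x - y" y] nrm_triangle[of "y - x" x] nrm_minus_commute[of x y] by simp

text \<open>Representatives of the completion, kept as sequences: two of them name the same element
  when the limit seminorm of their difference is 0. For the Sobolev form on smooth functions this
  set is \<open>sobolev_cauchy\<close>.\<close>

definition cauchy_seqs :: "(nat \<Rightarrow> 'v) set" where
  "cauchy_seqs = {s. range s \<subseteq> V \<and> (\<forall>e>0. \<exists>N. \<forall>m\<ge>N. \<forall>n\<ge>N. nrm (s m - s n) < e)}"

lemma cauchy_seqs_mem: "s \<in> cauchy_seqs \<Longrightarrow> s n \<in> V"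
  by (auto simp: cauchy_seqs_def)

lemma cauchy_seqsE:
  assumes "s \<in> cauchy_seqs" "e > 0"
  obtains N where "\<And>m n. \<lbrakk>m \<ge> N; n \<ge> N\<rbrakk> \<Longrightarrow> nrm (s m - s n) < e"
  using assms(1)[unfolded cauchy_seqs_def, THEN CollectD, THEN conjunct2, rule_format, OF assms(2)] that
  by blast

lemma const_cauchy_seqs: "x \<in> V \<Longrightarrow> (\<lambda>_. x) \<in> cauchy_seqs"
  by (auto simp: cauchy_seqs_def nrm_def)

lemma subspace_cauchy_seqs: "subspace cauchy_seqs"
proof (rule subspaceI)
  show "0 \<in> cauchy_seqs" using const_cauchy_seqs[of 0] by (simp add: zero_fun_def)
next
  fix s t assume s: "s \<in> cauchy_seqs" and t: "t \<in> cauchy_seqs"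
  note [simp] = cauchy_seqs_mem[OF s] cauchy_seqs_mem[OF t]
  have "\<exists>N. \<forall>m\<ge>N. \<forall>n\<ge>N. nrm ((s + t) m - (s + t) n) < e" if "e > 0" for e
  proof -
    have e: "e / 2 > 0" using that by simp
    obtain M where M: "\<And>m n. \<lbrakk>m \<ge> M; n \<ge> M\<rbrakk> \<Longrightarrow> nrm (s m - s n) < e / 2"
      using cauchy_seqsE[OF s e] by blast
    obtain N where N: "\<And>m n. \<lbrakk>m \<ge> N; n \<ge> N\<rbrakk> \<Longrightarrow> nrm (t m - t n) < e / 2"
      using cauchy_seqsE[OF t e] by blast
    show ?thesis
    proof (intro exI[of _ "max M N"] allI impI)
      fix m n assume "m \<ge> max M N" "n \<ge> max M N"
      then have "nrm (s m - s n) < e / 2" "nrm (t m - t n) < e / 2" using M N by auto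
      moreover have "nrm ((s m - s n) + (t m - t n)) \<le> nrm (s m - s n) + nrm (t m - t n)"
        by (intro nrm_triangle) simp_all
      ultimately show "nrm ((s + t) m - (s + t) n) < e" by (simp add: algebra_simps)
    qed
  qed
  then show "s + t \<in> cauchy_seqs" by (auto simp: cauchy_seqs_def)
next
  fix c s assume s: "s \<in> cauchy_seqs"
  note [simp] = cauchy_seqs_mem[OF s]
  have "\<exists>N. \<forall>m\<ge>N. \<forall>n\<ge>N. nrm ((c *\<^sub>R s) m - (c *\<^sub>R s) n) < e" if "e > 0" for e
  proof -
    have e: "e / (\<bar>c\<bar> + 1) > 0" using that by (simp add: add_nonneg_pos)
    obtain N where N: "\<And>m n. \<lbrakk>m \<ge> N; n \<ge> N\<rbrakk> \<Longrightarrow> nrm (s m - s n) < e / (\<bar>c\<bar> + 1)"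
      using cauchy_seqsE[OF s e] by blast
    show ?thesis
    proof (intro exI[of _ N] allI impI)
      fix m n assume "m \<ge> N" "n \<ge> N"
      then have "nrm (s m - s n) * (\<bar>c\<bar> + 1) < e" using N by (simp add: pos_less_divide_eq add_nonneg_pos)
      then have "\<bar>c\<bar> * nrm (s m - s n) + nrm (s m - s n) < e" by (simp add: algebra_simps)
      moreover have "nrm ((c *\<^sub>R s) m - (c *\<^sub>R s) n) = \<bar>c\<bar> * nrm (s m - s n)"
        by (simp add: scaleR_diff_right[symmetric] nrm_scale)
      moreover have "0 \<le> nrm (s m - s n)" by simp
      ultimately show "nrm ((c *\<^sub>R s) m - (c *\<^sub>R s) n) < e" by linarith
    qed
  qed
  then show "c *\<^sub>R s \<in> cauchy_seqs" by (auto simp: cauchy_seqs_def)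
qed

lemma convergent_nrm:
  assumes s: "s \<in> cauchy_seqs"
  shows "convergent (\<lambda>n. nrm (s n))"
proof -
  have "Cauchy (\<lambda>n. nrm (s n))"
  proof (rule metric_CauchyI)
    fix e :: real assume "e > 0"
    then obtain N where N: "\<And>m n. \<lbrakk>m \<ge> N; n \<ge> N\<rbrakk> \<Longrightarrow> nrm (s m - s n) < e"
      using cauchy_seqsE[OF s] by blast
    then show "\<exists>N. \<forall>m\<ge>N. \<forall>n\<ge>N. dist (nrm (s m)) (nrm (s n)) < e"
      using le_less_trans[OF nrm_reverse_triangle[OF cauchy_seqs_mem[OF s] cauchy_seqs_mem[OF s]]]
      unfolding dist_real_def by blast
  qed
  then show ?thesis by (simp add: Cauchy_convergent_iff)
qed

text \<open>Polarization reduces the convergence of mixed terms to that of the seminorms of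
  \<open>s + t\<close> and \<open>s - t\<close>.\<close>

lemma convergent_form:
  assumes s: "s \<in> cauchy_seqs" and t: "t \<in> cauchy_seqs"
  shows "convergent (\<lambda>n. f (s n) (t n))"
proof -
  note [simp] = cauchy_seqs_mem[OF s] cauchy_seqs_mem[OF t]
  have "s + t \<in> cauchy_seqs" "s - t \<in> cauchy_seqs"
    using subspace_cauchy_seqs s t by (auto simp: subspace_add subspace_diff)
  then obtain k l where kl: "(\<lambda>n. nrm ((s + t) n)) \<longlonglongrightarrow> k" "(\<lambda>n. nrm ((s - t) n)) \<longlonglongrightarrow> l"
    using convergent_nrm unfolding convergent_def by blast
  have "f (s n) (t n) = ((nrm ((s + t) n))\<^sup>2 - (nrm ((s - t) n))\<^sup>2) / 4" for n
    using sym[of "t n" "s n"] by (simp add: nrm_square expand)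
  moreover have "(\<lambda>n. ((nrm ((s + t) n))\<^sup>2 - (nrm ((s - t) n))\<^sup>2) / 4) \<longlonglongrightarrow> (k\<^sup>2 - l\<^sup>2) / 4"
    by (intro tendsto_intros kl) auto
  ultimately have "(\<lambda>n. f (s n) (t n)) \<longlonglongrightarrow> (k\<^sup>2 - l\<^sup>2) / 4" by presburger
  then show ?thesis unfolding convergent_def by blast
qed

lemma nrm_tendsto_unique:
  assumes s: "\<And>n. s n \<in> V" and t: "\<And>n. t n \<in> V" and "(\<lambda>n. nrm (s n - t n)) \<longlonglongrightarrow> 0"
    and "(\<lambda>n. nrm (s n)) \<longlonglongrightarrow> l"
  shows "(\<lambda>n. nrm (t n)) \<longlonglongrightarrow> l"
proof -
  have "(\<lambda>n. nrm (t n) - nrm (s n)) \<longlonglongrightarrow> 0"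
  proof (rule Lim_null_comparison[OF always_eventually assms(3)], rule allI)
    fix n
    show "norm (nrm (t n) - nrm (s n)) \<le> nrm (s n - t n)"
      using nrm_reverse_triangle[OF t s, of n n] nrm_minus_commute[OF t s, of n n] by simp
  qed
  from tendsto_add[OF this assms(4)] show ?thesis by simp
qed

subsection \<open>Completion\<close>

definition lim_form :: "(nat \<Rightarrow> 'v) \<Rightarrow> (nat \<Rightarrow> 'v) \<Rightarrow> real" where
  "lim_form s t = lim (\<lambda>n. f (s n) (t n))"

lemma tendsto_lim_form:
  "\<lbrakk>s \<in> cauchy_seqs; t \<in> cauchy_seqs\<rbrakk> \<Longrightarrow> (\<lambda>n. f (s n) (t n)) \<longlonglongrightarrow> lim_form s t"
  using convergent_form by (simp add: lim_form_def convergent_LIMSEQ_iff)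

lemma lim_form_eqI:
  "\<lbrakk>s \<in> cauchy_seqs; t \<in> cauchy_seqs; (\<lambda>n. f (s n) (t n)) \<longlonglongrightarrow> l\<rbrakk> \<Longrightarrow> lim_form s t = l"
  using tendsto_lim_form LIMSEQ_unique by blast

text \<open>The subspace \<open>W\<close> is left free because the limits of two different forms are
  later restricted to the sequences that are Cauchy for their sum.\<close>

lemma psd_form_lim_form:
  assumes "subspace W" "W \<subseteq> cauchy_seqs"
  shows "psd_form W lim_form"
proof
  note W = subsetD[OF assms(2)]
  note [simp] = cauchy_seqs_mem[OF W]
  show "subspace W" by fact
  fix x y assume xy: "x \<in> W" "y \<in> W"
  {
    fix z assume z: "z \<in> W"
    have "(\<lambda>n. f (x n) (z n) + f (y n) (z n)) \<longlonglongrightarrow> lim_form x z + lim_form y z"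
      using xy z W by (intro tendsto_add tendsto_lim_form)
    then show "lim_form (x + y) z = lim_form x z + lim_form y z"
      using xy z W subspace_add[OF assms(1)] by (intro lim_form_eqI) (simp_all add: expand)
  }
  {
    fix c
    have "(\<lambda>n. c * f (x n) (y n)) \<longlonglongrightarrow> c * lim_form x y"
      using xy W by (intro tendsto_intros tendsto_lim_form)
    then show "lim_form (c *\<^sub>R x) y = c * lim_form x y"
      using xy W subspace_scale[OF assms(1)] by (intro lim_form_eqI) (simp_all add: expand)
  }
  have "(\<lambda>n. f (y n) (x n)) \<longlonglongrightarrow> lim_form x y"
    using tendsto_lim_form[of x y] xy W sym by simp
  then show "lim_form x y = lim_form y x"
    using xy W by (intro lim_form_eqI[symmetric])
  show "0 \<le> lim_form x x"
    using tendsto_lim_form[of x x] xy W by (intro LIMSEQ_le_const) (auto intro!: nonneg)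
qed

end

context psd_form
begin

interpretation lim: psd_form cauchy_seqs lim_form
  by (intro psd_form_lim_form subspace_cauchy_seqs order_refl)

lemma lim_form_const: "\<lbrakk>x \<in> V; y \<in> V\<rbrakk> \<Longrightarrow> lim_form (\<lambda>_. x) (\<lambda>_. y) = f x y"
  by (intro lim_form_eqI const_cauchy_seqs) auto

lemma tendsto_lim_nrm: "s \<in> cauchy_seqs \<Longrightarrow> (\<lambda>n. nrm (s n)) \<longlonglongrightarrow> lim.nrm s"
  unfolding nrm_def lim.nrm_def by (intro tendsto_real_sqrt tendsto_lim_form)

lemma lim_nrm_const: "x \<in> V \<Longrightarrow> lim.nrm (\<lambda>_. x) = nrm x"
  by (simp add: nrm_def lim.nrm_def lim_form_const)

text \<open>Density of the original space in its completion: the constant sequences at the members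
  of \<open>s\<close> approach \<open>s\<close>.\<close>

lemma const_tendsto:
  assumes s: "s \<in> cauchy_seqs"
  shows "(\<lambda>n. lim.nrm (s - (\<lambda>_. s n))) \<longlonglongrightarrow> 0"
proof (rule LIMSEQ_I)
  fix e :: real assume e: "e > 0"
  then have "e / 2 > 0" by simp
  then obtain N where N: "\<And>m n. \<lbrakk>m \<ge> N; n \<ge> N\<rbrakk> \<Longrightarrow> nrm (s m - s n) < e / 2"
    using cauchy_seqsE[OF s] by blast
  have "norm (lim.nrm (s - (\<lambda>_. s n)) - 0) < e" if n: "n \<ge> N" for n
  proof -
    have mem: "s - (\<lambda>_. s n) \<in> cauchy_seqs"
      using s const_cauchy_seqs[OF cauchy_seqs_mem[OF s]] by simp
    have "lim.nrm (s - (\<lambda>_. s n)) \<le> e / 2"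
    proof (rule LIMSEQ_le_const2[OF tendsto_lim_nrm[OF mem]], intro exI[of _ N] allI impI)
      fix m assume "m \<ge> N"
      then show "nrm ((s - (\<lambda>_. s n)) m) \<le> e / 2"
        using N[OF _ n, of m] by simp
    qed
    then show ?thesis using e lim.nrm_nonneg[OF mem] by simp
  qed
  then show "\<exists>N. \<forall>n\<ge>N. norm (lim.nrm (s - (\<lambda>_. s n)) - 0) < e" by blast
qed

text \<open>A diagonal argument: replace \<open>S n\<close> by a constant sequence at distance below
  1 / (n + 1). The values of these constants form a Cauchy sequence of the original space, and that
  sequence is the limit.\<close>

lemma lim_complete:
  assumes S: "S \<in> lim.cauchy_seqs"
  shows "\<exists>l\<in>cauchy_seqs. (\<lambda>n. lim.nrm (S n - l)) \<longlonglongrightarrow> 0"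
proof -
  note Sn [simp] = lim.cauchy_seqs_mem[OF S]
  have "\<exists>j. lim.nrm (S n - (\<lambda>_. S n j)) < inverse (real (Suc n))" for n
  proof -
    have "inverse (real (Suc n)) > 0" by simp
    from order_tendstoD(2)[OF const_tendsto[OF Sn] this] show ?thesis
      by (auto simp: eventually_sequentially)
  qed
  then obtain J where J: "\<And>n. lim.nrm (S n - (\<lambda>_. S n (J n))) < inverse (real (Suc n))" by metis
  define l where "l n = S n (J n)" for n
  have lV [simp]: "l n \<in> V" for n unfolding l_def by (rule cauchy_seqs_mem) simp
  note const_l [simp] = const_cauchy_seqs[OF lV]
  have Jl: "lim.nrm (S n - (\<lambda>_. l n)) < inverse (real (Suc n))" for n
    using J by (simp add: l_def)
  have const_diff: "(\<lambda>_. l m) - (\<lambda>_. l n) = (\<lambda>_. l m - l n)" for m n by auto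
  have "l \<in> cauchy_seqs" unfolding cauchy_seqs_def
  proof (intro CollectI conjI allI impI)
    show "range l \<subseteq> V" by auto
    fix e :: real assume "e > 0"
    then have e: "e / 3 > 0" by simp
    obtain N1 where N1: "\<And>m n. \<lbrakk>m \<ge> N1; n \<ge> N1\<rbrakk> \<Longrightarrow> lim.nrm (S m - S n) < e / 3"
      using lim.cauchy_seqsE[OF S e] by blast
    obtain N2 where N2: "inverse (real (Suc N2)) < e / 3" using reals_Archimedean[OF e] by blast
    show "\<exists>N. \<forall>m\<ge>N. \<forall>n\<ge>N. nrm (l m - l n) < e"
    proof (intro exI[of _ "max N1 N2"] allI impI)
      fix m n assume mn: "m \<ge> max N1 N2" "n \<ge> max N1 N2"
      have "inverse (real (Suc m)) \<le> inverse (real (Suc N2))" "inverse (real (Suc n)) \<le> inverse (real (Suc N2))"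
        using mn by auto
      then have "lim.nrm (S m - (\<lambda>_. l m)) < e / 3" "lim.nrm (S n - (\<lambda>_. l n)) < e / 3"
        using Jl[of m] Jl[of n] N2 by linarith+
      moreover have "lim.nrm (S m - S n) < e / 3" using N1 mn by simp
      moreover have "lim.nrm ((\<lambda>_. l m) - (\<lambda>_. l n)) \<le> lim.nrm ((\<lambda>_. l m) - S m) + lim.nrm (S m - (\<lambda>_. l n))"
        by (intro lim.nrm_triangle_diff) simp_all
      moreover have "lim.nrm (S m - (\<lambda>_. l n)) \<le> lim.nrm (S m - S n) + lim.nrm (S n - (\<lambda>_. l n))"
        by (intro lim.nrm_triangle_diff) simp_all
      moreover have "lim.nrm ((\<lambda>_. l m) - S m) = lim.nrm (S m - (\<lambda>_. l m))"
        by (intro lim.nrm_minus_commute) simp_all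
      moreover have "lim.nrm ((\<lambda>_. l m) - (\<lambda>_. l n)) = nrm (l m - l n)"
        by (simp add: const_diff lim_nrm_const)
      ultimately show "nrm (l m - l n) < e" by linarith
    qed
  qed
  note l = this
  have "(\<lambda>n. inverse (real (Suc n)) + lim.nrm (l - (\<lambda>_. l n))) \<longlonglongrightarrow> 0 + 0"
    by (intro tendsto_add LIMSEQ_inverse_real_of_nat const_tendsto l)
  then have lim0: "(\<lambda>n. inverse (real (Suc n)) + lim.nrm (l - (\<lambda>_. l n))) \<longlonglongrightarrow> 0" by simp
  have "(\<lambda>n. lim.nrm (S n - l)) \<longlonglongrightarrow> 0"
  proof (rule Lim_null_comparison[OF always_eventually lim0], rule allI)
    fix n
    have "lim.nrm (S n - l) \<le> lim.nrm (S n - (\<lambda>_. l n)) + lim.nrm ((\<lambda>_. l n) - l)"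
      using l by (intro lim.nrm_triangle_diff) simp_all
    moreover have "lim.nrm ((\<lambda>_. l n) - l) = lim.nrm (l - (\<lambda>_. l n))"
      using l by (intro lim.nrm_minus_commute) simp_all
    moreover have "0 \<le> lim.nrm (S n - l)" using l by simp
    ultimately show "norm (lim.nrm (S n - l)) \<le> inverse (real (Suc n)) + lim.nrm (l - (\<lambda>_. l n))"
      using Jl[of n] by simp
  qed
  then show ?thesis using l by blast
qed

end

section \<open>Two forms on one space and their common completion\<close>

locale psd_pair = A: psd_form V a + B: psd_form V b for V :: "'v::real_vector set" and a b
begin

definition "q x y = a x y + b x y"

end

sublocale psd_pair \<subseteq> Q: psd_form V q
  by unfold_locales (auto simp: q_def A.subspace A.expand B.expand algebra_simps A.nonneg B.nonneg intro!: arg_cong2[where f = "(+)"] A.sym B.sym)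

context psd_pair
begin

lemma nrm_le_Q: "x \<in> V \<Longrightarrow> A.nrm x \<le> Q.nrm x" "x \<in> V \<Longrightarrow> B.nrm x \<le> Q.nrm x"
  by (auto simp: A.nrm_def B.nrm_def Q.nrm_def q_def A.nonneg B.nonneg)

lemma cauchy_seqs_Q: "Q.cauchy_seqs \<subseteq> A.cauchy_seqs" "Q.cauchy_seqs \<subseteq> B.cauchy_seqs"
proof -
  have "s \<in> A.cauchy_seqs \<inter> B.cauchy_seqs" if s: "s \<in> Q.cauchy_seqs" for s
  proof -
    have V: "s n \<in> V" for n using s by (rule Q.cauchy_seqs_mem)
    have "\<exists>N. \<forall>m\<ge>N. \<forall>n\<ge>N. A.nrm (s m - s n) < e \<and> B.nrm (s m - s n) < e" if e: "e > 0" for e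
    proof -
      obtain N where N: "\<And>m n. \<lbrakk>m \<ge> N; n \<ge> N\<rbrakk> \<Longrightarrow> Q.nrm (s m - s n) < e"
        using Q.cauchy_seqsE[OF s e] by blast
      have "s m - s n \<in> V" for m n using V by simp
      from nrm_le_Q[OF this] N show ?thesis by (meson le_less_trans)
    qed
    then have "\<forall>e>0. \<exists>N. \<forall>m\<ge>N. \<forall>n\<ge>N. A.nrm (s m - s n) < e" "\<forall>e>0. \<exists>N. \<forall>m\<ge>N. \<forall>n\<ge>N. B.nrm (s m - s n) < e"
      by meson+
    then show ?thesis using V unfolding A.cauchy_seqs_def B.cauchy_seqs_def by auto
  qed
  then show "Q.cauchy_seqs \<subseteq> A.cauchy_seqs" "Q.cauchy_seqs \<subseteq> B.cauchy_seqs" by auto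
qed

lemma lim_form_Q:
  assumes "s \<in> Q.cauchy_seqs" "t \<in> Q.cauchy_seqs"
  shows "Q.lim_form s t = A.lim_form s t + B.lim_form s t"
proof (intro Q.lim_form_eqI assms)
  show "(\<lambda>n. q (s n) (t n)) \<longlonglongrightarrow> A.lim_form s t + B.lim_form s t"
    unfolding q_def using assms cauchy_seqs_Q
    by (intro tendsto_add A.tendsto_lim_form B.tendsto_lim_form) auto
qed

text \<open>A sequence that is Cauchy for the sum is Cauchy for each summand, so both forms extend
  to the same completion. This makes the Sobolev space again an instance of
  \<open>psd_pair\<close>.\<close>

lemma psd_pair_lim: "psd_pair Q.cauchy_seqs A.lim_form B.lim_form"
  by (intro psd_pair.intro A.psd_form_lim_form B.psd_form_lim_form Q.subspace_cauchy_seqs cauchy_seqs_Q)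

end

section \<open>The spectral theorem for a pair of forms\<close>

text \<open>A homogeneous system with more unknowns than equations has a nonzero solution, by
  Gaussian elimination. The unknowns have an arbitrary index set because they will be indexed by a
  set of functions.\<close>

lemma underdetermined_system:
  fixes M :: "'i \<Rightarrow> nat \<Rightarrow> real"
  assumes "finite I" "k < card I"
  shows "\<exists>c. (\<exists>i\<in>I. c i \<noteq> 0) \<and> (\<forall>j<k. (\<Sum>i\<in>I. c i * M i j) = 0)"
  using assms
proof (induction k arbitrary: I M)
  case 0
  then obtain i where "i \<in> I" by fastforce
  then show ?case by (intro exI[of _ "\<lambda>_. 1"]) auto
next
  case (Suc k)
  show ?case
  proof (cases "\<forall>i\<in>I. M i k = 0")
    case True
    obtain c where "\<exists>i\<in>I. c i \<noteq> 0" "\<forall>j<k. (\<Sum>i\<in>I. c i * M i j) = 0"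
      using Suc.IH[of I M] Suc.prems by auto
    then show ?thesis using True by (intro exI[of _ c]) (auto simp: less_Suc_eq)
  next
    case False
    then obtain p where p: "p \<in> I" "M p k \<noteq> 0" by blast
    \<comment> \<open>Elimination with pivot row \<open>p\<close>: the column \<open>k\<close> of
      \<open>M'\<close> vanishes.\<close>
    define M' where "M' i j = M i j - M i k / M p k * M p j" for i j
    obtain c where c: "\<exists>i\<in>I - {p}. c i \<noteq> 0" "\<And>j. j < k \<Longrightarrow> (\<Sum>i\<in>I - {p}. c i * M' i j) = 0"
    proof -
      have "finite (I - {p})" "k < card (I - {p})" using Suc.prems p by (auto simp: card_Diff_singleton_if)
      from Suc.IH[OF this, of M'] show ?thesis using that by blast
    qed
    \<comment> \<open>The coefficient of the pivot row, fixed by equation \<open>k\<close>; the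
      other equations then follow from those for \<open>M'\<close>.\<close>
    define r where "r = - (\<Sum>i\<in>I - {p}. c i * M i k) / M p k"
    define d where "d = c(p := r)"
    have split: "(\<Sum>i\<in>I. d i * M i j) = (\<Sum>i\<in>I - {p}. c i * M i j) + r * M p j" for j
      using p Suc.prems by (simp add: sum.remove[of I p] d_def)
    have "(\<Sum>i\<in>I - {p}. c i * M' i j) = (\<Sum>i\<in>I - {p}. c i * M i j) + r * M p j" for j
      by (simp add: M'_def r_def right_diff_distrib sum_subtractf sum_divide_distrib sum_distrib_right
          sum_negf mult.assoc)
    moreover have "(\<Sum>i\<in>I - {p}. c i * M' i k) = 0"
      using p by (simp add: M'_def)
    ultimately have "\<forall>j<Suc k. (\<Sum>i\<in>I. d i * M i j) = 0"
      unfolding split by (metis c(2) less_Suc_eq)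
    moreover have "\<exists>i\<in>I. d i \<noteq> 0" using c(1) by (auto simp: d_def)
    ultimately show ?thesis by blast
  qed
qed

context psd_form
begin

text \<open>More than \<open>k\<close> independent vectors have a combination of positive length
  orthogonal to \<open>k\<close> given ones. It serves twice: the constraint set of the minimization
  is nonempty, and every test space meets the complement of the first eigenfunctions.\<close>

lemma independent_orthogonal:
  assumes w: "\<And>i. i \<in> I \<Longrightarrow> w i \<in> V" and e: "\<And>j. j < k \<Longrightarrow> e j \<in> V"
    and I: "finite I" "k < card I"
    and indep: "\<And>c. f (\<Sum>i\<in>I. c i *\<^sub>R w i) (\<Sum>i\<in>I. c i *\<^sub>R w i) = 0 \<Longrightarrow> \<forall>i\<in>I. c i = 0"
  obtains c where "f (\<Sum>i\<in>I. c i *\<^sub>R w i) (\<Sum>i\<in>I. c i *\<^sub>R w i) > 0"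
    "\<And>j. j < k \<Longrightarrow> f (\<Sum>i\<in>I. c i *\<^sub>R w i) (e j) = 0"
proof -
  obtain c where c: "\<exists>i\<in>I. c i \<noteq> 0" "\<And>j. j < k \<Longrightarrow> (\<Sum>i\<in>I. c i * f (w i) (e j)) = 0"
    using underdetermined_system[OF I, of "\<lambda>i j. f (w i) (e j)"] by blast
  have "f (\<Sum>i\<in>I. c i *\<^sub>R w i) (\<Sum>i\<in>I. c i *\<^sub>R w i) \<noteq> 0" using indep c(1) by blast
  moreover have "0 \<le> f (\<Sum>i\<in>I. c i *\<^sub>R w i) (\<Sum>i\<in>I. c i *\<^sub>R w i)" using w by (intro nonneg) auto
  moreover have "f (\<Sum>i\<in>I. c i *\<^sub>R w i) (e j) = 0" if "j < k" for j
    using w e[OF that] c(2)[OF that] by (subst sum_left) (auto simp: scale_left)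
  ultimately show ?thesis by (intro that[of c]) simp_all
qed

end

text \<open>The abstract form of the Sobolev space with a compact map into L2. Compactness asks only
  for a \<open>b\<close>-Cauchy subsequence, because the L2 limit need not come from an element of
  \<open>V\<close>. The last assumption keeps the successive minimization from ending.\<close>

locale compact_pair = psd_pair +
  assumes complete: "s \<in> Q.cauchy_seqs \<Longrightarrow> \<exists>l\<in>V. (\<lambda>n. Q.nrm (s n - l)) \<longlonglongrightarrow> 0"
    and compact: "\<lbrakk>\<And>n. s n \<in> V; \<And>n. Q.nrm (s n) \<le> C\<rbrakk> \<Longrightarrow>
      \<exists>r :: nat \<Rightarrow> nat. strict_mono r \<and> s \<circ> r \<in> B.cauchy_seqs"
    and infinite_dim: "\<exists>w. (\<forall>i<k::nat. w i \<in> V) \<and>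
      (\<forall>c. b (\<Sum>i<k. c i *\<^sub>R w i) (\<Sum>i<k. c i *\<^sub>R w i) = 0 \<longrightarrow> (\<forall>i<k. c i = 0))"
begin

definition perp :: "(nat \<Rightarrow> 'a) \<Rightarrow> nat \<Rightarrow> 'a set" where
  "perp e k = {w \<in> V. \<forall>i<k. b w (e i) = 0}"

lemma perpD: "w \<in> perp e k \<Longrightarrow> w \<in> V" "\<lbrakk>w \<in> perp e k; i < k\<rbrakk> \<Longrightarrow> b w (e i) = 0"
  by (auto simp: perp_def)

lemma subspace_perp: "(\<And>i. i < k \<Longrightarrow> e i \<in> V) \<Longrightarrow> subspace (perp e k)"
  by (rule subspaceI) (auto simp: perp_def B.expand)

text \<open>Homogeneity removes the normalization \<open>b w w = 1\<close>; vectors null for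
  \<open>b\<close> are covered by nonnegativity of \<open>a\<close>.\<close>

lemma perp_scaled_inequality:
  assumes e: "\<And>i. i < k \<Longrightarrow> e i \<in> V"
    and le: "\<And>w. \<lbrakk>w \<in> perp e k; b w w = 1\<rbrakk> \<Longrightarrow> m \<le> a w w"
    and w: "w \<in> perp e k"
  shows "m * b w w \<le> a w w"
proof (cases "b w w = 0")
  case True
  then show ?thesis using w by (simp add: perpD A.nonneg)
next
  case False
  have [simp]: "w \<in> V" using w by (rule perpD)
  have pos: "b w w > 0" using False B.nonneg[of w] by simp
  define c where "c = 1 / sqrt (b w w)"
  have c2: "c * c = 1 / b w w" using pos by (simp add: c_def)
  have "b (c *\<^sub>R w) (c *\<^sub>R w) = 1" using c2 pos by (simp add: B.expand mult.assoc[symmetric])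
  then have "m \<le> a (c *\<^sub>R w) (c *\<^sub>R w)"
    using subspace_perp[OF e] w by (intro le subspace_scale) auto
  also have "\<dots> = a w w / b w w" using c2 by (simp add: A.expand mult.assoc[symmetric])
  finally show ?thesis using pos by (simp add: field_simps)
qed

text \<open>A minimizing sequence converges in the full norm: a subsequence is Cauchy for \<open>b\<close> by compactness,
  and then for \<open>a\<close> by the parallelogram identity.\<close>

lemma rayleigh_minimizer:
  assumes e [simp]: "\<And>i. i < k \<Longrightarrow> e i \<in> V"
  shows "\<exists>u\<in>perp e k. b u u = 1 \<and> (\<forall>w\<in>perp e k. a u u * b w w \<le> a w w)"
proof -
  let ?S = "{w \<in> perp e k. b w w = 1}"
  let ?m = "INF w\<in>?S. a w w"
  obtain w0 where "w0 \<in> ?S"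
  proof -
    obtain w where w: "\<And>i. i < Suc k \<Longrightarrow> w i \<in> V"
      "\<And>c. b (\<Sum>i<Suc k. c i *\<^sub>R w i) (\<Sum>i<Suc k. c i *\<^sub>R w i) = 0 \<Longrightarrow> \<forall>i<Suc k. c i = 0"
      using infinite_dim[of "Suc k"] by blast
    obtain c where c: "b (\<Sum>i<Suc k. c i *\<^sub>R w i) (\<Sum>i<Suc k. c i *\<^sub>R w i) > 0"
      "\<And>j. j < k \<Longrightarrow> b (\<Sum>i<Suc k. c i *\<^sub>R w i) (e j) = 0"
      using B.independent_orthogonal[of "{..<Suc k}" w k e] w by auto
    define x where "x = (\<Sum>i<Suc k. c i *\<^sub>R w i)"
    have x: "x \<in> V" unfolding x_def using w(1) by (intro B.mem_sum B.mem_simps) auto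
    have px: "b x x > 0" using c(1) by (simp only: x_def)
    have "(1 / sqrt (b x x)) *\<^sub>R x \<in> ?S"
      using c(2)[folded x_def] x px by (auto simp: perp_def B.expand)
    then show ?thesis using that by blast
  qed
  then have ne: "?S \<noteq> {}" by blast
  have bdd: "bdd_below ((\<lambda>w. a w w) ` ?S)"
    by (rule bdd_belowI[of _ 0]) (auto simp: perp_def A.nonneg)
  have m0: "0 \<le> ?m" using ne by (intro cINF_greatest) (auto simp: perp_def A.nonneg)
  have m_le: "?m * b w w \<le> a w w" if "w \<in> perp e k" for w
    using e _ that by (rule perp_scaled_inequality) (auto intro!: cINF_lower bdd)
  have "\<exists>w\<in>?S. a w w < ?m + inverse (real (Suc n))" for n
  proof -
    have "?m < ?m + inverse (real (Suc n))" by simp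
    then show ?thesis using cINF_less_iff[OF ne bdd] by blast
  qed
  then have "\<forall>n. \<exists>w. w \<in> ?S \<and> a w w < ?m + inverse (real (Suc n))" by blast
  from choice[OF this] obtain s where
    s: "\<And>n. s n \<in> ?S" "\<And>n. a (s n) (s n) < ?m + inverse (real (Suc n))" by blast
  have sV [simp]: "s n \<in> V" for n using s(1) by (auto simp: perp_def)
  have sb: "b (s n) (s n) = 1" for n using s(1) by auto
  have "Q.nrm (s n) \<le> sqrt (?m + 2)" for n
  proof -
    have "inverse (real (Suc n)) \<le> 1" using inverse_le_1_iff by (simp add: field_simps)
    with s(2)[of n] show ?thesis by (simp add: Q.nrm_def q_def sb)
  qed
  then obtain r where r: "strict_mono r" "s \<circ> r \<in> B.cauchy_seqs"
    using compact[of s] sV by blast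
  define t where "t = s \<circ> r"
  have tV [simp]: "t n \<in> V" and tb [simp]: "b (t n) (t n) = 1" and tp: "t n \<in> perp e k" for n
    using sb s(1) by (auto simp: t_def)
  have ta: "a (t n) (t n) < ?m + inverse (real (Suc n))" for n
  proof -
    have "inverse (real (Suc (r n))) \<le> inverse (real (Suc n))"
      using seq_suble[OF r(1), of n] by simp
    then have "a (s (r n)) (s (r n)) < ?m + inverse (real (Suc n))" using s(2)[of "r n"] by linarith
    then show ?thesis by (simp only: t_def o_def)
  qed
  \<comment> \<open>Both \<open>t i\<close> and \<open>t j\<close> have energy close to
    \<open>?m\<close>, which contributes 4 \<open>?m\<close> on the right of the parallelogram
    identity. Minimality applied to \<open>t i + t j\<close>, whose squared \<open>b\<close>-length
    is 4 minus that of the difference, cancels it.\<close>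
  have Q_bound: "(Q.nrm (t i - t j))\<^sup>2 \<le>
      2 * inverse (real (Suc i)) + 2 * inverse (real (Suc j)) + (?m + 1) * (B.nrm (t i - t j))\<^sup>2" for i j
  proof -
    have "a (t i - t j) (t i - t j) = 2 * a (t i) (t i) + 2 * a (t j) (t j) - a (t i + t j) (t i + t j)"
      by (simp add: A.expand)
    moreover have "?m * b (t i + t j) (t i + t j) \<le> a (t i + t j) (t i + t j)"
      using tp subspace_perp[OF e] by (intro m_le subspace_add) auto
    moreover have "b (t i + t j) (t i + t j) = 4 - b (t i - t j) (t i - t j)"
      by (simp add: B.expand)
    ultimately have "a (t i - t j) (t i - t j) \<le>
        2 * inverse (real (Suc i)) + 2 * inverse (real (Suc j)) + ?m * b (t i - t j) (t i - t j)"
      using ta[of i] ta[of j] by (simp add: algebra_simps)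
    then show ?thesis by (simp add: Q.nrm_square B.nrm_square q_def distrib_right)
  qed
  have "t \<in> Q.cauchy_seqs" unfolding Q.cauchy_seqs_def
  proof (intro CollectI conjI allI impI)
    show "range t \<subseteq> V" by auto
    fix d :: real assume d: "d > 0"
    \<comment> \<open>The budget is half of \<open>d\<^sup>2\<close> for the two reciprocal terms
      and half for the \<open>b\<close>-term, which carries the factor
      \<open>?m + 1\<close>.\<close>
    define d1 where "d1 = d\<^sup>2 / 8"
    have d1: "d1 > 0" using d by (simp add: d1_def)
    define d2 where "d2 = sqrt (d\<^sup>2 / (2 * (?m + 1)))"
    have d2: "d2 > 0" and d2s: "d2\<^sup>2 = d\<^sup>2 / (2 * (?m + 1))" using d m0 by (simp_all add: d2_def)
    obtain N1 where N1: "inverse (real (Suc N1)) < d1" using reals_Archimedean[OF d1] by blast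
    obtain N2 where N2: "\<And>i j. \<lbrakk>i \<ge> N2; j \<ge> N2\<rbrakk> \<Longrightarrow> B.nrm (t i - t j) < d2"
      using B.cauchy_seqsE[OF r(2)[folded t_def] d2] by blast
    show "\<exists>N. \<forall>i\<ge>N. \<forall>j\<ge>N. Q.nrm (t i - t j) < d"
    proof (intro exI[of _ "max N1 N2"] allI impI)
      fix i j assume ij: "i \<ge> max N1 N2" "j \<ge> max N1 N2"
      have "inverse (real (Suc i)) \<le> inverse (real (Suc N1))" "inverse (real (Suc j)) \<le> inverse (real (Suc N1))"
        using ij by auto
      then have 1: "inverse (real (Suc i)) < d\<^sup>2 / 8" "inverse (real (Suc j)) < d\<^sup>2 / 8"
        using N1 unfolding d1_def by linarith+
      have "(B.nrm (t i - t j))\<^sup>2 < d2\<^sup>2" using N2[of i j] ij by (intro power_strict_mono) auto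
      then have "(?m + 1) * (B.nrm (t i - t j))\<^sup>2 < d\<^sup>2 / 2"
        using m0 by (simp add: d2s field_simps)
      then have "(Q.nrm (t i - t j))\<^sup>2 < d\<^sup>2"
        using Q_bound[of i j] 1 by linarith
      then show "Q.nrm (t i - t j) < d" using d by (simp add: power_less_imp_less_base)
    qed
  qed
  then obtain u where u [simp]: "u \<in> V" and tu: "(\<lambda>n. Q.nrm (t n - u)) \<longlonglongrightarrow> 0"
    using complete by blast
  have "(\<lambda>n. A.nrm (t n - u)) \<longlonglongrightarrow> 0" "(\<lambda>n. B.nrm (t n - u)) \<longlonglongrightarrow> 0"
    by (rule Lim_null_comparison[OF always_eventually tu]; simp add: nrm_le_Q)+
  note tuA = this(1) and tuB = this(2)
  have "(\<lambda>n. A.nrm (t n)) \<longlonglongrightarrow> A.nrm u" "(\<lambda>n. B.nrm (t n)) \<longlonglongrightarrow> B.nrm u"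
    using A.nrm_tendsto_unique[of "\<lambda>_. u" t "A.nrm u"] B.nrm_tendsto_unique[of "\<lambda>_. u" t "B.nrm u"] tuA tuB
    by (simp_all add: A.nrm_minus_commute[of u] B.nrm_minus_commute[of u])
  then have lim_a: "(\<lambda>n. (A.nrm (t n))\<^sup>2) \<longlonglongrightarrow> (A.nrm u)\<^sup>2" and lim_b: "(\<lambda>n. (B.nrm (t n))\<^sup>2) \<longlonglongrightarrow> (B.nrm u)\<^sup>2"
    by (auto intro: tendsto_power)
  have bu: "b u u = 1" using lim_b by (simp add: B.nrm_square LIMSEQ_const_iff)
  have "a u u \<le> ?m"
  proof (rule LIMSEQ_le)
    show "(\<lambda>n. a (t n) (t n)) \<longlonglongrightarrow> a u u" using lim_a by (simp add: A.nrm_square)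
    show "(\<lambda>n. ?m + inverse (real (Suc n))) \<longlonglongrightarrow> ?m"
      using tendsto_add[OF tendsto_const LIMSEQ_inverse_real_of_nat, of ?m] by simp
  qed (use ta in \<open>auto intro: less_imp_le\<close>)
  \<comment> \<open>Orthogonality to \<open>e i\<close> is a \<open>b\<close>-continuous condition,
    hence survives the limit.\<close>
  have "b u (e i) = 0" if i: "i < k" for i
  proof -
    have "norm (b u (e i)) \<le> B.nrm (t n - u) * B.nrm (e i)" for n
    proof -
      have "b (t n - u) (e i) = - b u (e i)" using i perpD(2)[OF tp i] by (simp add: B.expand)
      then show ?thesis using B.abs_le_nrm[of "t n - u" "e i"] i by simp
    qed
    then have "(\<lambda>n. b u (e i)) \<longlonglongrightarrow> 0"
      by (intro Lim_null_comparison[OF always_eventually tendsto_mult_left_zero[OF tuB]]) auto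
    then show ?thesis by (simp add: LIMSEQ_const_iff)
  qed
  then have "u \<in> perp e k" by (simp add: perp_def)
  moreover have "a u u * b w w \<le> a w w" if "w \<in> perp e k" for w
    using mult_right_mono[OF \<open>a u u \<le> ?m\<close> B.nonneg[OF perpD(1)[OF that]]] m_le[OF that] by linarith
  ultimately show ?thesis using bu by blast
qed

text \<open>Minimality alone gives the weak equation only against vectors orthogonal to the earlier
  eigenvectors; symmetry of the forms and induction extend it to all of \<open>V\<close>.\<close>

lemma spectral_theorem:
  obtains e \<nu> where
    "\<And>i. e i \<in> V"
    "\<And>i j. b (e i) (e j) = (if i = j then 1 else 0)"
    "\<And>i w. w \<in> V \<Longrightarrow> a (e i) w = \<nu> i * b (e i) w"
    "incseq \<nu>" "\<And>i. 0 \<le> \<nu> i" "filterlim \<nu> at_top sequentially"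
    "\<And>k w. w \<in> perp e k \<Longrightarrow> \<nu> k * b w w \<le> a w w"
    "\<And>w. w \<in> V \<Longrightarrow> (\<lambda>n. B.nrm (w - (\<Sum>i<n. b w (e i) *\<^sub>R e i))) \<longlonglongrightarrow> 0"
proof -
  let ?P = "\<lambda>e k u. u \<in> perp e k \<and> b u u = 1 \<and> (\<forall>w\<in>perp e k. a u u * b w w \<le> a w w)"
  have "\<exists>e. \<forall>k::nat. ?P e k (e k)"
  \<comment> \<open>The condition on the \<open>k\<close>-th vector sees only the vectors before it,
    which makes the recursive choice possible.\<close>
  proof (rule dependent_wellorder_choice)
    fix u :: 'a and f g :: "nat \<Rightarrow> 'a" and k assume "\<And>i. i < k \<Longrightarrow> f i = g i"
    then have "perp f k = perp g k" by (auto simp: perp_def)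
    then show "?P f k u = ?P g k u" by simp
  next
    fix k and f :: "nat \<Rightarrow> 'a" assume "\<And>i. i < k \<Longrightarrow> ?P f i (f i)"
    then show "\<exists>u. ?P f k u" using rayleigh_minimizer[of k f] perpD(1) by blast
  qed
  then obtain e where e: "\<And>k. ?P e k (e k)" by blast
  define \<nu> where "\<nu> k = a (e k) (e k)" for k
  have eV [simp]: "e k \<in> V" for k using e perpD(1) by blast
  have e_perp: "b (e i) (e j) = 0" if "j < i" for i j using e[of i] perpD(2) that by blast
  have orth: "b (e i) (e j) = (if i = j then 1 else 0)" for i j
    using e[of i] e_perp[of i j] e_perp[of j i] B.sym[of "e i" "e j"] by (cases i j rule: linorder_cases) auto
  have min: "\<nu> k * b w w \<le> a w w" if "w \<in> perp e k" for k w
    using e[of k] that by (auto simp: \<nu>_def)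
  have rest_perp: "w - (\<Sum>i<k. b w (e i) *\<^sub>R e i) \<in> perp e k" if w: "w \<in> V" for w k
  proof -
    have "b (w - (\<Sum>i<k. b w (e i) *\<^sub>R e i)) (e j) = 0" if "j < k" for j
    proof -
      have "b (\<Sum>i<k. b w (e i) *\<^sub>R e i) (e j) = (\<Sum>i<k. b w (e i) * b (e i) (e j))"
        by (subst B.sum_left) (auto simp: B.scale_left)
      also have "\<dots> = (\<Sum>i<k. if i = j then b w (e j) else 0)"
        by (intro sum.cong) (auto simp: orth)
      also have "\<dots> = b w (e j)" using that by simp
      finally show ?thesis using w by (simp add: B.diff_left)
    qed
    then show ?thesis using w by (simp add: perp_def)
  qed
  have eig: "a (e k) w = \<nu> k * b (e k) w" if "w \<in> V" for k w
    using that
  proof (induction k arbitrary: w rule: less_induct)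
    case (less k)
    \<comment> \<open>The form \<open>a\<close> - \<nu> k \<open>b\<close> is nonnegative on the
      complement and vanishes at \<open>e k\<close>, so its linear variation in any direction of the
      complement is 0.\<close>
    have perp_case: "a (e k) w = \<nu> k * b (e k) w" if w: "w \<in> perp e k" for w
    proof -
      have wV [simp]: "w \<in> V" using w by (rule perpD)
      have "0 \<le> 2 * t * (a (e k) w - \<nu> k * b (e k) w) + t\<^sup>2 * (a w w - \<nu> k * b w w)" for t
      proof -
        have "e k + t *\<^sub>R w \<in> perp e k"
          using e[of k] w subspace_perp[of k e] by (intro subspace_add subspace_scale) auto
        from min[OF this] show ?thesis
          by (simp add: A.square_add_scale B.square_add_scale orth \<nu>_def[symmetric] algebra_simps)
      qed
      from nonneg_quadratic_linear_zero[OF this] show ?thesis by simp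
    qed
    \<comment> \<open>The \<open>b\<close>-projection of \<open>w\<close> to the earlier
      eigenvectors. It is orthogonal to \<open>e k\<close> for \<open>b\<close> by construction and
      for \<open>a\<close> by the induction hypothesis, so only \<open>w - p\<close>
      matters.\<close>
    define p where "p = (\<Sum>i<k. b w (e i) *\<^sub>R e i)"
    have pV [simp]: "p \<in> V" by (simp add: p_def)
    have "a (e k) (e i) = 0" if "i < k" for i
      using less.IH[OF that eV, of k] that A.sym[of "e k" "e i"] by (simp add: orth)
    then have "a (e k) p = 0" "b (e k) p = 0"
      by (simp_all add: p_def A.sum_right A.scale_right B.sum_right B.scale_right e_perp)
    moreover have "a (e k) (w - p) = \<nu> k * b (e k) (w - p)"
      using rest_perp[OF less.prems, of k] by (intro perp_case) (simp add: p_def)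
    ultimately show ?case using less.prems by (simp add: A.expand B.expand)
  qed
  have nn: "0 \<le> \<nu> k" for k by (simp add: \<nu>_def A.nonneg)
  have inc: "incseq \<nu>"
  proof (rule incseq_SucI)
    fix k
    have "e (Suc k) \<in> perp e k" using e[of "Suc k"] by (auto simp: perp_def)
    from min[OF this] show "\<nu> k \<le> \<nu> (Suc k)" by (simp add: orth \<nu>_def)
  qed
  \<comment> \<open>Were \<nu> bounded, the eigenvectors would be bounded in the combined norm and
    have a \<open>b\<close>-Cauchy subsequence, while distinct orthonormal vectors are at distance
    sqrt 2.\<close>
  have top: "filterlim \<nu> at_top sequentially"
  proof (rule ccontr)
    assume "\<not> ?thesis"
    then obtain Z where Z: "\<And>n. \<exists>m\<ge>n. \<nu> m < Z"
      by (auto simp: filterlim_at_top eventually_sequentially not_le)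
    have "Q.nrm (e n) \<le> sqrt (Z + 1)" for n
    proof -
      obtain m where "m \<ge> n" "\<nu> m < Z" using Z by blast
      with inc have "\<nu> n \<le> Z" by (meson incseqD less_eq_real_def order.trans)
      then show ?thesis by (simp add: Q.nrm_def q_def \<nu>_def orth)
    qed
    then obtain r where r: "strict_mono r" "e \<circ> r \<in> B.cauchy_seqs"
      using compact[of e] eV by blast
    obtain N where N: "\<And>m n. \<lbrakk>m \<ge> N; n \<ge> N\<rbrakk> \<Longrightarrow> B.nrm ((e \<circ> r) m - (e \<circ> r) n) < 1"
      using B.cauchy_seqsE[OF r(2), of 1] by auto
    have "r N \<noteq> r (Suc N)" using strict_monoD[OF r(1), of N "Suc N"] by simp
    then have "B.nrm (e (r N) - e (r (Suc N))) = sqrt 2"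
      by (simp add: B.nrm_def B.expand orth)
    then show False using N[of N "Suc N"] by (simp add: real_sqrt_less_iff[of 2 1, simplified])
  qed
  have compl: "(\<lambda>n. B.nrm (w - (\<Sum>i<n. b w (e i) *\<^sub>R e i))) \<longlonglongrightarrow> 0" if w [simp]: "w \<in> V" for w
  proof -
    define u where "u n = w - (\<Sum>i<n. b w (e i) *\<^sub>R e i)" for n
    have uV [simp]: "u n \<in> V" for n by (simp add: u_def)
    have up: "u n \<in> perp e n" for n unfolding u_def by (rule rest_perp) simp
    \<comment> \<open>The remainder is \<open>a\<close>-orthogonal to the projection, since each
      \<open>e i\<close> with \<open>i < n\<close> is an eigenvector and the remainder is
      \<open>b\<close>-orthogonal to it; so energies add.\<close>
    have a_le: "a (u n) (u n) \<le> a w w" for n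
    proof -
      define p where "p = (\<Sum>i<n. b w (e i) *\<^sub>R e i)"
      have p [simp]: "p \<in> V" by (simp add: p_def)
      have "a (u n) (e i) = 0" if "i < n" for i
        using eig[of "u n" i] A.sym[of "u n" "e i"] B.sym[of "u n" "e i"] perpD(2)[OF up that] by simp
      then have 0: "a (u n) p = 0"
        by (simp add: p_def A.sum_right A.scale_right)
      have "w = u n + 1 *\<^sub>R p" by (simp add: u_def p_def)
      then have "a w w = a (u n) (u n) + a p p" using A.square_add_scale[of "u n" p 1] 0 by simp
      then show ?thesis using A.nonneg[of p] by simp
    qed
    \<comment> \<open>The first values of \<nu> may be 0, so division waits until they are
      positive.\<close>
    have "eventually (\<lambda>n. \<nu> n > 0) sequentially"
      using top by (simp add: filterlim_at_top_dense)
    then have "eventually (\<lambda>n. norm ((B.nrm (u n))\<^sup>2) \<le> a w w / \<nu> n) sequentially"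
    proof (rule eventually_mono)
      fix n assume "\<nu> n > 0"
      then show "norm ((B.nrm (u n))\<^sup>2) \<le> a w w / \<nu> n"
        using min[OF up[of n]] a_le[of n] by (simp add: B.nrm_square B.nonneg field_simps)
    qed
    moreover have "(\<lambda>n. a w w / \<nu> n) \<longlonglongrightarrow> 0"
      by (rule tendsto_divide_0[OF tendsto_const filterlim_at_top_imp_at_infinity[OF top]])
    ultimately have "(\<lambda>n. (B.nrm (u n))\<^sup>2) \<longlonglongrightarrow> 0" by (rule Lim_null_comparison)
    then have "(\<lambda>n. sqrt ((B.nrm (u n))\<^sup>2)) \<longlonglongrightarrow> sqrt 0" by (rule tendsto_real_sqrt)
    then show ?thesis by (simp add: u_def)
  qed
  show ?thesis by (rule that[OF eV orth eig inc nn top min compl])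
qed

end

section \<open>Calculus of smooth functions\<close>

lemma Ck_on_subset: "\<lbrakk>Ck_on k U f; U' \<subseteq> U\<rbrakk> \<Longrightarrow> Ck_on k U' f"
  by (induction k arbitrary: f) (auto intro: continuous_on_subset)

lemma Ck_on_imp_continuous_on:
  assumes "Ck_on k U f"
  shows "continuous_on U f"
proof (cases k)
  case (Suc m)
  then have "\<And>x. x \<in> U \<Longrightarrow> f differentiable (at x)" using assms by simp
  then show ?thesis
    by (meson continuous_at_imp_continuous_on differentiable_imp_continuous_within)
qed (use assms in simp)

lemma Ck_on_Suc_imp: "Ck_on (Suc k) U f \<Longrightarrow> Ck_on k U f"
proof (induction k arbitrary: f)
  case 0
  then show ?case using Ck_on_imp_continuous_on[OF 0] by simp
next
  case (Suc k)
  then show ?case by (metis Ck_on.simps(2))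
qed

lemma Ck_on_cong:
  assumes "open U" "Ck_on k U f" "\<And>x. x \<in> U \<Longrightarrow> f x = g x"
  shows "Ck_on k U g"
  using assms(2,3)
proof (induction k arbitrary: f g)
  case 0
  then show ?case using continuous_on_cong[of U U f g] by simp
next
  case (Suc k)
  have D: "(g has_derivative frechet_derivative f (at x)) (at x)" if "x \<in> U" for x
    using Suc.prems that assms(1)
    by (auto intro: has_derivative_transform_within_open[of f _ x UNIV U] simp: frechet_derivative_works)
  then have "frechet_derivative g (at x) = frechet_derivative f (at x)" if "x \<in> U" for x
    using that frechet_derivative_at by metis
  note eq = this
  have "Ck_on k U (\<lambda>x. frechet_derivative g (at x) (axis i 1))" for i
    by (rule Suc.IH[of "\<lambda>x. frechet_derivative f (at x) (axis i 1)"]) (use Suc.prems(1) eq in simp_all)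
  then show ?case using D by (auto simp: differentiable_def)
qed

text \<open>On an open set any explicit derivative is the Frechet derivative, so smoothness can be
  shown without ever computing \<open>frechet_derivative\<close>.\<close>

lemma Ck_on_SucI:
  assumes "open U" "\<And>x. x \<in> U \<Longrightarrow> (f has_derivative D x) (at x)"
    "\<And>i. Ck_on k U (\<lambda>x. D x (axis i 1))"
  shows "Ck_on (Suc k) U f"
proof -
  have "frechet_derivative f (at x) = D x" if "x \<in> U" for x
    using assms(2)[OF that] frechet_derivative_at by metis
  then have "Ck_on k U (\<lambda>x. frechet_derivative f (at x) (axis i 1))" for i
    by (intro Ck_on_cong[OF assms(1) assms(3)[of i]]) simp
  then show ?thesis using assms(2) by (auto simp: differentiable_def)
qed

lemma Ck_on_SucD:
  assumes "Ck_on (Suc k) U f"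
  shows "x \<in> U \<Longrightarrow> (f has_derivative frechet_derivative f (at x)) (at x)"
    "Ck_on k U (\<lambda>x. frechet_derivative f (at x) (axis i 1))"
  using assms by (auto simp: frechet_derivative_works)

lemma Ck_on_const: "open U \<Longrightarrow> Ck_on k U (\<lambda>x. c)"
proof (induction k arbitrary: c)
  case (Suc k)
  then show ?case by (intro Ck_on_SucI[where D = "\<lambda>_ _. 0"]) auto
qed simp

lemma Ck_on_add: "\<lbrakk>open U; Ck_on k U f; Ck_on k U g\<rbrakk> \<Longrightarrow> Ck_on k U (\<lambda>x. f x + g x)"
proof (induction k arbitrary: f g)
  case (Suc k)
  have "Ck_on k U (\<lambda>x. frechet_derivative f (at x) (axis i 1) + frechet_derivative g (at x) (axis i 1))" for i
    by (intro Suc.IH Suc.prems(1) Ck_on_SucD(2)[OF Suc.prems(2)] Ck_on_SucD(2)[OF Suc.prems(3)])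
  then show ?case
    by (intro Ck_on_SucI[OF Suc.prems(1) has_derivative_add[OF Ck_on_SucD(1)[OF Suc.prems(2)] Ck_on_SucD(1)[OF Suc.prems(3)]]])
qed (auto intro: continuous_intros)

lemma Ck_on_mult: "\<lbrakk>open U; Ck_on k U f; Ck_on k U g\<rbrakk> \<Longrightarrow> Ck_on k U (\<lambda>x. f x * g x)"
proof (induction k arbitrary: f g)
  case (Suc k)
  have "Ck_on k U (\<lambda>x. f x * frechet_derivative g (at x) (axis i 1) + frechet_derivative f (at x) (axis i 1) * g x)" for i
    by (intro Ck_on_add Suc.IH Suc.prems(1) Ck_on_SucD(2)[OF Suc.prems(2)] Ck_on_SucD(2)[OF Suc.prems(3)]
        Ck_on_Suc_imp[OF Suc.prems(2)] Ck_on_Suc_imp[OF Suc.prems(3)])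
  then show ?case
    by (intro Ck_on_SucI[OF Suc.prems(1) has_derivative_mult[OF Ck_on_SucD(1)[OF Suc.prems(2)] Ck_on_SucD(1)[OF Suc.prems(3)]]])
qed (auto intro: continuous_intros)

lemma Ck_on_sum: "\<lbrakk>open U; \<And>i. i \<in> I \<Longrightarrow> Ck_on k U (f i)\<rbrakk> \<Longrightarrow> Ck_on k U (\<lambda>x. \<Sum>i\<in>I. f i x)"
  by (induction I rule: infinite_finite_induct) (auto intro: Ck_on_const Ck_on_add)

text \<open>The outer function comes with the whole chain \<open>d\<close> of its derivatives; the
  induction on \<open>k\<close> then only shifts \<open>j\<close>.\<close>

lemma Ck_on_compose_real:
  assumes "open U" "\<And>j t. (d j has_real_derivative d (Suc j) t) (at t)" "\<And>k. Ck_on k U f"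
  shows "Ck_on k U (\<lambda>x. d j (f x))"
proof (induction k arbitrary: j)
  case 0
  have "continuous_on UNIV (d j)"
    using assms(2) by (meson DERIV_isCont continuous_at_imp_continuous_on)
  then show ?case using assms(3)[of 0]
    using continuous_on_compose2[of UNIV "d j" U f] by simp
next
  case (Suc k)
  show ?case
  proof (rule Ck_on_SucI[OF assms(1)])
    fix x assume "x \<in> U"
    show "((\<lambda>x. d j (f x)) has_derivative (\<lambda>h. d (Suc j) (f x) * frechet_derivative f (at x) h)) (at x)"
      by (rule has_derivative_compose[OF Ck_on_SucD(1)[OF assms(3) \<open>x \<in> U\<close>]])
        (use assms(2)[of j "f x"] in \<open>simp add: has_field_derivative_def\<close>)
  next
    fix i
    show "Ck_on k U (\<lambda>x. d (Suc j) (f x) * frechet_derivative f (at x) (axis i 1))"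
      by (intro Ck_on_mult assms(1) Suc Ck_on_SucD(2) assms(3))
  qed
qed

section \<open>Smooth cutoff functions\<close>

text \<open>The functions p(1/t) exp(-1/t), extended by 0. The class is closed under
  differentiation, which is the reason for carrying the polynomial.\<close>

definition flat_poly :: "real poly \<Rightarrow> real \<Rightarrow> real" where
  "flat_poly p t = (if t > 0 then poly p (1 / t) * exp (- (1 / t)) else 0)"

lemma poly_times_exp_minus_tendsto_0:
  fixes p :: "real poly"
  shows "((\<lambda>y. poly p y * exp (- y)) \<longlongrightarrow> 0) at_top"
proof -
  have "((\<lambda>y. \<Sum>i\<le>degree p. coeff p i * (y ^ i / exp y)) \<longlongrightarrow> (\<Sum>i\<le>degree p. coeff p i * 0)) at_top"
    by (intro tendsto_intros tendsto_power_div_exp_0)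
  then show ?thesis
    by (simp add: poly_altdef exp_minus sum_distrib_right divide_inverse mult.assoc)
qed

lemma flat_poly_tendsto_0: "((\<lambda>t. flat_poly p t) \<longlongrightarrow> 0) (at_right 0)"
proof -
  have "((\<lambda>t. poly p (inverse t) * exp (- inverse t)) \<longlongrightarrow> 0) (at_right 0)"
    by (rule filterlim_compose[OF poly_times_exp_minus_tendsto_0 filterlim_inverse_at_top_right])
  moreover have "eventually (\<lambda>t. poly p (inverse t) * exp (- inverse t) = flat_poly p t) (at_right 0)"
    by (auto simp: eventually_at_right_less flat_poly_def inverse_eq_divide intro: eventually_mono[OF eventually_at_right_less])
  ultimately show ?thesis by (rule Lim_transform_eventually)
qed

text \<open>For t > 0 the derivative is t^-2 (p - p')(1/t) exp(-1/t), and t^-2 is the polynomial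
  \<open>[:0, 0, 1:]\<close> at 1/t.\<close>

lemma flat_poly_has_derivative:
  "(flat_poly p has_real_derivative flat_poly ([:0, 0, 1:] * (p - pderiv p)) t) (at t)"
proof (cases t "0::real" rule: linorder_cases)
  case less
  have "((\<lambda>_. 0) has_real_derivative 0) (at t)" by simp
  then have "(flat_poly p has_real_derivative 0) (at t)"
    by (rule DERIV_cong_ev[THEN iffD1, rotated -1])
      (use less in \<open>auto simp: flat_poly_def intro!: eventually_mono[OF eventually_nhds_in_open[of "{..<0}"]]\<close>)
  then show ?thesis using less by (simp add: flat_poly_def)
next
  case greater
  have "((\<lambda>t. poly p (1 / t) * exp (- (1 / t))) has_real_derivative
      flat_poly ([:0, 0, 1:] * (p - pderiv p)) t) (at t)"
    using greater
    by (auto intro!: derivative_eq_intros DERIV_chain2[OF poly_DERIV] simp: flat_poly_def field_simps power2_eq_square)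
  then show ?thesis
    by (rule DERIV_cong_ev[THEN iffD1, rotated -1])
      (use greater in \<open>auto simp: flat_poly_def intro!: eventually_mono[OF eventually_nhds_in_open[of "{0<..}"]]\<close>)
next
  case equal
  have "((\<lambda>h. flat_poly p h / h) \<longlongrightarrow> 0) (at 0)"
  proof (rule filterlim_split_at)
    have "eventually (\<lambda>h. 0 = flat_poly p h / h) (at_left 0)"
      by (auto simp: flat_poly_def eventually_at_filter)
    then show "((\<lambda>h. flat_poly p h / h) \<longlongrightarrow> 0) (at_left 0)"
      by (rule Lim_transform_eventually[OF tendsto_const])
    \<comment> \<open>Dividing by \<open>h\<close> multiplies the polynomial by its variable, so the
      right difference quotient lies again in the class and tends to 0.\<close>
    have "eventually (\<lambda>h. flat_poly ([:0, 1:] * p) h = flat_poly p h / h) (at_right 0)"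
      by (auto simp: flat_poly_def eventually_at_filter)
    then show "((\<lambda>h. flat_poly p h / h) \<longlongrightarrow> 0) (at_right 0)"
      by (rule Lim_transform_eventually[OF flat_poly_tendsto_0])
  qed
  then show ?thesis using equal by (simp add: DERIV_def flat_poly_def)
qed

definition flat_exp :: "nat \<Rightarrow> real \<Rightarrow> real" where
  "flat_exp k = flat_poly (((\<lambda>p. [:0, 0, 1:] * (p - pderiv p)) ^^ k) 1)"

lemma flat_exp_has_derivative: "(flat_exp k has_real_derivative flat_exp (Suc k) t) (at t)"
  unfolding flat_exp_def funpow.simps o_def by (rule flat_poly_has_derivative)

lemma flat_exp_nonpos: "t \<le> 0 \<Longrightarrow> flat_exp k t = 0"
  by (simp add: flat_exp_def flat_poly_def)

lemma flat_exp_0_pos: "t > 0 \<Longrightarrow> flat_exp 0 t = exp (- (1 / t))"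
  by (simp add: flat_exp_def flat_poly_def)

lemma flat_exp_0_mono: "s \<le> t \<Longrightarrow> flat_exp 0 s \<le> flat_exp 0 t"
  by (cases "s > 0"; cases "t > 0") (auto simp: flat_exp_0_pos flat_exp_nonpos frac_le)

lemma flat_exp_0_nonneg: "0 \<le> flat_exp 0 t"
  by (cases "t > 0") (auto simp: flat_exp_0_pos flat_exp_nonpos)

text \<open>A smooth step from 1 on the nonpositive reals down to 0 from 1 onwards. Nesting the flat
  exponential, instead of dividing two bumps, reduces smoothness to composition, sums and
  products.\<close>

definition cutoff :: "real \<Rightarrow> real" where
  "cutoff t = flat_exp 0 (flat_exp 0 1 - flat_exp 0 t) / flat_exp 0 (flat_exp 0 1)"

definition cutoff_deriv :: "real \<Rightarrow> real" where
  "cutoff_deriv t = - flat_exp 1 (flat_exp 0 1 - flat_exp 0 t) * flat_exp 1 t / flat_exp 0 (flat_exp 0 1)"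

lemma cutoff_denom_pos: "flat_exp 0 (flat_exp 0 1) > 0"
  by (simp add: flat_exp_0_pos)

lemma cutoff_eq_1: "t \<le> 0 \<Longrightarrow> cutoff t = 1"
  using cutoff_denom_pos by (simp add: cutoff_def flat_exp_nonpos)

lemma cutoff_eq_0: "t \<ge> 1 \<Longrightarrow> cutoff t = 0"
  using flat_exp_0_mono[of 1 t] by (simp add: cutoff_def flat_exp_nonpos)

lemma cutoff_nonneg: "0 \<le> cutoff t"
  using cutoff_denom_pos by (simp add: cutoff_def flat_exp_0_nonneg)

lemma cutoff_le_1: "cutoff t \<le> 1"
  using cutoff_denom_pos flat_exp_0_mono[of "flat_exp 0 1 - flat_exp 0 t" "flat_exp 0 1"]
  by (simp add: cutoff_def flat_exp_0_nonneg)

lemma cutoff_has_derivative: "(cutoff has_real_derivative cutoff_deriv t) (at t)"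
proof -
  have "((\<lambda>t. flat_exp 0 (flat_exp 0 1 - flat_exp 0 t)) has_real_derivative
      flat_exp 1 (flat_exp 0 1 - flat_exp 0 t) * (0 - flat_exp 1 t)) (at t)"
    by (rule DERIV_chain2[OF flat_exp_has_derivative[of 0, folded One_nat_def]
          DERIV_diff[OF DERIV_const flat_exp_has_derivative[of 0, folded One_nat_def]]])
  from DERIV_cdivide[OF this, of "flat_exp 0 (flat_exp 0 1)"] show ?thesis
    by (simp add: cutoff_def[abs_def] cutoff_deriv_def)
qed

text \<open>This confines the gradient of a rescaled cutoff to an annulus, so that cutoffs at
  distant scales do not interact.\<close>

lemma cutoff_deriv_support: "t \<notin> {0..1} \<Longrightarrow> cutoff_deriv t = 0"
  using flat_exp_0_mono[of 1 t] by (auto simp: cutoff_deriv_def flat_exp_nonpos)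

lemma cutoff_deriv_bounded: obtains C where "C > 0" "\<And>t. \<bar>cutoff_deriv t\<bar> \<le> C"
proof -
  have c: "continuous_on UNIV (flat_exp k)" for k
    using flat_exp_has_derivative by (meson DERIV_isCont continuous_at_imp_continuous_on)
  have "continuous_on {0..1} cutoff_deriv"
    unfolding cutoff_deriv_def[abs_def] using cutoff_denom_pos
    by (intro continuous_intros continuous_on_compose2[OF c]) auto
  then have "bounded (cutoff_deriv ` {0..1})"
    by (intro compact_imp_bounded compact_continuous_image) auto
  then obtain C where C: "C > 0" "\<And>t. t \<in> {0..1} \<Longrightarrow> \<bar>cutoff_deriv t\<bar> \<le> C"
    by (auto simp: bounded_pos)
  have "\<bar>cutoff_deriv t\<bar> \<le> C" for t
    using C cutoff_deriv_support[of t] by (cases "t \<in> {0..1}") auto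
  with C(1) show ?thesis by (rule that)
qed

lemma Ck_on_cutoff:
  assumes "open U" "\<And>k. Ck_on k U f"
  shows "Ck_on k U (\<lambda>x. cutoff (f x))"
proof -
  have 1: "Ck_on k U (\<lambda>x. flat_exp 0 1 + (-1) * flat_exp 0 (f x))" for k
    by (intro Ck_on_add Ck_on_mult Ck_on_const Ck_on_compose_real[where d = flat_exp]
        flat_exp_has_derivative assms)
  have "Ck_on k U (\<lambda>x. flat_exp 0 (flat_exp 0 1 + (-1) * flat_exp 0 (f x)) * (1 / flat_exp 0 (flat_exp 0 1)))"
    by (intro Ck_on_mult Ck_on_const Ck_on_compose_real[where d = flat_exp]
        flat_exp_has_derivative assms(1) 1)
  then show ?thesis by (simp add: cutoff_def)
qed

section \<open>Derivatives on Lipschitz domains\<close>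

lemma lipschitz_domainE:
  assumes "lipschitz_domain S" "x \<in> S"
  obtains W v h L where "open W" "x \<in> W" "norm v = 1" "L-lipschitz_on UNIV h"
    "\<forall>y t. h (y + t *\<^sub>R v) = h y" "S \<inter> W = {y \<in> W. (h y :: real) \<le> y \<bullet> v}"
  using bspec[OF assms(1)[unfolded lipschitz_domain_def] assms(2)]
  by (elim exE conjE) (rule that)

text \<open>The interior cone condition, at boundary points too: along a direction \<open>w\<close>
  near \<open>v\<close> the height grows at rate at least \<open>1 - norm (w - v)\<close>, the graph
  at rate at most \<open>L * norm (w - v)\<close>.\<close>

lemma lipschitz_domain_cone:
  fixes S :: "(real^'n) set"
  assumes "lipschitz_domain S" "x \<in> S"
  obtains r v where "r > 0"
    "\<forall>w. norm (w - v) < r \<longrightarrow> (\<exists>d>0. \<forall>t. 0 \<le> t \<and> t \<le> d \<longrightarrow> x + t *\<^sub>R w \<in> S)"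
proof -
  obtain W v h L where W: "open W" "x \<in> W" and v: "norm v = 1"
    and h: "L-lipschitz_on UNIV h" "\<forall>y t. h (y + t *\<^sub>R v) = h y"
    and SW: "S \<inter> W = {y \<in> W. (h y :: real) \<le> y \<bullet> v}"
    by (rule lipschitz_domainE[OF assms])
  have L: "L \<ge> 0" using h(1) by (rule lipschitz_on_nonneg)
  \<comment> \<open>Up to this distance from \<open>v\<close> the growth of the graph stays below
    that of the height.\<close>
  define r where "r = 1 / (L + 1)"
  have r: "r > 0" using L by (simp add: r_def)
  have "\<exists>d>0. \<forall>t. 0 \<le> t \<and> t \<le> d \<longrightarrow> x + t *\<^sub>R w \<in> S" if w: "norm (w - v) < r" for w
  proof -
    have "((\<lambda>t. x + t *\<^sub>R w) \<longlongrightarrow> x + 0 *\<^sub>R w) (at (0::real))" by (intro tendsto_intros)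
    then have "eventually (\<lambda>t. x + t *\<^sub>R w \<in> W) (at (0::real))"
      using W by (intro topological_tendstoD) auto
    then obtain d where d: "d > 0" "\<And>t. \<lbrakk>t \<noteq> 0; \<bar>t\<bar> < d\<rbrakk> \<Longrightarrow> x + t *\<^sub>R w \<in> W"
      by (auto simp: eventually_at dist_real_def)
    have "x + t *\<^sub>R w \<in> S" if t: "0 \<le> t" "t \<le> d / 2" for t
    proof (cases "t = 0")
      case False
      then have inW: "x + t *\<^sub>R w \<in> W" using d t by auto
      \<comment> \<open>As \<open>h\<close> is constant along \<open>v\<close>, only the deviation
        of \<open>w\<close> from \<open>v\<close> moves it.\<close>
      have "h (x + t *\<^sub>R w) = h (x + t *\<^sub>R (w - v))"
        using h(2)[rule_format, of "x + t *\<^sub>R (w - v)" t] by (simp add: algebra_simps)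
      also have "\<dots> \<le> h x + L * (t * norm (w - v))"
        using lipschitz_onD[OF h(1), of "x + t *\<^sub>R (w - v)" x] t by (simp add: dist_norm)
      also have "h x \<le> x \<bullet> v" using SW assms(2) W(2) by auto
      also have "L * (t * norm (w - v)) \<le> t * (1 - norm (w - v))"
      proof -
        have "(L + 1) * norm (w - v) \<le> 1" using w L by (simp add: r_def field_simps)
        then have "t * ((L + 1) * norm (w - v)) \<le> t * 1" using t by (intro mult_left_mono) auto
        then show ?thesis by (simp add: algebra_simps)
      qed
      also have "x \<bullet> v + t * (1 - norm (w - v)) \<le> x \<bullet> v + t * (w \<bullet> v)"
      proof -
        have "w \<bullet> v = (w - v) \<bullet> v + 1" using v by (simp add: inner_diff_left norm_eq_1)
        moreover have "\<bar>(w - v) \<bullet> v\<bar> \<le> norm (w - v)" using Cauchy_Schwarz_ineq2[of "w - v" v] v by simp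
        ultimately show ?thesis using t by (intro add_left_mono mult_left_mono) auto
      qed
      also have "\<dots> = (x + t *\<^sub>R w) \<bullet> v" by (simp add: inner_add_left)
      finally show ?thesis using SW inW by auto
    qed (use assms in simp)
    then show ?thesis using d by (intro exI[of _ "d / 2"]) auto
  qed
  then show ?thesis by (intro that[OF r]) blast
qed

text \<open>Admissible directions contain a ball around \<open>v\<close>, and the directions in a
  ball span the space. Uniqueness frees \<open>frechet_derivative\<close> at boundary points from
  any choice.\<close>

lemma lipschitz_domain_derivative_unique:
  fixes f :: "real^'n \<Rightarrow> 'b::real_normed_vector"
  assumes S: "lipschitz_domain S" "x \<in> S"
    and D: "(f has_derivative D) (at x within S)" "(f has_derivative D') (at x within S)"
  shows "D = D'"
proof -
  obtain r v where r: "r > 0"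
    and cone: "\<forall>w. norm (w - v) < r \<longrightarrow> (\<exists>d>0. \<forall>t. 0 \<le> t \<and> t \<le> d \<longrightarrow> x + t *\<^sub>R w \<in> S)"
    by (rule lipschitz_domain_cone[OF S])
  have lin: "linear D" "linear D'" using D by (auto dest: has_derivative_linear)
  have agree: "D w = D' w" if w: "norm (w - v) < r" for w
  proof -
    obtain d where d: "d > 0" "\<And>t. \<lbrakk>0 \<le> t; t \<le> d\<rbrakk> \<Longrightarrow> x + t *\<^sub>R w \<in> S"
      using cone[rule_format, OF w] by blast
    have *: "((\<lambda>t. f (x + t *\<^sub>R w)) has_vector_derivative E w) (at 0 within {0..d})"
      if E: "(f has_derivative E) (at x within S)" for E
    proof -
      have line: "((\<lambda>t. x + t *\<^sub>R w) has_derivative (\<lambda>t. t *\<^sub>R w)) (at 0 within {0..d})"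
        by (auto intro!: derivative_eq_intros)
      have "(f has_derivative E) (at (x + 0 *\<^sub>R w) within ((\<lambda>t. x + t *\<^sub>R w) ` {0..d}))"
      proof -
        have "(\<lambda>t. x + t *\<^sub>R w) ` {0..d} \<subseteq> S" using d(2) by (intro image_subsetI) simp
        from has_derivative_subset[OF E this] show ?thesis by simp
      qed
      from has_derivative_in_compose[OF line this]
      have "((\<lambda>t. f (x + t *\<^sub>R w)) has_derivative (\<lambda>t. E (t *\<^sub>R w))) (at 0 within {0..d})" .
      then show ?thesis
        using has_derivative_linear[OF E] by (simp add: has_vector_derivative_def linear_scale)
    qed
    show ?thesis
      using vector_derivative_unique_within_closed_interval[of 0 d 0, unfolded cbox_interval, OF d(1) _ *[OF D(1)] *[OF D(2)]]
        d(1) by simp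
  qed
  show ?thesis
  proof
    fix y :: "real^'n"
    \<comment> \<open>Small enough for \<open>v + s y\<close> to stay in the ball of admissible
      directions.\<close>
    define s where "s = r / (2 * (norm y + 1))"
    have pos: "norm y + 1 > 0" by (simp add: add_nonneg_pos)
    have s: "s > 0" using r pos by (simp add: s_def)
    have "norm (s *\<^sub>R y) < r"
    proof -
      have "s * norm y \<le> s * (norm y + 1)" using s by simp
      also have "\<dots> = r / 2" using pos by (simp add: s_def divide_simps)
      finally show ?thesis using r s by simp
    qed
    then have "D (v + s *\<^sub>R y) = D' (v + s *\<^sub>R y)" "D v = D' v" using agree r by auto
    then have "s *\<^sub>R D y = s *\<^sub>R D' y"
      using lin by (simp add: linear_add linear_scale)
    then show "D y = D' y" using s by simp
  qed
qed

text \<open>It makes chart images Borel sets and gives points of the manifold closed coordinate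
  neighbourhoods.\<close>

lemma lipschitz_domain_locally_closed:
  assumes "lipschitz_domain S"
  obtains C Q where "closed C" "open Q" "S = C \<inter> Q"
proof -
  have "\<exists>W. open W \<and> x \<in> W \<and> closedin (top_of_set W) (S \<inter> W)" if x: "x \<in> S" for x
  proof -
    obtain W v h L where W: "open W" "x \<in> W" "norm v = 1" and h: "L-lipschitz_on UNIV h"
      "\<forall>y t. h (y + t *\<^sub>R v) = h y" and SW: "S \<inter> W = {y \<in> W. (h y :: real) \<le> y \<bullet> v}"
      by (rule lipschitz_domainE[OF assms x])
    have "closed {y. h y \<le> y \<bullet> v}"
      using lipschitz_on_continuous_on[OF h(1)] by (intro closed_Collect_le continuous_intros) auto
    moreover have "S \<inter> W = W \<inter> {y. h y \<le> y \<bullet> v}" using SW by auto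
    ultimately show ?thesis using W by (metis closedin_closed)
  qed
  then obtain W where W: "\<And>x. x \<in> S \<Longrightarrow> open (W x)" "\<And>x. x \<in> S \<Longrightarrow> x \<in> W x"
    "\<And>x. x \<in> S \<Longrightarrow> closedin (top_of_set (W x)) (S \<inter> W x)" by metis
  define Q where "Q = (\<Union>x\<in>S. W x)"
  have "open Q" using W by (auto simp: Q_def)
  have "S = closure S \<inter> Q"
  proof (intro equalityI subsetI IntI)
    fix y assume "y \<in> closure S \<inter> Q"
    then obtain x where x: "x \<in> S" "y \<in> W x" "y \<in> closure S" by (auto simp: Q_def)
    obtain T where T: "closed T" "S \<inter> W x = W x \<inter> T" using W(3)[OF x(1)] by (auto simp: closedin_closed)
    have "y \<in> closure (W x \<inter> S)"
      using x open_Int_closure_subset[OF W(1)[OF x(1)], of S] by auto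
    also have "\<dots> \<subseteq> T" using T by (intro closure_minimal) auto
    finally show "y \<in> S" using T x by auto
  qed (use W closure_subset[of S] in \<open>auto simp: Q_def\<close>)
  then show ?thesis using \<open>open Q\<close> that[of "closure S" Q] by auto
qed

lemma smooth_on_setE:
  assumes "smooth_on_set S f" "x \<in> S"
  obtains U F where "open U" "x \<in> U" "\<And>k. Ck_on k U F" "\<And>y. y \<in> S \<inter> U \<Longrightarrow> F y = f y"
  using assms unfolding smooth_on_set_def by metis

lemma smooth_on_setI:
  assumes "\<And>x. x \<in> S \<Longrightarrow> \<exists>U F. open U \<and> x \<in> U \<and> (\<forall>k. Ck_on k U F) \<and> (\<forall>y\<in>S \<inter> U. F y = f y)"
  shows "smooth_on_set S f"
  using assms by (simp add: smooth_on_set_def)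

text \<open>Together with uniqueness, the derivative within \<open>S\<close> can be computed from
  any smooth extension, which gives its continuity up to the boundary.\<close>

lemma smooth_extension_derivative:
  assumes "open U" "y \<in> S \<inter> U" "\<And>k. Ck_on k U F" "\<And>y. y \<in> S \<inter> U \<Longrightarrow> F y = f y"
  shows "(f has_derivative frechet_derivative F (at y)) (at y within S)"
proof -
  have "(F has_derivative frechet_derivative F (at y)) (at y within S)"
    using Ck_on_SucD(1)[OF assms(3)] assms(2) by (auto intro: has_derivative_at_withinI)
  moreover obtain d where "d > 0" "ball y d \<subseteq> U" using assms(1,2) openE by blast
  ultimately show ?thesis
    using assms(2,4) by (intro has_derivative_transform_within[of F _ y S d f]) (auto simp: dist_commute subset_iff)
qed

lemma smooth_on_set_differentiable:
  assumes "smooth_on_set S f" "x \<in> S"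
  shows "f differentiable (at x within S)"
proof -
  obtain U F where "open U" "x \<in> U" "\<And>k. Ck_on k U F" "\<And>y. y \<in> S \<inter> U \<Longrightarrow> F y = f y"
    using smooth_on_setE[OF assms] by blast
  then have "(f has_derivative frechet_derivative F (at x)) (at x within S)"
    using assms(2) by (intro smooth_extension_derivative) auto
  then show ?thesis by (auto simp: differentiable_def)
qed

lemma smooth_on_set_continuous: "smooth_on_set S f \<Longrightarrow> continuous_on S f"
  unfolding continuous_on_eq_continuous_within
  by (intro ballI differentiable_imp_continuous_within smooth_on_set_differentiable)

lemma frechet_derivative_within_eqI:
  assumes "lipschitz_domain S" "x \<in> S" "(f has_derivative D) (at x within S)"
  shows "frechet_derivative f (at x within S) = D"
proof -
  have "(f has_derivative frechet_derivative f (at x within S)) (at x within S)"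
    using assms(3) frechet_derivative_works by (auto simp: differentiable_def)
  then show ?thesis by (rule lipschitz_domain_derivative_unique[OF assms(1,2) _ assms(3)])
qed

lemma smooth_on_set_continuous_derivative:
  assumes "lipschitz_domain S" "smooth_on_set S f"
  shows "continuous_on S (\<lambda>x. frechet_derivative f (at x within S) (axis i 1))"
  unfolding continuous_on_eq_continuous_within
proof
  fix x assume x: "x \<in> S"
  obtain U F where U: "open U" "x \<in> U" "\<And>k. Ck_on k U F" "\<And>y. y \<in> S \<inter> U \<Longrightarrow> F y = f y"
    using smooth_on_setE[OF assms(2) x] by blast
  have "continuous (at x) (\<lambda>x. frechet_derivative F (at x) (axis i 1))"
    using Ck_on_SucD(2)[OF U(3), of 0 i] U(1,2) by (simp add: continuous_on_eq_continuous_at)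
  then have cont: "continuous (at x within S) (\<lambda>x. frechet_derivative F (at x) (axis i 1))"
    by (rule continuous_at_imp_continuous_at_within)
  have eq: "frechet_derivative f (at y within S) = frechet_derivative F (at y)" if "y \<in> S \<inter> U" for y
    using that U assms(1) by (intro frechet_derivative_within_eqI smooth_extension_derivative) auto
  obtain d where d: "d > 0" "ball x d \<subseteq> U" using U(1,2) openE by blast
  show "continuous (at x within S) (\<lambda>x. frechet_derivative f (at x within S) (axis i 1))"
  proof (rule continuous_transform_within[OF cont d(1) x])
    fix y assume "y \<in> S" "dist y x < d"
    then have "y \<in> S \<inter> U" using d(2) by (auto simp: dist_commute subset_iff)
    then show "frechet_derivative F (at y) (axis i 1) = frechet_derivative f (at y within S) (axis i 1)"
      by (simp add: eq)
  qed
qed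

lemma smooth_on_set_binop:
  fixes S :: "(real^'n) set"
  assumes "smooth_on_set S f" "smooth_on_set S g"
    and op: "\<And>(U :: (real^'n) set) F G. \<lbrakk>open U; \<forall>k. Ck_on k U F; \<forall>k. Ck_on k U G\<rbrakk> \<Longrightarrow> \<forall>k. Ck_on k U (\<lambda>x. h (F x) (G x))"
  shows "smooth_on_set S (\<lambda>x. h (f x) (g x))"
proof (rule smooth_on_setI)
  fix x assume x: "x \<in> S"
  obtain U F where U: "open U" "x \<in> U" "\<And>k. Ck_on k U F" "\<And>y. y \<in> S \<inter> U \<Longrightarrow> F y = f y"
    using smooth_on_setE[OF assms(1) x] by blast
  obtain V G where V: "open V" "x \<in> V" "\<And>k. Ck_on k V G" "\<And>y. y \<in> S \<inter> V \<Longrightarrow> G y = g y"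
    using smooth_on_setE[OF assms(2) x] by blast
  have "\<forall>k. Ck_on k (U \<inter> V) (\<lambda>x. h (F x) (G x))"
    by (rule op) (use U V Ck_on_subset[OF U(3)] Ck_on_subset[OF V(3)] in auto)
  then show "\<exists>U F. open U \<and> x \<in> U \<and> (\<forall>k. Ck_on k U F) \<and> (\<forall>y\<in>S \<inter> U. F y = h (f y) (g y))"
    using U V by (intro exI[of _ "U \<inter> V"] exI[of _ "\<lambda>x. h (F x) (G x)"]) auto
qed

lemma smooth_on_set_add: "\<lbrakk>smooth_on_set S f; smooth_on_set S g\<rbrakk> \<Longrightarrow> smooth_on_set S (\<lambda>x. f x + g x)"
  by (rule smooth_on_set_binop[where h = "(+)"]) (blast intro: Ck_on_add)+

lemma smooth_on_set_mult: "\<lbrakk>smooth_on_set S f; smooth_on_set S g\<rbrakk> \<Longrightarrow> smooth_on_set S (\<lambda>x. f x * g x)"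
  by (rule smooth_on_set_binop[where h = "(*)"]) (blast intro: Ck_on_mult)+

lemma smooth_on_set_const: "smooth_on_set S (\<lambda>x. c)"
  by (rule smooth_on_setI) (intro exI[of _ UNIV] exI[of _ "\<lambda>_. c"] conjI allI Ck_on_const, auto)

section \<open>Linear algebra of positive definite matrices\<close>

lemma inner_matrix_vector_left:
  fixes A :: "real^'n^'m"
  shows "(A *v x) \<bullet> y = x \<bullet> (transpose A *v y)"
  using dot_lmul_matrix[of x "transpose A" y] by (simp del: transpose_matrix_vector)

lemma inner_symmetric_matrix:
  fixes A :: "real^'n^'n"
  assumes "transpose A = A"
  shows "x \<bullet> (A *v y) = y \<bullet> (A *v x)"
  using inner_matrix_vector_left[of A y x] assms by (simp add: inner_commute del: transpose_matrix_vector)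

lemma invertible_mult_matrix_inv:
  fixes A :: "'a::field^'n^'n"
  assumes "invertible A"
  shows "A ** matrix_inv A = mat 1" "matrix_inv A ** A = mat 1"
proof -
  have "A ** matrix_inv A = mat 1 \<and> matrix_inv A ** A = mat 1"
    using assms unfolding invertible_def matrix_inv_def by (rule someI_ex)
  then show "A ** matrix_inv A = mat 1" "matrix_inv A ** A = mat 1" by auto
qed

lemma matrix_inv_mult_eq:
  fixes A :: "'a::field^'n^'n"
  assumes "invertible A"
  shows "A *v (matrix_inv A *v x) = x" "matrix_inv A *v (A *v x) = x"
  using invertible_mult_matrix_inv[OF assms] by (simp_all add: matrix_vector_mul_assoc)

lemma positive_definite_invertible:
  fixes A :: "real^'n^'n"
  assumes "\<And>v. v \<noteq> 0 \<Longrightarrow> 0 < v \<bullet> (A *v v)"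
  shows "invertible A"
proof -
  have "x = 0" if "A *v x = 0" for x using assms[of x] that by (cases "x = 0") auto
  then have "\<exists>B. B ** A = mat 1" by (simp add: matrix_left_invertible_ker)
  then show ?thesis by (simp add: invertible_left_inverse)
qed

lemma positive_definite_nonneg:
  fixes A :: "real^'n^'n"
  assumes "\<And>v. v \<noteq> 0 \<Longrightarrow> 0 < v \<bullet> (A *v v)"
  shows "0 \<le> v \<bullet> (A *v v)"
  using assms[of v] by (cases "v = 0") auto

lemma continuous_on_det:
  fixes M :: "'a::topological_space \<Rightarrow> real^'n^'n"
  assumes "\<And>i j. continuous_on S (\<lambda>x. M x $ i $ j)"
  shows "continuous_on S (\<lambda>x. det (M x))"
  unfolding det_def by (intro continuous_intros assms)

text \<open>Cramer's rule writes the components as quotients of determinants, which are polynomial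
  in the entries.\<close>

lemma continuous_on_matrix_inv_vector:
  fixes M :: "'a::topological_space \<Rightarrow> real^'n^'n"
  assumes M: "\<And>i j. continuous_on S (\<lambda>x. M x $ i $ j)" and inv: "\<And>x. x \<in> S \<Longrightarrow> invertible (M x)"
    and b: "continuous_on S b"
  shows "continuous_on S (\<lambda>x. matrix_inv (M x) *v b x)"
proof -
  have "matrix_inv (M x) *v b x = (\<chi> k. det (\<chi> i j. if j = k then b x $ i else M x $ i $ j) / det (M x))"
    if "x \<in> S" for x
    using cramer[of "M x" "matrix_inv (M x) *v b x" "b x"] inv[OF that]
    by (simp add: matrix_inv_mult_eq invertible_det_nz)
  moreover have "continuous_on S (\<lambda>x. \<chi> k. det (\<chi> i j. if j = k then b x $ i else M x $ i $ j) / det (M x))"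
  proof (intro continuous_on_vec_lambda continuous_on_divide continuous_on_det M)
    show "\<forall>x\<in>S. det (M x) \<noteq> 0" using inv by (simp add: invertible_det_nz)
    fix k i j
    show "continuous_on S (\<lambda>x. (\<chi> i j. if j = k then b x $ i else M x $ i $ j) $ i $ j)"
      using M b by (cases "j = k") (auto intro!: continuous_intros)
  qed
  ultimately show ?thesis by (simp cong: continuous_on_cong_simp)
qed

section \<open>Charts\<close>

lemma at_within_Int_nhd: "\<lbrakk>open U; x \<in> U\<rbrakk> \<Longrightarrow> at x within (S \<inter> U) = at x within S"
  by (rule at_within_nhd[of x U]) auto

context
  fixes c :: "('a::topological_space, 'n::finite) chart"
  assumes chart: "is_chart c"
begin

lemma open_chart_domain: "open (fst c)"
  and chart_homeomorphism: "homeomorphism (fst c) (chart_image c) (snd c) (chart_inv c)"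
  and chart_lipschitz: "lipschitz_domain (chart_image c)"
  using chart by (auto simp: is_chart_def)

lemma chart_inv_chart: "p \<in> fst c \<Longrightarrow> chart_inv c (snd c p) = p"
  using homeomorphism_apply1[OF chart_homeomorphism] .

lemma chart_chart_inv: "y \<in> chart_image c \<Longrightarrow> snd c (chart_inv c y) = y"
  using homeomorphism_apply2[OF chart_homeomorphism] .

lemma chart_inv_mem: "y \<in> chart_image c \<Longrightarrow> chart_inv c y \<in> fst c"
  by (rule inv_into_into)

lemma continuous_on_chart: "continuous_on (fst c) (snd c)"
  using homeomorphism_cont1[OF chart_homeomorphism] .

lemma continuous_on_chart_inv: "continuous_on (chart_image c) (chart_inv c)"
  using homeomorphism_cont2[OF chart_homeomorphism] .

lemma chart_image_relatively_open:
  assumes "open V"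
  obtains U where "open U" "snd c ` (fst c \<inter> V) = chart_image c \<inter> U"
proof -
  have "openin (top_of_set (fst c)) (fst c \<inter> V)" using assms by (rule openin_open_Int)
  from homeomorphism_imp_open_map[OF chart_homeomorphism this] show ?thesis
    using that by (auto simp: openin_open)
qed

lemma chart_preimage_open:
  assumes "open U"
  shows "open {p \<in> fst c. snd c p \<in> U}"
  using continuous_open_preimage[OF continuous_on_chart open_chart_domain assms]
  by (simp add: vimage_def Int_def)

lemma chart_image_borel: "chart_image c \<in> sets borel"
proof -
  obtain C Q where "closed C" "open Q" "chart_image c = C \<inter> Q"
    by (rule lipschitz_domain_locally_closed[OF chart_lipschitz])
  then show ?thesis by simp
qed

lemma chart_inv_measurable: "chart_inv c \<in> borel_measurable (restrict_space borel (chart_image c))"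
  by (rule borel_measurable_continuous_on_restrict[OF continuous_on_chart_inv])

lemma chart_image_eq: "B \<subseteq> fst c \<Longrightarrow> snd c ` B = {y \<in> chart_image c. chart_inv c y \<in> B}"
  using chart_inv_chart chart_chart_inv by force

text \<open>The image under the chart is a preimage under its inverse, which is continuous on the
  Borel chart image.\<close>

lemma chart_image_measurable:
  assumes "B \<in> sets borel" "B \<subseteq> fst c"
  shows "snd c ` B \<in> sets borel"
proof -
  have "chart_inv c -` B \<inter> space (restrict_space borel (chart_image c)) \<in> sets (restrict_space borel (chart_image c))"
    using chart_inv_measurable assms(1) by (rule measurable_sets)
  moreover have "chart_inv c -` B \<inter> space (restrict_space borel (chart_image c)) = snd c ` B"
    using chart_image_eq[OF assms(2)] by (auto simp: space_restrict_space)
  ultimately show ?thesis using chart_image_borel by (simp add: sets_restrict_space_iff)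
qed

end

section \<open>Gradients on a compact manifold, possibly with Lipschitz boundary, and their
  independence of the chart\<close>

locale closed_manifold =
  fixes A :: "('a::{t2_space, second_countable_topology}, 'n::finite) chart set"
    and g :: "('a, 'n) metric"
  assumes manifold: "riemannian_manifold A g"
    and compact_UNIV: "compact (UNIV :: 'a set)"
begin

lemma chart: "c \<in> A \<Longrightarrow> is_chart c"
  using manifold by (auto simp: riemannian_manifold_def smooth_atlas_def)

lemma chart_cover: obtains c where "c \<in> A" "p \<in> fst c"
  using manifold unfolding riemannian_manifold_def smooth_atlas_def by blast

lemma transition_smooth: "\<lbrakk>c \<in> A; c' \<in> A\<rbrakk> \<Longrightarrow> smooth_on_set (overlap c c') (\<lambda>x. transition c c' x $ i)"
  using manifold by (auto simp: riemannian_manifold_def smooth_atlas_def)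

lemma metric_smooth: "c \<in> A \<Longrightarrow> smooth_on_set (chart_image c) (\<lambda>x. g c x $ i $ j)"
  using manifold by (auto simp: riemannian_manifold_def riemannian_metric_def)

lemma metric_symmetric: "\<lbrakk>c \<in> A; x \<in> chart_image c\<rbrakk> \<Longrightarrow> transpose (g c x) = g c x"
  using manifold unfolding riemannian_manifold_def riemannian_metric_def by blast

lemma metric_positive: "\<lbrakk>c \<in> A; x \<in> chart_image c; v \<noteq> 0\<rbrakk> \<Longrightarrow> 0 < v \<bullet> (g c x *v v)"
  using manifold unfolding riemannian_manifold_def riemannian_metric_def by blast

lemma metric_invertible: "\<lbrakk>c \<in> A; x \<in> chart_image c\<rbrakk> \<Longrightarrow> invertible (g c x)"
  using metric_positive by (rule positive_definite_invertible)

definition jac :: "('a, 'n) chart \<Rightarrow> ('a, 'n) chart \<Rightarrow> real^'n \<Rightarrow> real^'n \<Rightarrow> real^'n" where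
  "jac c c' x = frechet_derivative (transition c c') (at x within overlap c c')"

lemma metric_transform:
  assumes "c \<in> A" "c' \<in> A" "x \<in> overlap c c'"
  shows "g c x = transpose (matrix (jac c c' x)) ** g c' (transition c c' x) ** matrix (jac c c' x)"
proof -
  have "riemannian_metric A g" using manifold by (simp add: riemannian_manifold_def)
  then show ?thesis using assms unfolding riemannian_metric_def Let_def jac_def by blast
qed

lemma overlap_relatively_open:
  assumes "c \<in> A" "c' \<in> A"
  obtains U where "open U" "overlap c c' = chart_image c \<inter> U"
  by (rule chart_image_relatively_open[OF chart[OF assms(1)] open_chart_domain[OF chart[OF assms(2)]]]) (rule that)

text \<open>The transformation law of the metric differentiates within the overlap,
  \<open>chart_differential\<close> within the whole chart image. The overlap is relatively open, so
  the two derivatives agree.\<close>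

lemma at_within_overlap:
  assumes "c \<in> A" "c' \<in> A" "x \<in> overlap c c'"
  shows "at x within overlap c c' = at x within chart_image c"
proof -
  obtain U where U: "open U" "overlap c c' = chart_image c \<inter> U"
    by (rule overlap_relatively_open[OF assms(1,2)])
  moreover have "x \<in> U" using U(2) assms(3) by blast
  ultimately show ?thesis using at_within_Int_nhd by metis
qed

lemma transition_has_derivative:
  assumes "c \<in> A" "c' \<in> A" "x \<in> overlap c c'"
  shows "(transition c c' has_derivative jac c c' x) (at x within overlap c c')"
proof -
  have "(\<lambda>y. transition c c' y $ i) differentiable (at x within overlap c c')" for i
    by (rule smooth_on_set_differentiable[OF transition_smooth[OF assms(1,2)] assms(3)])
  then have "transition c c' differentiable (at x within overlap c c')"
    unfolding differentiable_componentwise_within[of "transition c c'"]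
    by (auto simp: Basis_vec_def inner_axis)
  then show ?thesis unfolding jac_def by (simp only: frechet_derivative_works)
qed

lemma overlap_mem:
  assumes "c \<in> A" "c' \<in> A" "x \<in> overlap c c'"
  shows "x \<in> chart_image c" "chart_inv c x \<in> fst c" "chart_inv c x \<in> fst c'"
    "transition c c' x \<in> chart_image c'" "chart_inv c' (transition c c' x) = chart_inv c x"
  using assms chart_inv_chart[OF chart] by auto

definition du :: "('a, 'n) chart \<Rightarrow> ('a \<Rightarrow> real) \<Rightarrow> 'a \<Rightarrow> real^'n \<Rightarrow> real" where
  "du c u p = frechet_derivative (u \<circ> chart_inv c) (at (snd c p) within chart_image c)"

lemma smooth_functionsD: "\<lbrakk>u \<in> smooth_functions A; c \<in> A\<rbrakk> \<Longrightarrow> smooth_on_set (chart_image c) (u \<circ> chart_inv c)"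
  by (simp add: smooth_functions_def)

lemma du_has_derivative:
  assumes "u \<in> smooth_functions A" "c \<in> A" "p \<in> fst c"
  shows "((u \<circ> chart_inv c) has_derivative du c u p) (at (snd c p) within chart_image c)"
  using smooth_on_set_differentiable[OF smooth_functionsD[OF assms(1,2)]] assms(3)
  unfolding du_def by (simp add: frechet_derivative_works[symmetric])

lemma du_eqI:
  assumes "c \<in> A" "p \<in> fst c" "((u \<circ> chart_inv c) has_derivative D) (at (snd c p) within chart_image c)"
  shows "du c u p = D"
  unfolding du_def using assms by (intro frechet_derivative_within_eqI chart_lipschitz chart) auto

lemma du_eq_inner:
  assumes "u \<in> smooth_functions A" "c \<in> A" "p \<in> fst c"
  shows "du c u p h = chart_differential c u p \<bullet> h"
proof -
  have lin: "linear (du c u p)" using du_has_derivative[OF assms] by (rule has_derivative_linear)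
  have "du c u p h = du c u p (\<Sum>i\<in>UNIV. h $ i *\<^sub>R axis i 1)"
    using basis_expansion[of h] by (simp add: scalar_mult_eq_scaleR)
  also have "\<dots> = (\<Sum>i\<in>UNIV. h $ i * du c u p (axis i 1))"
    using lin by (simp add: linear_sum linear_scale)
  also have "\<dots> = chart_differential c u p \<bullet> h"
    by (simp add: chart_differential_def inner_vec_def du_def mult.commute)
  finally show ?thesis .
qed

lemma chart_differential_eqI:
  assumes "c \<in> A" "p \<in> fst c" "((u \<circ> chart_inv c) has_derivative (\<lambda>h. d \<bullet> h)) (at (snd c p) within chart_image c)"
  shows "chart_differential c u p = d"
  using du_eqI[OF assms] by (simp add: chart_differential_def du_def[symmetric] vec_eq_iff inner_axis)

text \<open>The chain rule: covectors are pulled back by the transposed Jacobian of the transition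
  map.\<close>

lemma chart_differential_transform:
  assumes u: "u \<in> smooth_functions A" and c: "c \<in> A" "c' \<in> A" and p: "p \<in> fst c" "p \<in> fst c'"
  shows "chart_differential c u p = transpose (matrix (jac c c' (snd c p))) *v chart_differential c' u p"
proof (rule chart_differential_eqI[OF c(1) p(1)])
  define x where "x = snd c p"
  let ?J = "jac c c' x" and ?O = "overlap c c'"
  have x: "x \<in> ?O" using p by (auto simp: x_def)
  have J: "(transition c c' has_derivative ?J) (at x within ?O)"
    by (rule transition_has_derivative[OF c x])
  have Tx: "transition c c' x = snd c' p" using p chart_inv_chart[OF chart[OF c(1)]] by (simp add: x_def)
  have "((u \<circ> chart_inv c') has_derivative du c' u p) (at (transition c c' x) within transition c c' ` ?O)"
    unfolding Tx using overlap_mem(4)[OF c]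
    by (intro has_derivative_subset[OF du_has_derivative[OF u c(2) p(2)]]) auto
  from has_derivative_in_compose[OF J this]
  have "((\<lambda>y. (u \<circ> chart_inv c') (transition c c' y)) has_derivative (\<lambda>h. du c' u p (?J h))) (at x within ?O)" .
  then have "((u \<circ> chart_inv c) has_derivative (\<lambda>h. du c' u p (?J h))) (at x within ?O)"
    by (rule has_derivative_transform[OF x, rotated]) (use overlap_mem(5)[OF c] in auto)
  moreover have "du c' u p (?J h) = (transpose (matrix ?J) *v chart_differential c' u p) \<bullet> h" for h
  proof -
    have "?J h = matrix ?J *v h"
      using has_derivative_linear[OF J] by (simp add: matrix_vector_mul(2)[THEN fun_cong])
    then show ?thesis
      using du_eq_inner[OF u c(2) p(2)] inner_matrix_vector_left[of "matrix ?J" h "chart_differential c' u p"]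
      by (simp add: inner_commute del: transpose_matrix_vector)
  qed
  ultimately show "((u \<circ> chart_inv c) has_derivative (\<lambda>h. (transpose (matrix (jac c c' (snd c p))) *v chart_differential c' u p) \<bullet> h))
      (at (snd c p) within chart_image c)"
    using at_within_overlap[OF c x] by (simp add: x_def del: transpose_matrix_vector)
qed

definition ginner :: "('a, 'n) chart \<Rightarrow> ('a \<Rightarrow> real) \<Rightarrow> ('a \<Rightarrow> real) \<Rightarrow> 'a \<Rightarrow> real" where
  "ginner c u w p = chart_gradient g c u p \<bullet> (g c (snd c p) *v chart_gradient g c w p)"

lemma metric_chart_gradient: "\<lbrakk>c \<in> A; p \<in> fst c\<rbrakk> \<Longrightarrow> g c (snd c p) *v chart_gradient g c w p = chart_differential c w p"
  unfolding chart_gradient_def by (intro matrix_inv_mult_eq metric_invertible) auto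

text \<open>The laws for the metric and for covectors are known; cancelling the transposed Jacobian
  between them leaves the law for vectors. A nonzero determinant of the metric forces the Jacobian
  to be invertible.\<close>

lemma chart_gradient_transform:
  assumes u: "u \<in> smooth_functions A" and c: "c \<in> A" "c' \<in> A" and p: "p \<in> fst c" "p \<in> fst c'"
  shows "matrix (jac c c' (snd c p)) *v chart_gradient g c u p = chart_gradient g c' u p"
proof -
  let ?J = "matrix (jac c c' (snd c p))"
  have x: "snd c p \<in> overlap c c'" using p by auto
  have T: "transition c c' (snd c p) = snd c' p" using p chart_inv_chart[OF chart[OF c(1)]] by simp
  have G: "g c (snd c p) = transpose ?J ** g c' (snd c' p) ** ?J"
    using metric_transform[OF c x] T by simp
  have "invertible (g c (snd c p))" using c(1) p by (intro metric_invertible) auto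
  then have "det (g c (snd c p)) \<noteq> 0" by (simp add: invertible_det_nz)
  then have "invertible (transpose ?J)"
    by (simp add: G det_mul det_transpose invertible_det_nz)
  note inj = matrix_inv_mult_eq(2)[OF this]
  have "transpose ?J *v (g c' (snd c' p) *v (?J *v chart_gradient g c u p)) = g c (snd c p) *v chart_gradient g c u p"
    unfolding G by (simp add: matrix_vector_mul_assoc matrix_mul_assoc del: transpose_matrix_vector)
  also have "\<dots> = transpose ?J *v chart_differential c' u p"
    using metric_chart_gradient[OF c(1) p(1)] chart_differential_transform[OF u c p] by simp
  finally have "g c' (snd c' p) *v (?J *v chart_gradient g c u p) = chart_differential c' u p"
    using inj by metis
  then have "matrix_inv (g c' (snd c' p)) *v (g c' (snd c' p) *v (?J *v chart_gradient g c u p)) = chart_gradient g c' u p"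
    by (simp add: chart_gradient_def)
  moreover have "invertible (g c' (snd c' p))" using c(2) p by (intro metric_invertible) auto
  ultimately show ?thesis by (simp add: matrix_inv_mult_eq)
qed

lemma ginner_transform:
  assumes u: "u \<in> smooth_functions A" "w \<in> smooth_functions A"
    and c: "c \<in> A" "c' \<in> A" and p: "p \<in> fst c" "p \<in> fst c'"
  shows "ginner c u w p = ginner c' u w p"
proof -
  let ?J = "matrix (jac c c' (snd c p))"
  have x: "snd c p \<in> overlap c c'" using p by auto
  have T: "transition c c' (snd c p) = snd c' p" using p chart_inv_chart[OF chart[OF c(1)]] by simp
  have G: "g c (snd c p) = transpose ?J ** g c' (snd c' p) ** ?J"
    using metric_transform[OF c x] T by simp
  have "ginner c' u w p = (?J *v chart_gradient g c u p) \<bullet> (g c' (snd c' p) *v (?J *v chart_gradient g c w p))"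
    by (simp add: ginner_def chart_gradient_transform[OF u(1) c p] chart_gradient_transform[OF u(2) c p])
  also have "\<dots> = chart_gradient g c u p \<bullet> (g c (snd c p) *v chart_gradient g c w p)"
    unfolding G inner_matrix_vector_left by (simp add: matrix_vector_mul_assoc matrix_mul_assoc del: transpose_matrix_vector)
  finally show ?thesis by (simp add: ginner_def)
qed

text \<open>For smooth functions the chart chosen by \<open>SOME\<close>, which may jump from point
  to point, can be replaced by any convenient one; continuity and bilinearity are then checked in a
  fixed chart.\<close>

lemma gradient_inner_eq:
  assumes u: "u \<in> smooth_functions A" "w \<in> smooth_functions A" and c: "c \<in> A" "p \<in> fst c"
  shows "gradient_inner A g u w p = ginner c u w p"
proof -
  define c' where "c' = (SOME c. c \<in> A \<and> p \<in> fst c)"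
  have c': "c' \<in> A \<and> p \<in> fst c'" unfolding c'_def using c by (intro someI) blast
  have "gradient_inner A g u w p = ginner c' u w p"
    by (simp add: gradient_inner_def ginner_def Let_def c'_def)
  then show ?thesis using ginner_transform[OF u] c c' by metis
qed

lemma continuous_on_metric: "c \<in> A \<Longrightarrow> continuous_on (chart_image c) (\<lambda>x. g c x $ i $ j)"
  by (intro smooth_on_set_continuous metric_smooth)

lemma continuous_on_chart_differential:
  assumes "u \<in> smooth_functions A" "c \<in> A"
  shows "continuous_on (fst c) (chart_differential c u)"
  unfolding chart_differential_def
proof (intro continuous_on_vec_lambda)
  fix i
  have "continuous_on (chart_image c) (\<lambda>x. frechet_derivative (u \<circ> chart_inv c) (at x within chart_image c) (axis i 1))"
    using assms by (intro smooth_on_set_continuous_derivative chart_lipschitz chart smooth_functionsD)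
  then show "continuous_on (fst c) (\<lambda>p. frechet_derivative (u \<circ> chart_inv c) (at (snd c p) within chart_image c) (axis i 1))"
    by (rule continuous_on_compose2[OF _ continuous_on_chart[OF chart[OF assms(2)]]]) simp
qed

lemma continuous_on_gradient_inner:
  assumes u: "u \<in> smooth_functions A" "w \<in> smooth_functions A"
  shows "continuous_on UNIV (gradient_inner A g u w)"
proof -
  have "continuous_on (\<Union>(fst ` A)) (gradient_inner A g u w)"
  proof (rule continuous_on_open_Union)
    show "open S" if "S \<in> fst ` A" for S using that open_chart_domain[OF chart] by auto
    fix S assume "S \<in> fst ` A"
    then obtain c where c: "c \<in> A" "S = fst c" by auto
    have "continuous_on (fst c) (\<lambda>p. chart_gradient g c u p \<bullet> chart_differential c w p)"
      unfolding chart_gradient_def using u c(1)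
      by (intro continuous_on_inner continuous_on_matrix_inv_vector continuous_on_chart_differential
          metric_invertible continuous_on_compose2[OF continuous_on_metric continuous_on_chart[OF chart]]) auto
    moreover have "gradient_inner A g u w p = chart_gradient g c u p \<bullet> chart_differential c w p" if "p \<in> fst c" for p
      using gradient_inner_eq[OF u c(1) that] metric_chart_gradient[OF c(1) that] by (simp add: ginner_def)
    ultimately show "continuous_on S (gradient_inner A g u w)"
      using c(2) by (simp cong: continuous_on_cong_simp)
  qed
  moreover have "\<Union>(fst ` A) = UNIV" using chart_cover by blast
  ultimately show ?thesis by simp
qed

lemma smooth_functions_add: "\<lbrakk>u \<in> smooth_functions A; w \<in> smooth_functions A\<rbrakk> \<Longrightarrow> (\<lambda>x. u x + w x) \<in> smooth_functions A"
  using smooth_on_set_add by (fastforce simp: smooth_functions_def o_def)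

lemma smooth_functions_mult: "\<lbrakk>u \<in> smooth_functions A; w \<in> smooth_functions A\<rbrakk> \<Longrightarrow> (\<lambda>x. u x * w x) \<in> smooth_functions A"
  using smooth_on_set_mult by (fastforce simp: smooth_functions_def o_def)

lemma smooth_functions_const: "(\<lambda>x. a) \<in> smooth_functions A"
  by (simp add: smooth_functions_def o_def smooth_on_set_const)

lemma smooth_functions_continuous:
  assumes "u \<in> smooth_functions A"
  shows "continuous_on UNIV u"
proof -
  have "continuous_on (\<Union>(fst ` A)) u"
  proof (rule continuous_on_open_Union)
    show "open S" if "S \<in> fst ` A" for S using that open_chart_domain[OF chart] by auto
    fix S assume "S \<in> fst ` A"
    then obtain c where c: "c \<in> A" "S = fst c" by auto
    have "continuous_on (fst c) (\<lambda>p. (u \<circ> chart_inv c) (snd c p))"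
      by (rule continuous_on_compose2[OF smooth_on_set_continuous[OF smooth_functionsD[OF assms c(1)]]
            continuous_on_chart[OF chart[OF c(1)]]]) simp
    moreover have "(u \<circ> chart_inv c) (snd c p) = u p" if "p \<in> fst c" for p
      using chart_inv_chart[OF chart[OF c(1)] that] by simp
    ultimately show "continuous_on S u" using c(2) by (simp cong: continuous_on_cong_simp)
  qed
  moreover have "\<Union>(fst ` A) = UNIV" using chart_cover by blast
  ultimately show ?thesis by simp
qed

lemma chart_differential_add:
  assumes "u \<in> smooth_functions A" "w \<in> smooth_functions A" "c \<in> A" "p \<in> fst c"
  shows "chart_differential c (\<lambda>x. u x + w x) p = chart_differential c u p + chart_differential c w p"
proof (rule chart_differential_eqI[OF assms(3,4)])
  show "(((\<lambda>x. u x + w x) \<circ> chart_inv c) has_derivative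
      (\<lambda>h. (chart_differential c u p + chart_differential c w p) \<bullet> h)) (at (snd c p) within chart_image c)"
    using has_derivative_add[OF du_has_derivative[OF assms(1,3,4)] du_has_derivative[OF assms(2,3,4)]]
    by (simp add: du_eq_inner[OF assms(1,3,4)] du_eq_inner[OF assms(2,3,4)] inner_add_left o_def)
qed

lemma chart_differential_scale:
  assumes "u \<in> smooth_functions A" "c \<in> A" "p \<in> fst c"
  shows "chart_differential c (\<lambda>x. a * u x) p = a *\<^sub>R chart_differential c u p"
proof (rule chart_differential_eqI[OF assms(2,3)])
  show "(((\<lambda>x. a * u x) \<circ> chart_inv c) has_derivative
      (\<lambda>h. (a *\<^sub>R chart_differential c u p) \<bullet> h)) (at (snd c p) within chart_image c)"
    using has_derivative_mult_right[OF du_has_derivative[OF assms], of a]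
    by (simp add: du_eq_inner[OF assms] o_def)
qed

lemma gradient_inner_add:
  assumes u: "u \<in> smooth_functions A" "w \<in> smooth_functions A" "z \<in> smooth_functions A"
  shows "gradient_inner A g (\<lambda>x. u x + w x) z p = gradient_inner A g u z p + gradient_inner A g w z p"
proof -
  obtain c where c: "c \<in> A" "p \<in> fst c" by (rule chart_cover)
  show ?thesis
    using u c by (simp add: gradient_inner_eq smooth_functions_add ginner_def chart_gradient_def
        chart_differential_add matrix_vector_right_distrib inner_add_left)
qed

lemma gradient_inner_scale:
  assumes u: "u \<in> smooth_functions A" "z \<in> smooth_functions A"
  shows "gradient_inner A g (\<lambda>x. a * u x) z p = a * gradient_inner A g u z p"
proof -
  obtain c where c: "c \<in> A" "p \<in> fst c" by (rule chart_cover)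
  have "(\<lambda>x. a * u x) \<in> smooth_functions A"
    using smooth_functions_mult[OF smooth_functions_const u(1)] .
  then show ?thesis
    using u c by (simp add: gradient_inner_eq ginner_def chart_gradient_def
        chart_differential_scale matrix_vector_mult_scaleR)
qed

lemma gradient_inner_sym:
  assumes u: "u \<in> smooth_functions A" "w \<in> smooth_functions A"
  shows "gradient_inner A g u w p = gradient_inner A g w u p"
proof -
  obtain c where c: "c \<in> A" "p \<in> fst c" by (rule chart_cover)
  then have "transpose (g c (snd c p)) = g c (snd c p)" by (intro metric_symmetric) auto
  from inner_symmetric_matrix[OF this] show ?thesis
    using u c by (simp add: gradient_inner_eq ginner_def)
qed

lemma gradient_inner_nonneg: "0 \<le> gradient_inner A g u u p"
proof -
  define c where "c = (SOME c. c \<in> A \<and> p \<in> fst c)"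
  obtain c0 where "c0 \<in> A" "p \<in> fst c0" by (rule chart_cover)
  then have c: "c \<in> A \<and> p \<in> fst c" unfolding c_def by (intro someI) blast
  then have "0 \<le> chart_gradient g c u p \<bullet> (g c (snd c p) *v chart_gradient g c u p)"
    by (intro positive_definite_nonneg metric_positive) auto
  then show ?thesis by (simp add: gradient_inner_def Let_def c_def)
qed

lemma gradient_inner_zero_differential:
  assumes "u \<in> smooth_functions A" "w \<in> smooth_functions A" "c \<in> A" "p \<in> fst c" "chart_differential c u p = 0"
  shows "gradient_inner A g u w p = 0"
  using assms by (simp add: gradient_inner_eq ginner_def chart_gradient_def)

lemma gradient_inner_const: "u \<in> smooth_functions A \<Longrightarrow> gradient_inner A g (\<lambda>_. a) u p = 0"
proof -
  assume u: "u \<in> smooth_functions A"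
  obtain c where c: "c \<in> A" "p \<in> fst c" by (rule chart_cover)
  have "chart_differential c (\<lambda>_. a) p = 0"
    by (rule chart_differential_eqI[OF c]) (simp add: o_def)
  then show ?thesis using u c smooth_functions_const by (intro gradient_inner_zero_differential) 
qed

end

section \<open>Change of variables over an arbitrary finite index type\<close>

text \<open>The library proves the change of variables formula for well-ordered index types only. A copy of a
  finite type carries a well-order, and permuting coordinates preserves Lebesgue measure and
  determinants.\<close>

typedef 'n wo = "UNIV :: 'n set" morphisms of_wo to_wo
  by blast

instantiation wo :: (finite) "{finite, wellorder}"
begin

definition "(x :: 'a wo) \<le> y \<longleftrightarrow> to_nat (of_wo x) \<le> to_nat (of_wo y)"
definition "(x :: 'a wo) < y \<longleftrightarrow> to_nat (of_wo x) < to_nat (of_wo y)"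

instance
proof
  have "(UNIV :: 'a wo set) = to_wo ` UNIV"
    using of_wo_inverse by (metis surjI)
  then show "finite (UNIV :: 'a wo set)" by (metis finite finite_imageI)
  fix x y z :: "'a wo" and P :: "'a wo \<Rightarrow> bool"
  show "x < y \<longleftrightarrow> x \<le> y \<and> \<not> y \<le> x" "x \<le> x" "\<lbrakk>x \<le> y; y \<le> z\<rbrakk> \<Longrightarrow> x \<le> z" "x \<le> y \<or> y \<le> x"
    by (auto simp: less_eq_wo_def less_wo_def)
  show "\<lbrakk>x \<le> y; y \<le> x\<rbrakk> \<Longrightarrow> x = y"
    by (simp add: less_eq_wo_def of_wo_inject)
  assume P: "\<And>x. (\<And>y. y < x \<Longrightarrow> P y) \<Longrightarrow> P x"
  show "P x"
    by (induction "to_nat (of_wo x)" arbitrary: x rule: less_induct) (auto intro: P simp: less_wo_def)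
qed

end

lemma bij_to_wo: "bij to_wo"
  by (rule bijI') (auto simp: to_wo_inject intro: of_wo_inverse[symmetric])

definition vec_wo :: "real^'n \<Rightarrow> real^('n wo)" where
  "vec_wo x = (\<chi> i. x $ of_wo i)"

definition wo_vec :: "real^('n wo) \<Rightarrow> real^'n" where
  "wo_vec x = (\<chi> i. x $ to_wo i)"

lemma vec_wo_inverse [simp]: "wo_vec (vec_wo x) = x" "vec_wo (wo_vec y) = y"
  by (simp_all add: vec_wo_def wo_vec_def vec_eq_iff to_wo_inverse of_wo_inverse)

lemma linear_vec_wo: "linear vec_wo" "linear wo_vec"
  by (auto intro!: linearI simp: vec_wo_def wo_vec_def vec_eq_iff)

lemma bounded_linear_vec_wo: "bounded_linear (vec_wo :: real^'n::finite \<Rightarrow> _)" "bounded_linear (wo_vec :: _ \<Rightarrow> real^'n::finite)"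
  using linear_vec_wo by (simp_all add: linear_conv_bounded_linear)

lemma continuous_vec_wo: "continuous_on S (vec_wo :: real^'n::finite \<Rightarrow> _)" "continuous_on S' (wo_vec :: _ \<Rightarrow> real^'n::finite)"
  using bounded_linear_vec_wo by (auto intro: linear_continuous_on)

lemma measurable_vec_wo [measurable]:
  "(vec_wo :: real^'n::finite \<Rightarrow> _) \<in> borel_measurable borel" "(wo_vec :: _ \<Rightarrow> real^'n::finite) \<in> borel_measurable borel"
  by (intro borel_measurable_continuous_onI continuous_vec_wo)+

lemma prod_Basis_cart: "(\<Prod>b\<in>Basis. f b) = (\<Prod>i\<in>UNIV. f (axis i 1 :: real^'n::finite))"
proof -
  have "(Basis :: (real^'n) set) = (\<lambda>i. axis i 1) ` UNIV" by (auto simp: Basis_vec_def)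
  moreover have "inj (\<lambda>i::'n. axis i (1::real))" by (auto simp: inj_on_def axis_eq_axis)
  ultimately show ?thesis using prod.reindex[of "\<lambda>i::'n. axis i (1::real)" UNIV f] by (simp only: o_def)
qed

lemma lborel_distr_vec_wo: "distr lborel borel (vec_wo :: real^'n::finite \<Rightarrow> _) = lborel"
proof (rule lborel_eqI[symmetric])
  fix l u :: "real^('n wo)" assume le: "\<And>b. b \<in> Basis \<Longrightarrow> l \<bullet> b \<le> u \<bullet> b"
  have le': "l $ i \<le> u $ i" for i using le[of "axis i 1"] by (simp add: inner_axis axis_in_Basis_iff)
  have "vec_wo -` box l u \<inter> space lborel = box (wo_vec l) (wo_vec u)"
  proof -
    have "(\<forall>i. l $ i < x $ of_wo i \<and> x $ of_wo i < u $ i) \<longleftrightarrow> (\<forall>i. l $ to_wo i < x $ i \<and> x $ i < u $ to_wo i)" for x :: "real^'n"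
      by (metis to_wo_inverse of_wo_inverse UNIV_I)
    then show ?thesis by (auto simp: mem_box_cart vec_wo_def wo_vec_def)
  qed
  then have "emeasure (distr lborel borel vec_wo) (box l u) = emeasure lborel (box (wo_vec l) (wo_vec u))"
    by (simp add: emeasure_distr)
  also have "\<dots> = (\<Prod>b\<in>Basis. (wo_vec u - wo_vec l) \<bullet> b)"
    using le' by (intro emeasure_lborel_box) (auto simp: Basis_vec_def inner_axis wo_vec_def)
  also have "(\<Prod>b\<in>Basis. (wo_vec u - wo_vec l) \<bullet> b) = (\<Prod>i\<in>UNIV. (u - l) $ to_wo i)"
    by (simp add: prod_Basis_cart inner_axis wo_vec_def)
  also have "\<dots> = (\<Prod>i\<in>UNIV. (u - l) $ i)"
    by (rule prod.reindex_bij_betw[OF bij_to_wo])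
  also have "\<dots> = (\<Prod>b\<in>Basis. (u - l) \<bullet> b)"
    by (simp add: prod_Basis_cart inner_axis)
  finally show "emeasure (distr lborel borel vec_wo) (box l u) = (\<Prod>b\<in>Basis. (u - l) \<bullet> b)" .
qed simp

text \<open>Transporting permutations along \<open>to_wo\<close> is a sign-preserving bijection of
  the permutation groups, so the Leibniz sums agree term by term.\<close>

lemma det_reindex:
  fixes M :: "real^'n::finite^'n"
  shows "det (\<chi> i j. M $ of_wo i $ of_wo j) = det M"
proof -
  let ?m = "map_permutation UNIV (to_wo :: 'n \<Rightarrow> 'n wo)"
  have inj: "inj (to_wo :: 'n \<Rightarrow> 'n wo)" using bij_to_wo by (rule bij_is_inj)
  have bij: "bij_betw ?m {p. p permutes UNIV} {p. p permutes UNIV}"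
  proof (rule bij_betw_byWitness[where f' = "map_permutation UNIV of_wo"])
    have bij': "bij (of_wo :: 'n wo \<Rightarrow> 'n)"
      by (rule bijI') (auto simp: of_wo_inject intro: to_wo_inverse[OF UNIV_I, symmetric])
    show "\<forall>p\<in>{p. p permutes UNIV}. map_permutation UNIV of_wo (?m p) = p"
      by (auto intro!: map_permutation_compose_inv[OF bij_to_wo] simp: to_wo_inverse)
    show "\<forall>p\<in>{p. p permutes UNIV}. ?m (map_permutation UNIV of_wo p) = p"
      by (auto intro!: map_permutation_compose_inv[OF bij'] simp: of_wo_inverse)
    show "?m ` {p. p permutes UNIV} \<subseteq> {p. p permutes UNIV}"
      using map_permutation_permutes[OF bij_to_wo] by auto
    show "map_permutation UNIV (of_wo :: 'n wo \<Rightarrow> 'n) ` {p. p permutes UNIV} \<subseteq> {p. p permutes UNIV}"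
      using map_permutation_permutes[OF bij'] by auto
  qed
  have "det (\<chi> i j. M $ of_wo i $ of_wo j) = (\<Sum>p | p permutes (UNIV :: 'n wo set).
      of_int (sign p) * (\<Prod>i\<in>UNIV. M $ of_wo i $ of_wo (p i)))"
    by (simp add: det_def)
  also have "\<dots> = (\<Sum>p | p permutes (UNIV :: 'n set). of_int (sign (?m p)) * (\<Prod>i\<in>UNIV. M $ of_wo i $ of_wo (?m p i)))"
    by (rule sum.reindex_bij_betw[OF bij, symmetric])
  also have "\<dots> = (\<Sum>p | p permutes (UNIV :: 'n set). of_int (sign p) * (\<Prod>i\<in>UNIV. M $ i $ p i))"
  proof (rule sum.cong[OF refl])
    fix p :: "'n \<Rightarrow> 'n" assume p: "p \<in> {p. p permutes UNIV}"
    have "sign (?m p) = sign p"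
      using p inj by (intro sign_map_permutation) auto
    moreover have "(\<Prod>i\<in>UNIV. M $ of_wo i $ of_wo (?m p i)) = (\<Prod>i\<in>UNIV. M $ of_wo (to_wo i) $ of_wo (?m p (to_wo i)))"
      by (rule prod.reindex_bij_betw[OF bij_to_wo, symmetric])
    moreover have "?m p (to_wo i) = to_wo (p i)" for i
      using inj by (intro map_permutation_apply) auto
    ultimately show "of_int (sign (?m p)) * (\<Prod>i\<in>UNIV. M $ of_wo i $ of_wo (?m p i)) = of_int (sign p) * (\<Prod>i\<in>UNIV. M $ i $ p i)"
      by (simp add: to_wo_inverse)
  qed
  finally show ?thesis by (simp add: det_def)
qed

lemma det_conjugate_vec_wo:
  fixes L :: "real^'n::finite \<Rightarrow> real^'n"
  shows "det (matrix (\<lambda>y. vec_wo (L (wo_vec y)))) = det (matrix L)"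
proof -
  have "wo_vec (axis j 1) = axis (of_wo j) 1" for j :: "'n wo"
    by (simp add: wo_vec_def vec_eq_iff axis_def) (metis of_wo_inverse to_wo_inverse UNIV_I)
  then have "matrix (\<lambda>y. vec_wo (L (wo_vec y))) = (\<chi> i j. matrix L $ of_wo i $ of_wo j)"
    by (simp add: matrix_def vec_wo_def)
  then show ?thesis by (simp add: det_reindex)
qed

text \<open>The scalar case, read off vectors of length one. For nonnegative functions integrability
  and absolute integrability coincide.\<close>

lemma has_integral_change_of_variables_wo:
  fixes h :: "real^'m::{finite,wellorder} \<Rightarrow> real" and T :: "real^'m::_ \<Rightarrow> real^'m::_"
  assumes S: "S \<in> sets lebesgue"
    and der: "\<And>x. x \<in> S \<Longrightarrow> (T has_derivative T' x) (at x within S)"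
    and inj: "inj_on T S" and h: "\<And>y. 0 \<le> h y"
  shows "((\<lambda>x. \<bar>det (matrix (T' x))\<bar> * h (T x)) has_integral b) S \<longleftrightarrow> (h has_integral b) (T ` S)"
proof -
  have *: "(F absolutely_integrable_on R \<and> integral R F = vec b) \<longleftrightarrow> (f has_integral b) R"
    if F: "F = (\<lambda>x. vec (f x) :: real^1)" and f: "\<And>x. 0 \<le> f x" for F R and f :: "real^'m::_ \<Rightarrow> real"
  proof -
    have eq: "(\<lambda>x. F x $ 1) = f" by (simp add: F)
    have "F absolutely_integrable_on R \<longleftrightarrow> f absolutely_integrable_on R"
      unfolding absolutely_integrable_on_1_iff eq ..
    also have "\<dots> \<longleftrightarrow> f integrable_on R"
      using f by (auto intro: nonnegative_absolutely_integrable_1 set_lebesgue_integral_eq_integral)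
    finally have int: "F absolutely_integrable_on R \<longleftrightarrow> f integrable_on R" .
    have "integral R F = vec b \<longleftrightarrow> integral R f = b" if "f integrable_on R"
    proof -
      have "integral R F = vec (integral R f)"
        using integral_on_1_eq[of R F] by (simp add: eq)
      then show ?thesis by (simp add: vec_eq_iff)
    qed
    then show ?thesis using int by (auto simp: has_integral_iff)
  qed
  show ?thesis
    using has_absolute_integral_change_of_variables[OF S der inj, of "\<lambda>x. vec (h x) :: real^1" "vec b"]
      *[of "\<lambda>x. vec (h x)" h "T ` S"] *[of "\<lambda>x. \<bar>det (matrix (T' x))\<bar> *\<^sub>R vec (h (T x))" "\<lambda>x. \<bar>det (matrix (T' x))\<bar> * h (T x)" S] h
    by (simp add: fun_eq_iff vec_eq_iff)
qed

text \<open>\<open>has_integral\<close> speaks of finite values only. The infinite case follows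
  because a finite value on either side forces the same value on the other.\<close>

lemma nn_integral_eq_of_has_integral_iff:
  fixes f h :: "'a::euclidean_space \<Rightarrow> real"
  assumes f: "\<And>x. 0 \<le> f x" "(\<lambda>x. indicator S x * f x) \<in> borel_measurable borel"
    and h: "\<And>x. 0 \<le> h x" "(\<lambda>x. indicator R x * h x) \<in> borel_measurable borel"
    and iff: "\<And>b. (f has_integral b) S \<longleftrightarrow> (h has_integral b) R"
  shows "(\<integral>\<^sup>+x. ennreal (indicator S x * f x) \<partial>lborel) = (\<integral>\<^sup>+x. ennreal (indicator R x * h x) \<partial>lborel)"
proof -
  have *: "(\<integral>\<^sup>+x. ennreal (indicator R x * h x) \<partial>lborel) = ennreal b"
    if "(\<integral>\<^sup>+x. ennreal (indicator S x * f x) \<partial>lborel) = ennreal b" "b \<ge> 0"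
      and f: "\<And>x. 0 \<le> f x" "(\<lambda>x. indicator S x * f x) \<in> borel_measurable borel"
      and h: "\<And>x. 0 \<le> h x"
      and iff: "\<And>b. (f has_integral b) S \<longleftrightarrow> (h has_integral b) R" for b R S and f h :: "'a \<Rightarrow> real"
  proof -
    have "((\<lambda>x. indicator S x * f x) has_integral b) UNIV"
      using that by (intro nn_integral_has_integral) auto
    moreover have "(\<lambda>x. indicator S x * f x) = (\<lambda>x. if x \<in> S then f x else 0)" by (auto simp: indicator_def)
    ultimately have "(f has_integral b) S" by (simp add: has_integral_restrict_UNIV)
    then have "(h has_integral b) R" by (simp add: iff)
    then show ?thesis using h by (intro nn_integral_has_integral_lebesgue)
  qed
  show ?thesis
  proof (cases "(\<integral>\<^sup>+x. ennreal (indicator S x * f x) \<partial>lborel)" rule: ennreal_cases)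
    case (real r)
    then show ?thesis using *[OF real(2,1) f h(1) iff] by simp
  next
    case top
    show ?thesis
    proof (cases "(\<integral>\<^sup>+x. ennreal (indicator R x * h x) \<partial>lborel)" rule: ennreal_cases)
      case (real r)
      then show ?thesis using *[OF real(2,1) h f(1) iff[symmetric]] by simp
    qed (use top in simp)
  qed
qed

text \<open>Measurability is asked of the integrands cut off to \<open>S\<close> and its image, as
  chart data carry no information elsewhere.\<close>

theorem nn_integral_change_of_variables:
  fixes h :: "real^'n::finite \<Rightarrow> real" and T :: "real^'n \<Rightarrow> real^'n"
  assumes S: "S \<in> sets borel"
    and der: "\<And>x. x \<in> S \<Longrightarrow> (T has_derivative T' x) (at x within S)"
    and inj: "inj_on T S" and h: "\<And>y. 0 \<le> h y"
    and meas: "(\<lambda>y. indicator (T ` S) y * h y) \<in> borel_measurable borel"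
      "(\<lambda>x. indicator S x * (\<bar>det (matrix (T' x))\<bar> * h (T x))) \<in> borel_measurable borel"
  shows "(\<integral>\<^sup>+y. ennreal (indicator (T ` S) y * h y) \<partial>lborel) =
    (\<integral>\<^sup>+x. ennreal (indicator S x * (\<bar>det (matrix (T' x))\<bar> * h (T x))) \<partial>lborel)"
proof -
  let ?T = "\<lambda>y. vec_wo (T (wo_vec y))" and ?T' = "\<lambda>y z. vec_wo (T' (wo_vec y) (wo_vec z))"
  let ?S = "vec_wo ` S"
  have S': "?S = wo_vec -` S \<inter> space borel" by (force intro: image_eqI[of _ _ "wo_vec _"])
  have TS: "?T ` ?S = vec_wo ` T ` S" by (auto simp: image_image)
  have ind: "indicator (vec_wo ` R) y = (indicator R (wo_vec y) :: real)" for R :: "(real^'n) set" and y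
    by (auto simp: indicator_def image_iff) (metis vec_wo_inverse)+
  have "?S \<in> sets borel" unfolding S' using S by measurable
  then have Sleb: "?S \<in> sets lebesgue" by auto
  have inj': "inj_on ?T ?S"
    using inj by (auto simp: inj_on_def) (metis vec_wo_inverse(1))
  have der': "(?T has_derivative ?T' y) (at y within ?S)" if "y \<in> ?S" for y
  proof -
    have mem: "wo_vec y \<in> S" and im: "wo_vec ` ?S = S" using that by (auto simp: image_image)
    have "(wo_vec has_derivative wo_vec) (at y within ?S)"
      by (rule bounded_linear_imp_has_derivative[OF bounded_linear_vec_wo(2)])
    moreover have "(T has_derivative T' (wo_vec y)) (at (wo_vec y) within wo_vec ` ?S)"
      using der[OF mem] im by simp
    ultimately have "((\<lambda>y. T (wo_vec y)) has_derivative (\<lambda>z. T' (wo_vec y) (wo_vec z))) (at y within ?S)"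
      by (rule has_derivative_in_compose)
    then show ?thesis
      by (rule bounded_linear.has_derivative[OF bounded_linear_vec_wo(1)])
  qed
  have iff: "((\<lambda>x. \<bar>det (matrix (T' (wo_vec x)))\<bar> * h (T (wo_vec x))) has_integral b) ?S \<longleftrightarrow>
      ((\<lambda>y. h (wo_vec y)) has_integral b) (vec_wo ` T ` S)" for b
    using has_integral_change_of_variables_wo[OF Sleb der' inj', of "\<lambda>y. h (wo_vec y)" b] h
    unfolding TS det_conjugate_vec_wo by simp
  have transfer: "(\<integral>\<^sup>+y. ennreal (f (wo_vec y)) \<partial>lborel) = (\<integral>\<^sup>+x. ennreal (f x) \<partial>lborel)"
    if [measurable]: "f \<in> borel_measurable borel" for f :: "real^'n \<Rightarrow> real"
    by (subst lborel_distr_vec_wo[symmetric], subst nn_integral_distr) simp_all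
  have m1: "(\<lambda>y. indicator (vec_wo ` T ` S) y * h (wo_vec y)) \<in> borel_measurable borel"
    unfolding ind using measurable_compose[OF measurable_vec_wo(2) meas(1)] by simp
  have m2: "(\<lambda>x. indicator ?S x * (\<bar>det (matrix (T' (wo_vec x)))\<bar> * h (T (wo_vec x)))) \<in> borel_measurable borel"
    unfolding ind using measurable_compose[OF measurable_vec_wo(2) meas(2)] by simp
  have "(\<integral>\<^sup>+y. ennreal (indicator (vec_wo ` T ` S) y * h (wo_vec y)) \<partial>lborel) =
      (\<integral>\<^sup>+x. ennreal (indicator ?S x * (\<bar>det (matrix (T' (wo_vec x)))\<bar> * h (T (wo_vec x)))) \<partial>lborel)"
    using h by (intro nn_integral_eq_of_has_integral_iff m1 m2 iff[symmetric]) auto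
  then show ?thesis
    unfolding ind using transfer[OF meas(1)] transfer[OF meas(2)] by simp
qed

section \<open>The Riemannian volume\<close>

text \<open>Glues measures that are meaningful only on the pieces \<open>E i\<close>; with disjoint
  pieces of charts this assembles the volume.\<close>

lemma ex_sum_measure:
  fixes E :: "nat \<Rightarrow> 'a::topological_space set"
  assumes \<nu>: "\<And>i. sets (\<nu> i) = sets borel" and E: "\<And>i. E i \<in> sets borel"
  obtains M where "sets M = sets borel"
    "\<forall>B\<in>sets borel. emeasure M B = (\<Sum>i<N::nat. emeasure (\<nu> i) (B \<inter> E i))"
proof -
  define M where "M = measure_of UNIV (sets (borel :: 'a measure)) (\<lambda>B. \<Sum>i<N. emeasure (\<nu> i) (B \<inter> E i))"
  have sa: "sigma_algebra UNIV (sets (borel :: 'a measure))"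
    using sets.sigma_algebra_axioms[of "borel :: 'a measure"] by simp
  have "sets M = sets borel"
    unfolding M_def using sigma_algebra.sigma_sets_eq[OF sa] sets.space_closed[of "borel :: 'a measure"] by simp
  moreover have "emeasure M B = (\<Sum>i<N. emeasure (\<nu> i) (B \<inter> E i))" if B: "B \<in> sets borel" for B
    unfolding M_def
  proof (rule emeasure_measure_of_sigma[OF sa _ _ B])
    show "positive (sets borel) (\<lambda>B. \<Sum>i<N. emeasure (\<nu> i) (B \<inter> E i))" by (simp add: positive_def)
    show "countably_additive (sets borel) (\<lambda>B. \<Sum>i<N. emeasure (\<nu> i) (B \<inter> E i))"
      unfolding countably_additive_def
    proof (intro allI impI)
      fix F :: "nat \<Rightarrow> 'a set" assume F: "range F \<subseteq> sets borel" "disjoint_family F"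
      have "(\<Sum>n. \<Sum>i<N. emeasure (\<nu> i) (F n \<inter> E i)) = (\<Sum>i<N. \<Sum>n. emeasure (\<nu> i) (F n \<inter> E i))"
        by (rule suminf_sum) simp
      also have "\<dots> = (\<Sum>i<N. emeasure (\<nu> i) ((\<Union>n. F n) \<inter> E i))"
      proof (rule sum.cong[OF refl])
        fix i
        have "(\<Sum>n. emeasure (\<nu> i) (F n \<inter> E i)) = emeasure (\<nu> i) (\<Union>n. F n \<inter> E i)"
          using F E \<nu> by (intro suminf_emeasure) (auto simp: disjoint_family_on_def)
        then show "(\<Sum>n. emeasure (\<nu> i) (F n \<inter> E i)) = emeasure (\<nu> i) ((\<Union>n. F n) \<inter> E i)" by simp
      qed
      finally show "(\<Sum>n. \<Sum>i<N. emeasure (\<nu> i) (F n \<inter> E i)) = (\<Sum>i<N. emeasure (\<nu> i) ((\<Union>n. F n) \<inter> E i))" .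
    qed
  qed
  ultimately show ?thesis by (intro that[of M]) auto
qed

context closed_manifold
begin

text \<open>Off the chart image \<open>g\<close> is arbitrary and its determinant may be negative.
  The truncation gives nonnegativity everywhere, and \<open>ennreal\<close> of the value is the same
  with or without it.\<close>

definition chart_density :: "('a, 'n) chart \<Rightarrow> real^'n \<Rightarrow> real" where
  "chart_density c x = max 0 (sqrt (det (g c x)))"

definition chart_volume :: "('a, 'n) chart \<Rightarrow> 'a set \<Rightarrow> ennreal" where
  "chart_volume c B = (\<integral>\<^sup>+x\<in>snd c ` B. ennreal (sqrt (det (g c x))) \<partial>lborel)"

lemma continuous_on_chart_density: "c \<in> A \<Longrightarrow> continuous_on (chart_image c) (chart_density c)"
  unfolding chart_density_def[abs_def]
  by (intro continuous_on_max continuous_on_const continuous_on_real_sqrt continuous_on_det continuous_on_metric)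

lemma chart_density_measurable:
  assumes "c \<in> A" "R \<in> sets borel" "R \<subseteq> chart_image c"
  shows "(\<lambda>x. indicator R x * chart_density c x) \<in> borel_measurable borel"
  using borel_measurable_continuous_on_indicator[OF assms(2) continuous_on_subset[OF continuous_on_chart_density[OF assms(1)] assms(3)]]
  by simp

lemma chart_volume_eq: "chart_volume c B = (\<integral>\<^sup>+x. ennreal (indicator (snd c ` B) x * chart_density c x) \<partial>lborel)"
  unfolding chart_volume_def
  by (intro nn_integral_cong) (auto simp: indicator_def chart_density_def max_def ennreal_neg)

text \<open>The determinant of the tensor law gives det g = (det J)^2 det g'; its square root is the
  factor in the change of variables.\<close>

lemma chart_volume_overlap:
  assumes c: "c \<in> A" "c' \<in> A" and B: "B \<in> sets borel" "B \<subseteq> fst c" "B \<subseteq> fst c'"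
  shows "chart_volume c B = chart_volume c' B"
proof -
  let ?S = "snd c ` B" and ?T = "transition c c'"
  have S: "?S \<in> sets borel" and S': "snd c' ` B \<in> sets borel"
    using B by (auto intro: chart_image_measurable chart c)
  have sub: "?S \<subseteq> overlap c c'" using B by auto
  have TS: "?T ` ?S = snd c' ` B"
    using chart_inv_chart[OF chart[OF c(1)]] B by (force simp: image_image intro!: image_cong)
  have inj: "inj_on ?T ?S"
  proof (rule inj_onI)
    fix x y assume "x \<in> ?S" "y \<in> ?S" and eq: "?T x = ?T y"
    then obtain p q where "p \<in> B" "q \<in> B" and xy: "x = snd c p" "y = snd c q" by blast
    then have mem: "p \<in> fst c" "q \<in> fst c" "p \<in> fst c'" "q \<in> fst c'" using B by auto
    then have "snd c' p = snd c' q" using eq xy chart_inv_chart[OF chart[OF c(1)]] by simp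
    then have "p = q" using mem chart_inv_chart[OF chart[OF c(2)]] by metis
    then show "x = y" using xy by simp
  qed
  have der: "(?T has_derivative jac c c' x) (at x within ?S)" if "x \<in> ?S" for x
    using transition_has_derivative[OF c] sub that by (blast intro: has_derivative_subset)
  have dens: "\<bar>det (matrix (jac c c' x))\<bar> * chart_density c' (?T x) = chart_density c x" if "x \<in> ?S" for x
  proof -
    have "x \<in> overlap c c'" using sub that by blast
    from metric_transform[OF c this]
    have "det (g c x) = (det (matrix (jac c c' x)))\<^sup>2 * det (g c' (?T x))"
      by (simp only: det_mul det_transpose power2_eq_square) (simp add: mult_ac)
    then have "sqrt (det (g c x)) = \<bar>det (matrix (jac c c' x))\<bar> * sqrt (det (g c' (?T x)))"
      by (simp only: real_sqrt_mult real_sqrt_abs)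
    then show ?thesis by (simp only: chart_density_def) (simp add: max_mult_distrib_left)
  qed
  have eq: "indicator ?S x * (\<bar>det (matrix (jac c c' x))\<bar> * chart_density c' (?T x)) =
      indicator ?S x * chart_density c x" for x
    using dens by (auto simp: indicator_def simp del: o_apply)
  have m: "(\<lambda>x. indicator ?S x * chart_density c x) \<in> borel_measurable borel"
    using S B(2) by (intro chart_density_measurable c) auto
  have m': "(\<lambda>x. indicator (?T ` ?S) x * chart_density c' x) \<in> borel_measurable borel"
    unfolding TS using S' B(3) by (intro chart_density_measurable c) auto
  have "(\<integral>\<^sup>+y. ennreal (indicator (?T ` ?S) y * chart_density c' y) \<partial>lborel) =
    (\<integral>\<^sup>+x. ennreal (indicator ?S x * (\<bar>det (matrix (jac c c' x))\<bar> * chart_density c' (?T x))) \<partial>lborel)"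
    using m m' by (intro nn_integral_change_of_variables S der inj) (simp_all only: eq, auto simp: chart_density_def)
  then show ?thesis by (simp only: chart_volume_eq TS eq)
qed

lemma chart_volume_measure:
  assumes c: "c \<in> A"
  obtains \<nu> where "sets \<nu> = sets borel" "\<forall>B\<in>sets borel. B \<subseteq> fst c \<longrightarrow> emeasure \<nu> B = chart_volume c B"
proof -
  let ?I = "chart_image c"
  \<comment> \<open>The inverse chart is extended by an arbitrary value to be Borel on the whole
    space; the density \<open>d\<close> vanishes where it was extended.\<close>
  define i where "i x = (if x \<in> ?I then chart_inv c x else undefined)" for x
  define d where "d x = ennreal (indicator ?I x * chart_density c x)" for x
  have [measurable]: "d \<in> borel_measurable borel"
    unfolding d_def by (intro measurable_ennreal measurable_compose[OF chart_density_measurable[OF c]] chart_image_borel chart c order_refl)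
  have [measurable]: "i \<in> borel_measurable borel"
    unfolding i_def using chart_image_borel[OF chart[OF c]] chart_inv_measurable[OF chart[OF c]]
    by (intro measurable_If_restrict_space_iff[THEN iffD2]) auto
  define \<nu> where "\<nu> = distr (density lborel d) borel i"
  have "emeasure \<nu> B = chart_volume c B" if B: "B \<in> sets borel" "B \<subseteq> fst c" for B
  proof -
    have [measurable]: "B \<in> sets borel" by fact
    have "emeasure \<nu> B = emeasure (density lborel d) (i -` B \<inter> space (density lborel d))"
      unfolding \<nu>_def by (rule emeasure_distr) (auto simp: B)
    also have "\<dots> = (\<integral>\<^sup>+x. d x * indicator (i -` B) x \<partial>lborel)"
      using measurable_sets[of i borel borel B] B by (subst emeasure_density) auto
    also have "\<dots> = chart_volume c B"
      unfolding chart_volume_eq chart_image_eq[OF chart[OF c] B(2)]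
      by (intro nn_integral_cong) (auto simp: d_def i_def indicator_def)
    finally show ?thesis .
  qed
  then show ?thesis using that[of \<nu>] by (simp add: \<nu>_def)
qed

definition is_volume :: "'a measure \<Rightarrow> bool" where
  "is_volume v \<longleftrightarrow> sets v = sets borel \<and>
    (\<forall>c\<in>A. \<forall>B\<in>sets borel. B \<subseteq> fst c \<longrightarrow> emeasure v B = chart_volume c B)"

text \<open>Finitely many charts cover, and their domains are cut into disjoint Borel pieces.
  Summing the chart volumes over the pieces defines the measure, the overlap lemma makes it right in
  every chart, and the same decomposition gives uniqueness.\<close>

lemma ex1_volume: "\<exists>!v. is_volume v"
proof -
  have op: "open (fst c)" if "c \<in> A" for c using open_chart_domain[OF chart[OF that]] .
  have cover: "(UNIV :: 'a set) \<subseteq> (\<Union>c\<in>A. fst c)"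
  proof
    fix p :: 'a
    obtain c where "c \<in> A" "p \<in> fst c" by (rule chart_cover)
    then show "p \<in> (\<Union>c\<in>A. fst c)" by blast
  qed
  obtain A' where A': "A' \<subseteq> A" "finite A'" "UNIV \<subseteq> (\<Union>c\<in>A'. fst c)"
    by (rule compactE_image[OF compact_UNIV op cover])
  obtain N :: nat and h where h: "A' = h ` {i. i < N}"
    using finite_imp_nat_seg_image_inj_on[OF A'(2)] by blast
  \<comment> \<open>Empty from index \<open>N\<close> on, so that only the chosen charts
    contribute.\<close>
  define E where "E = disjointed (\<lambda>i. if i < N then fst (h i) else {})"
  have hA: "h i \<in> A" if "i < N" for i using h A'(1) that by auto
  have E_sub: "E i \<subseteq> fst (h i)" if "i < N" for i
    using disjointed_subset[of "\<lambda>i. if i < N then fst (h i) else {}" i] that by (simp add: E_def)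
  have "(\<Union>i<N. E i) = (\<Union>i<N. fst (h i))"
    using finite_UN_disjointed_eq[of "\<lambda>i. if i < N then fst (h i) else {}" N]
    by (simp add: E_def atLeast0LessThan)
  also have "\<dots> = UNIV" using A'(3) h by auto
  finally have E_UN: "(\<Union>i<N. E i) = UNIV" .
  have E_disj: "disjoint_family_on E {..<N}"
    using disjoint_family_disjointed[of "\<lambda>i. if i < N then fst (h i) else {}"]
    by (auto simp: E_def disjoint_family_on_def)
  have "(\<lambda>i. if i < N then fst (h i) else {}) ` UNIV \<subseteq> sets borel"
    using borel_open[OF op[OF hA]] by auto
  then have E_borel: "E i \<in> sets borel" for i
    unfolding E_def using sets.range_disjointed_sets[of _ "borel :: 'a measure"] by blast
  have decomp: "emeasure M B = (\<Sum>i<N. emeasure M (B \<inter> E i))"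
    if M: "sets M = sets borel" and B: "B \<in> sets borel" for M :: "'a measure" and B
  proof -
    have "(\<Sum>i<N. emeasure M (B \<inter> E i)) = emeasure M (\<Union>i<N. B \<inter> E i)"
      using E_disj B E_borel M by (intro sum_emeasure) (auto simp: disjoint_family_on_def)
    also have "(\<Union>i<N. B \<inter> E i) = B" using E_UN by blast
    finally show ?thesis ..
  qed
  have "\<forall>i. \<exists>\<nu>. sets \<nu> = sets borel \<and> (i < N \<longrightarrow> (\<forall>B\<in>sets borel. B \<subseteq> fst (h i) \<longrightarrow> emeasure \<nu> B = chart_volume (h i) B))"
  proof
    fix i
    show "\<exists>\<nu>. sets \<nu> = sets borel \<and> (i < N \<longrightarrow> (\<forall>B\<in>sets borel. B \<subseteq> fst (h i) \<longrightarrow> emeasure \<nu> B = chart_volume (h i) B))"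
    proof (cases "i < N")
      case True
      show ?thesis
        by (rule chart_volume_measure[OF hA[OF True]]) blast
    qed (auto intro: exI[of _ borel])
  qed
  from choice[OF this] obtain \<nu> where \<nu>: "\<And>i. sets (\<nu> i) = sets borel"
    "\<And>i B. \<lbrakk>i < N; B \<in> sets borel; B \<subseteq> fst (h i)\<rbrakk> \<Longrightarrow> emeasure (\<nu> i) B = chart_volume (h i) B" by blast
  obtain v where v: "sets v = sets borel"
    "\<forall>B\<in>sets borel. emeasure v B = (\<Sum>i<N. emeasure (\<nu> i) (B \<inter> E i))"
    by (rule ex_sum_measure[of \<nu> E N, OF \<nu>(1) E_borel])
  have "is_volume v" unfolding is_volume_def
  proof (intro conjI ballI impI)
    fix c B assume c: "c \<in> A" and B: "B \<in> sets borel" "B \<subseteq> fst c"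
    obtain \<nu>' where \<nu>': "sets \<nu>' = sets borel"
      "\<forall>B\<in>sets borel. B \<subseteq> fst c \<longrightarrow> emeasure \<nu>' B = chart_volume c B"
      by (rule chart_volume_measure[OF c])
    have "emeasure v B = (\<Sum>i<N. emeasure \<nu>' (B \<inter> E i))"
      unfolding v(2)[rule_format, OF B(1)]
    proof (rule sum.cong[OF refl])
      fix i assume "i \<in> {..<N}"
      then have i: "i < N" by simp
      have BE: "B \<inter> E i \<in> sets borel" "B \<inter> E i \<subseteq> fst (h i)" "B \<inter> E i \<subseteq> fst c"
        using B E_borel E_sub[OF i] by auto
      show "emeasure (\<nu> i) (B \<inter> E i) = emeasure \<nu>' (B \<inter> E i)"
        unfolding \<nu>(2)[OF i BE(1,2)] \<nu>'(2)[rule_format, OF BE(1,3)]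
        by (rule chart_volume_overlap[OF hA[OF i] c BE])
    qed
    also have "\<dots> = emeasure \<nu>' B" using decomp[OF \<nu>'(1) B(1)] by simp
    finally show "emeasure v B = chart_volume c B" using \<nu>'(2) B by simp
  qed (rule v(1))
  moreover have "v = w" if vw: "is_volume v" "is_volume w" for v w
  proof (rule measure_eqI)
    show "sets v = sets w" using vw by (simp add: is_volume_def)
    fix B assume "B \<in> sets v"
    then have B: "B \<in> sets borel" using vw by (simp add: is_volume_def)
    have "emeasure v (B \<inter> E i) = emeasure w (B \<inter> E i)" if "i < N" for i
    proof -
      have "B \<inter> E i \<in> sets borel" "B \<inter> E i \<subseteq> fst (h i)" using B E_borel E_sub[OF that] by auto
      then show ?thesis using vw hA[OF that] unfolding is_volume_def by metis
    qed
    then show "emeasure v B = emeasure w B"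
      using vw decomp[OF _ B] by (simp add: is_volume_def)
  qed
  ultimately show ?thesis by blast
qed

abbreviation vol :: "'a measure" where "vol \<equiv> riemannian_volume A g"

lemma is_volume_vol: "is_volume vol"
proof -
  have "vol = (THE v. is_volume v)"
    by (simp add: riemannian_volume_def is_volume_def chart_volume_def)
  then show ?thesis using theI'[OF ex1_volume] by simp
qed

lemma sets_vol [simp]: "sets vol = sets borel" "space vol = UNIV"
  using is_volume_vol sets_eq_imp_space_eq[of vol borel] by (auto simp: is_volume_def)

lemma emeasure_vol: "\<lbrakk>c \<in> A; B \<in> sets borel; B \<subseteq> fst c\<rbrakk> \<Longrightarrow> emeasure vol B = chart_volume c B"
  using is_volume_vol by (auto simp: is_volume_def)

definition chart_ball :: "('a, 'n) chart \<Rightarrow> 'a \<Rightarrow> real \<Rightarrow> 'a set" where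
  "chart_ball c p r = {q \<in> fst c. dist (snd c q) (snd c p) < r}"

lemma open_chart_ball: "c \<in> A \<Longrightarrow> open (chart_ball c p r)"
  using chart_preimage_open[OF chart, of c "ball (snd c p) r"] by (simp add: chart_ball_def dist_commute)

text \<open>Near \<open>p\<close> the continuous density is at most its value at \<open>p\<close>
  plus 1. This yields finiteness of the volume and the growth rate behind the energy of
  bumps.\<close>

lemma chart_ball_volume:
  assumes c: "c \<in> A" "p \<in> fst c"
  obtains r0 m where "r0 > 0" "m \<ge> 0"
    "\<forall>r\<le>r0. emeasure vol (chart_ball c p r) \<le> ennreal m * emeasure lborel (ball (snd c p) r)"
proof -
  define x where "x = snd c p"
  have x: "x \<in> chart_image c" using c by (auto simp: x_def)
  have "continuous (at x within chart_image c) (chart_density c)"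
    by (rule continuous_on_eq_continuous_within[THEN iffD1, OF continuous_on_chart_density[OF c(1)], rule_format, OF x])
  then obtain r0 where r0: "r0 > 0" "\<And>y. \<lbrakk>y \<in> chart_image c; dist y x < r0\<rbrakk> \<Longrightarrow> dist (chart_density c y) (chart_density c x) < 1"
    unfolding continuous_within_eps_delta by (meson zero_less_one)
  define m where "m = chart_density c x + 1"
  have m: "m \<ge> 0" by (simp add: m_def chart_density_def)
  have "emeasure vol (chart_ball c p r) \<le> ennreal m * emeasure lborel (ball (snd c p) r)" if r: "r \<le> r0" for r
  proof -
    have "chart_ball c p r \<in> sets borel" "chart_ball c p r \<subseteq> fst c"
      using open_chart_ball[OF c(1)] by (auto simp: chart_ball_def)
    then have "emeasure vol (chart_ball c p r) = (\<integral>\<^sup>+y. ennreal (indicator (snd c ` chart_ball c p r) y * chart_density c y) \<partial>lborel)"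
      using c(1) by (simp add: emeasure_vol chart_volume_eq)
    also have "\<dots> \<le> (\<integral>\<^sup>+y. ennreal m * indicator (ball x r) y \<partial>lborel)"
    proof (rule nn_integral_mono)
      fix y
      show "ennreal (indicator (snd c ` chart_ball c p r) y * chart_density c y) \<le> ennreal m * indicator (ball x r) y"
      proof (cases "y \<in> snd c ` chart_ball c p r")
        case True
        then have y: "y \<in> chart_image c" "dist y x < r" by (auto simp: chart_ball_def x_def)
        then have "dist (chart_density c y) (chart_density c x) < 1" using r0 r by auto
        then have "ennreal (chart_density c y) \<le> ennreal m" by (intro ennreal_leI) (simp add: m_def dist_real_def)
        then show ?thesis using y(2) True by (simp add: dist_commute)
      qed simp
    qed
    also have "\<dots> = ennreal m * emeasure lborel (ball x r)" by (subst nn_integral_cmult_indicator) auto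
    finally show ?thesis by (simp add: x_def)
  qed
  then show ?thesis by (intro that[OF r0(1) m]) blast
qed

lemma finite_measure_vol: "finite_measure vol"
proof
  have "\<forall>p. \<exists>U. open U \<and> p \<in> U \<and> emeasure vol U < \<infinity>"
  proof
    fix p
    obtain c where c: "c \<in> A" "p \<in> fst c" by (rule chart_cover)
    obtain r0 m where r: "r0 > 0" "m \<ge> 0"
      "\<forall>r\<le>r0. emeasure vol (chart_ball c p r) \<le> ennreal m * emeasure lborel (ball (snd c p) r)"
      by (rule chart_ball_volume[OF c])
    have "emeasure vol (chart_ball c p r0) < \<infinity>"
      using r(3)[rule_format, of r0] emeasure_bounded_finite[OF bounded_ball, of "snd c p" r0]
      by (auto simp: ennreal_mult_less_top intro: le_less_trans)
    then show "\<exists>U. open U \<and> p \<in> U \<and> emeasure vol U < \<infinity>"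
      using open_chart_ball[OF c(1)] c r(1) by (intro exI[of _ "chart_ball c p r0"]) (auto simp: chart_ball_def)
  qed
  from choice[OF this] obtain U where U: "\<And>p. open (U p)" "\<And>p. p \<in> U p" "\<And>p. emeasure vol (U p) < \<infinity>" by blast
  have cover: "UNIV \<subseteq> (\<Union>p\<in>UNIV. U p)" using U(2) by blast
  obtain I where I: "I \<subseteq> UNIV" "finite I" "UNIV \<subseteq> (\<Union>p\<in>I. U p)"
    by (rule compactE_image[OF compact_UNIV U(1) cover])
  have "emeasure vol (\<Union>p\<in>I. U p) \<le> (\<Sum>p\<in>I. emeasure vol (U p))"
    using I U by (intro emeasure_subadditive_finite) auto
  also have "\<dots> < \<infinity>" using U I by (simp add: less_top[symmetric] ennreal_sum_less_top)
  finally show "emeasure vol (space vol) \<noteq> \<infinity>" using I(3) by (auto simp: top.extremum_unique)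
qed

lemma integrable_continuous_vol:
  fixes f :: "'a \<Rightarrow> real"
  assumes "continuous_on UNIV f"
  shows "integrable vol f"
proof -
  interpret finite_measure vol by (rule finite_measure_vol)
  have "bounded (range f)" using compact_continuous_image[OF assms compact_UNIV] by (rule compact_imp_bounded)
  then obtain C where "\<And>x. \<bar>f x\<bar> \<le> C" by (auto simp: bounded_iff)
  then show ?thesis
    using borel_measurable_continuous_onI[OF assms]
    by (intro integrable_const_bound[of _ C]) (auto simp: measurable_cong_sets[OF sets_vol(1) refl])
qed

lemma integrable_gradient_inner:
  "\<lbrakk>u \<in> smooth_functions A; w \<in> smooth_functions A\<rbrakk> \<Longrightarrow> integrable vol (gradient_inner A g u w)"
  by (intro integrable_continuous_vol continuous_on_gradient_inner)

lemma subspace_smooth_functions: "subspace (smooth_functions A)"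
proof (rule subspaceI)
  show "0 \<in> smooth_functions A" using smooth_functions_const[of 0] by (simp add: zero_fun_def)
  show "x + y \<in> smooth_functions A" if "x \<in> smooth_functions A" "y \<in> smooth_functions A" for x y
    using smooth_functions_add[OF that] by (simp add: plus_fun_def)
  show "c *\<^sub>R x \<in> smooth_functions A" if "x \<in> smooth_functions A" for c x
    using smooth_functions_mult[OF smooth_functions_const that] by (simp add: scaleR_fun_def)
qed

sublocale D: psd_form "smooth_functions A" "dirichlet_form A g"
proof
  show "subspace (smooth_functions A)" by (rule subspace_smooth_functions)
  fix x y z assume x: "x \<in> smooth_functions A" and y: "y \<in> smooth_functions A"
  {
    assume z: "z \<in> smooth_functions A"
    show "dirichlet_form A g (x + y) z = dirichlet_form A g x z + dirichlet_form A g y z"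
      using x y z by (simp add: dirichlet_form_def plus_fun_def gradient_inner_add integrable_gradient_inner)
  }
  show "dirichlet_form A g (c *\<^sub>R x) y = c * dirichlet_form A g x y" for c
    using x y by (simp add: dirichlet_form_def scaleR_fun_def gradient_inner_scale)
  show "dirichlet_form A g x y = dirichlet_form A g y x"
    using gradient_inner_sym[OF x y] by (simp add: dirichlet_form_def)
  show "0 \<le> dirichlet_form A g x x"
    by (simp add: dirichlet_form_def gradient_inner_nonneg)
qed

lemma dirichlet_const: "u \<in> smooth_functions A \<Longrightarrow> dirichlet_form A g (\<lambda>_. a) u = 0"
  by (simp add: dirichlet_form_def gradient_inner_const)

end

section \<open>Square integrable functions\<close>

lemma L2_mult_integrable:
  assumes "f \<in> L2 M" "h \<in> L2 M"
  shows "integrable M (\<lambda>x. f x * h x)"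
proof (rule Bochner_Integration.integrable_bound)
  show "integrable M (\<lambda>x. (f x)\<^sup>2 + (h x)\<^sup>2)" using assms by (auto simp: L2_def)
  show "(\<lambda>x. f x * h x) \<in> borel_measurable M" using assms by (auto simp: L2_def)
  have "\<bar>a * b\<bar> \<le> a\<^sup>2 + b\<^sup>2" for a b :: real
  proof -
    have "2 * (\<bar>a\<bar> * \<bar>b\<bar>) \<le> a\<^sup>2 + b\<^sup>2" using sum_squares_bound[of "\<bar>a\<bar>" "\<bar>b\<bar>"] by simp
    moreover have "0 \<le> \<bar>a\<bar> * \<bar>b\<bar>" by simp
    ultimately show ?thesis unfolding abs_mult by linarith
  qed
  then show "AE x in M. norm (f x * h x) \<le> norm ((f x)\<^sup>2 + (h x)\<^sup>2)" by (intro AE_I2) simp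
qed

definition L2_inner :: "'a measure \<Rightarrow> ('a \<Rightarrow> real) \<Rightarrow> ('a \<Rightarrow> real) \<Rightarrow> real" where
  "L2_inner M f h = (\<integral>x. f x * h x \<partial>M)"

lemma L2_square_expand:
  "f \<in> L2 M \<Longrightarrow> h \<in> L2 M \<Longrightarrow> integrable M (\<lambda>x. (f x + h x)\<^sup>2)"
  using L2_mult_integrable[of f M h] by (auto simp: power2_sum L2_def mult.assoc)

lemma psd_form_L2: "psd_form (L2 M) (L2_inner M)"
proof
  show "subspace (L2 M)"
  proof (rule subspaceI)
    show "0 \<in> L2 M" by (simp add: L2_def zero_fun_def)
    show "f + h \<in> L2 M" if "f \<in> L2 M" "h \<in> L2 M" for f h
      using L2_square_expand[OF that] that by (auto simp: L2_def plus_fun_def)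
    show "c *\<^sub>R f \<in> L2 M" if "f \<in> L2 M" for c f
      using that by (auto simp: L2_def scaleR_fun_def power_mult_distrib)
  qed
  fix f h k assume f: "f \<in> L2 M" and h: "h \<in> L2 M"
  show "L2_inner M (f + h) k = L2_inner M f k + L2_inner M h k" if k: "k \<in> L2 M"
    using L2_mult_integrable[OF f k] L2_mult_integrable[OF h k]
    by (simp add: L2_inner_def plus_fun_def distrib_right)
  show "L2_inner M (c *\<^sub>R f) h = c * L2_inner M f h" for c
    by (simp add: L2_inner_def scaleR_fun_def mult.assoc)
  show "L2_inner M f h = L2_inner M h f" by (simp add: L2_inner_def mult.commute)
  show "0 \<le> L2_inner M f f" by (simp add: L2_inner_def)
qed

lemma L2_inner_self: "L2_inner M f f = (\<integral>x. (f x)\<^sup>2 \<partial>M)"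
  by (simp add: L2_inner_def power2_eq_square)

lemma AE_zero_iff_L2:
  assumes "f \<in> L2 M"
  shows "(AE x in M. f x = 0) \<longleftrightarrow> L2_inner M f f = 0"
  using integral_nonneg_eq_0_iff_AE[of M "\<lambda>x. (f x)\<^sup>2"] assms by (auto simp: L2_inner_self L2_def)

context finite_measure
begin

lemma bounded_in_L2:
  assumes "f \<in> borel_measurable M" "\<And>x. \<bar>f x\<bar> \<le> C"
  shows "f \<in> L2 M"
proof -
  have "(f x)\<^sup>2 \<le> C\<^sup>2" for x using assms(2)[of x] by (simp add: abs_le_square_iff[symmetric])
  then show ?thesis using assms(1) unfolding L2_def
    by (auto intro!: integrable_const_bound[of _ "C\<^sup>2"])
qed

lemma L2_integrable: "f \<in> L2 M \<Longrightarrow> integrable M f"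
  using L2_mult_integrable[of f M "\<lambda>_. 1"] bounded_in_L2[of "\<lambda>_. 1" 1] by simp

end

text \<open>On a finite measure space an \<open>L\<^sup>2\<close>-Cauchy sequence is \<open>L\<^sup>1\<close>-Cauchy, so a subsequence converges almost
  everywhere; Fatou's lemma bounds the \<open>L\<^sup>2\<close>-distance to its limit.\<close>

lemma L2_complete:
  assumes s: "s \<in> psd_form.cauchy_seqs (L2 M) (L2_inner M)" and fin: "finite_measure M"
  shows "\<exists>f\<in>L2 M. L2_tendsto M s f"
proof -
  interpret psd_form "L2 M" "L2_inner M" by (rule psd_form_L2)
  interpret finite_measure M by (rule fin)
  note sL [simp] = cauchy_seqs_mem[OF s]
  have [measurable]: "s n \<in> borel_measurable M" for n using sL[of n] by (simp add: L2_def)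
  have int: "integrable M (s n)" for n by (rule L2_integrable) simp
  have one: "(\<lambda>_. 1) \<in> L2 M" by (rule bounded_in_L2[of _ 1]) auto
  \<comment> \<open>The summand 1 keeps the constant positive even for the zero measure.\<close>
  define C where "C = nrm (\<lambda>_. 1) + 1"
  have C: "C > 0" using nrm_nonneg[OF one] by (simp add: C_def)
  have L1: "(\<integral>x. norm (s i x - s j x) \<partial>M) \<le> nrm (s i - s j) * C" for i j
  proof -
    have ab: "(\<lambda>x. \<bar>s i x - s j x\<bar>) \<in> L2 M" using mem_simps(3)[OF sL[of i] sL[of j]] by (auto simp: L2_def)
    have "(\<integral>x. norm (s i x - s j x) \<partial>M) \<le> nrm (\<lambda>x. \<bar>s i x - s j x\<bar>) * nrm (\<lambda>_. 1)"
      using abs_le_nrm[OF ab one] by (simp add: L2_inner_def)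
    also have "nrm (\<lambda>x. \<bar>s i x - s j x\<bar>) = nrm (s i - s j)" by (simp add: nrm_def L2_inner_self)
    also have "nrm (s i - s j) * nrm (\<lambda>_. 1) \<le> nrm (s i - s j) * C"
      by (intro mult_left_mono) (simp_all add: C_def)
    finally show ?thesis .
  qed
  have "\<exists>N. \<forall>i\<ge>N. \<forall>j\<ge>N. (\<integral>x. norm (s i x - s j x) \<partial>M) < e" if "e > 0" for e
  proof -
    have "e / C > 0" using that C by simp
    then obtain N where N: "\<And>m n. \<lbrakk>m \<ge> N; n \<ge> N\<rbrakk> \<Longrightarrow> nrm (s m - s n) < e / C"
      by (rule cauchy_seqsE[OF s]) blast
    show ?thesis
    proof (intro exI[of _ N] allI impI)
      fix i j assume "i \<ge> N" "j \<ge> N"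
      then have "nrm (s i - s j) * C < e" using N C by (simp add: pos_less_divide_eq)
      then show "(\<integral>x. norm (s i x - s j x) \<partial>M) < e" using L1[of i j] by simp
    qed
  qed
  from cauchy_L1_AE_cauchy_subseq[OF int this]
  obtain r where r: "strict_mono r" "AE x in M. Cauchy (\<lambda>i. s (r i) x)" by blast
  define f where "f x = lim (\<lambda>k. s (r k) x)" for x
  have [measurable]: "f \<in> borel_measurable M" unfolding f_def by measurable
  have conv: "AE x in M. (\<lambda>k. s (r k) x) \<longlonglongrightarrow> f x"
    using r(2) by eventually_elim (simp add: f_def Cauchy_convergent_iff convergent_LIMSEQ_iff)
  have bound: "(\<integral>\<^sup>+x. ennreal ((s n x - f x)\<^sup>2) \<partial>M) \<le> ennreal (e\<^sup>2)"
    if N: "\<And>m n. \<lbrakk>m \<ge> N; n \<ge> N\<rbrakk> \<Longrightarrow> nrm (s m - s n) < e" and n: "n \<ge> N" for N n e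
  proof -
    have "(\<integral>\<^sup>+x. ennreal ((s n x - f x)\<^sup>2) \<partial>M) = (\<integral>\<^sup>+x. liminf (\<lambda>k. ennreal ((s n x - s (r k) x)\<^sup>2)) \<partial>M)"
    proof (rule nn_integral_cong_AE)
      show "AE x in M. ennreal ((s n x - f x)\<^sup>2) = liminf (\<lambda>k. ennreal ((s n x - s (r k) x)\<^sup>2))"
        using conv
      proof eventually_elim
        case (elim x)
        have "(\<lambda>k. ennreal ((s n x - s (r k) x)\<^sup>2)) \<longlonglongrightarrow> ennreal ((s n x - f x)\<^sup>2)"
          by (intro tendsto_intros elim)
        then show ?case by (intro lim_imp_Liminf[symmetric]) auto
      qed
    qed
    also have "\<dots> \<le> liminf (\<lambda>k. \<integral>\<^sup>+x. ennreal ((s n x - s (r k) x)\<^sup>2) \<partial>M)"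
      by (rule nn_integral_liminf) measurable
    also have "\<dots> \<le> ennreal (e\<^sup>2)"
    proof (rule Liminf_le)
      show "eventually (\<lambda>k. (\<integral>\<^sup>+x. ennreal ((s n x - s (r k) x)\<^sup>2) \<partial>M) \<le> ennreal (e\<^sup>2)) sequentially"
        unfolding eventually_sequentially
      proof (intro exI[of _ N] allI impI)
        fix k assume "k \<ge> N"
        then have "r k \<ge> N" using seq_suble[OF r(1), of k] by simp
        have mem: "s n - s (r k) \<in> L2 M" by simp
        have "(\<integral>\<^sup>+x. ennreal ((s n x - s (r k) x)\<^sup>2) \<partial>M) = ennreal (\<integral>x. ((s n - s (r k)) x)\<^sup>2 \<partial>M)"
          using mem by (subst nn_integral_eq_integral) (auto simp: L2_def)
        also have "(\<integral>x. ((s n - s (r k)) x)\<^sup>2 \<partial>M) = (nrm (s n - s (r k)))\<^sup>2"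
          using mem by (simp add: nrm_square L2_inner_self)
        also have "\<dots> \<le> e\<^sup>2"
          using N[OF n \<open>r k \<ge> N\<close>] nrm_nonneg[OF mem] by (intro power_mono) auto
        finally show "(\<integral>\<^sup>+x. ennreal ((s n x - s (r k) x)\<^sup>2) \<partial>M) \<le> ennreal (e\<^sup>2)"
          by (simp add: ennreal_leI)
      qed
    qed simp
    finally show ?thesis .
  qed
  have close: "(\<lambda>x. s n x - f x) \<in> L2 M" "(\<integral>x. (s n x - f x)\<^sup>2 \<partial>M) \<le> e\<^sup>2"
    if N: "\<And>m n. \<lbrakk>m \<ge> N; n \<ge> N\<rbrakk> \<Longrightarrow> nrm (s m - s n) < e" and n: "n \<ge> N" for N n e
  proof -
    note b = bound[of N e n, OF N n]
    have "integrable M (\<lambda>x. (s n x - f x)\<^sup>2)"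
      using b by (intro integrableI_nonneg) (auto simp: le_less_trans)
    then show "(\<lambda>x. s n x - f x) \<in> L2 M" by (simp add: L2_def)
    have "ennreal (\<integral>x. (s n x - f x)\<^sup>2 \<partial>M) \<le> ennreal (e\<^sup>2)"
      using b \<open>integrable M (\<lambda>x. (s n x - f x)\<^sup>2)\<close> by (subst nn_integral_eq_integral[symmetric]) auto
    then show "(\<integral>x. (s n x - f x)\<^sup>2 \<partial>M) \<le> e\<^sup>2" by (simp add: ennreal_le_iff)
  qed
  obtain N1 where N1: "\<And>m n. \<lbrakk>m \<ge> N1; n \<ge> N1\<rbrakk> \<Longrightarrow> nrm (s m - s n) < 1"
    by (rule cauchy_seqsE[OF s, of 1]) auto
  \<comment> \<open>Only differences with \<open>f\<close> are known to be square integrable;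
    subtracting one from a member of the sequence recovers \<open>f\<close>.\<close>
  have "s N1 - (\<lambda>x. s N1 x - f x) \<in> L2 M"
    by (intro mem_simps close(1)[of N1 1] sL) (use N1 in auto)
  then have fL: "f \<in> L2 M" by (simp add: fun_diff_def)
  have "L2_tendsto M s f" unfolding L2_tendsto_def
  proof (rule LIMSEQ_I)
    fix e :: real assume e: "e > 0"
    define d where "d = sqrt (e / 2)"
    have d: "d > 0" "d\<^sup>2 = e / 2" using e by (auto simp: d_def)
    obtain N where N: "\<And>m n. \<lbrakk>m \<ge> N; n \<ge> N\<rbrakk> \<Longrightarrow> nrm (s m - s n) < d"
      by (rule cauchy_seqsE[OF s d(1)]) auto
    show "\<exists>N. \<forall>n\<ge>N. norm ((\<integral>x. (s n x - f x)\<^sup>2 \<partial>M) - 0) < e"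
    proof (intro exI[of _ N] allI impI)
      fix n assume "n \<ge> N"
      from close(2)[of N d n, OF N this] show "norm ((\<integral>x. (s n x - f x)\<^sup>2 \<partial>M) - 0) < e"
        using d e by simp
    qed
  qed
  with fL show ?thesis by blast
qed

text \<open>Functions approximable from \<open>G\<close> form a linear space, so indicators give
  simple functions. Simple functions converging pointwise to \<open>h\<close> and bounded by twice
  its modulus converge in L2 by dominated convergence.\<close>

lemma L2_dense:
  assumes fin: "finite_measure M" and G: "subspace G" "G \<subseteq> L2 M"
    and ind: "\<And>B e. \<lbrakk>B \<in> sets M; e > 0\<rbrakk> \<Longrightarrow> \<exists>f\<in>G. psd_form.nrm (L2_inner M) (indicator B - f) < e"
    and h: "h \<in> L2 M" and e: "e > 0"
  shows "\<exists>f\<in>G. psd_form.nrm (L2_inner M) (h - f) < e"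
proof -
  interpret psd_form "L2 M" "L2_inner M" by (rule psd_form_L2)
  interpret finite_measure M by (rule fin)
  note GL = subsetD[OF G(2)]
  have indL: "indicator B \<in> L2 M" if "B \<in> sets M" for B
    using that by (intro bounded_in_L2[of _ 1]) (auto simp: indicator_def)
  define P where "P u \<longleftrightarrow> u \<in> L2 M \<and> (\<forall>e>0. \<exists>f\<in>G. nrm (u - f) < e)" for u
  have P_add: "P (u + w)" if uw: "P u" "P w" for u w
    unfolding P_def
  proof (intro conjI allI impI)
    show "u + w \<in> L2 M" using uw by (simp add: P_def)
    fix e :: real assume "e > 0"
    then have "e / 2 > 0" by simp
    then obtain f k where f: "f \<in> G" "nrm (u - f) < e / 2" and k: "k \<in> G" "nrm (w - k) < e / 2"
      using uw unfolding P_def by meson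
    have "nrm ((u - f) + (w - k)) \<le> nrm (u - f) + nrm (w - k)"
      using uw GL f(1) k(1) by (intro nrm_triangle) (auto simp: P_def)
    then show "\<exists>f\<in>G. nrm (u + w - f) < e"
      using f k subspace_add[OF G(1) f(1) k(1)] by (intro bexI[of _ "f + k"]) (auto simp: algebra_simps)
  qed
  have P_scale: "P (c *\<^sub>R u)" if u: "P u" for u c
    unfolding P_def
  proof (intro conjI allI impI)
    show "c *\<^sub>R u \<in> L2 M" using u by (simp add: P_def)
    fix e :: real assume e: "e > 0"
    have pos: "\<bar>c\<bar> + 1 > 0" by (simp add: add_nonneg_pos)
    then have "e / (\<bar>c\<bar> + 1) > 0" using e by simp
    then obtain f where f: "f \<in> G" "nrm (u - f) < e / (\<bar>c\<bar> + 1)"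
      using u unfolding P_def by meson
    have mem: "u - f \<in> L2 M" using u f(1) GL by (simp add: P_def)
    have "nrm (c *\<^sub>R u - c *\<^sub>R f) = \<bar>c\<bar> * nrm (u - f)"
      using nrm_scale[OF mem] by (simp add: scaleR_diff_right)
    also have "\<dots> \<le> (\<bar>c\<bar> + 1) * nrm (u - f)" using nrm_nonneg[OF mem] by (intro mult_right_mono) auto
    also have "\<dots> < e" using f(2) pos by (simp add: pos_less_divide_eq mult.commute)
    finally show "\<exists>f\<in>G. nrm (c *\<^sub>R u - f) < e"
      using subspace_scale[OF G(1) f(1)] by blast
  qed
  have P_0: "P 0" using subspace_0[OF G(1)] by (auto simp: P_def nrm_def intro!: bexI[of _ 0])
  have P_ind: "P (indicator B)" if "B \<in> sets M" for B
    using ind[OF that] indL[OF that] by (simp add: P_def)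
  have P_simple: "P (\<lambda>x. \<Sum>y\<in>Y. y * indicator (F y) x)" if "finite Y" "\<And>y. y \<in> Y \<Longrightarrow> F y \<in> sets M" for Y F
    using that
  proof (induction Y rule: finite_induct)
    case empty
    then show ?case using P_0 by (simp add: zero_fun_def)
  next
    case (insert y Y)
    have "P (y *\<^sub>R indicator (F y) + (\<lambda>x. \<Sum>y\<in>Y. y * indicator (F y) x))"
      using insert by (intro P_add P_scale P_ind) auto
    then show ?case
      by (simp only: sum.insert[OF insert.hyps(1,2)] plus_fun_def scaleR_fun_def real_scaleR_def)
  qed
  have hm [measurable]: "h \<in> borel_measurable M" using h by (simp add: L2_def)
  obtain F where F0: "\<forall>i. simple_function M (F i)" "\<forall>x\<in>space M. (\<lambda>i. F i x) \<longlonglongrightarrow> h x"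
    "\<forall>i. \<forall>x\<in>space M. norm (F i x) \<le> 2 * norm (h x)"
    using borel_measurable_implies_sequence_metric[OF hm, of 0] by (auto simp: dist_norm)
  note F = F0[rule_format]
  have Fm [measurable]: "F i \<in> borel_measurable M" for i using F(1) by (rule borel_measurable_simple_function)
  have FP: "\<exists>u. P u \<and> (\<forall>x\<in>space M. u x = F i x)" for i
  proof -
    let ?u = "\<lambda>x. \<Sum>y\<in>F i ` space M. y * indicator (F i -` {y} \<inter> space M) x"
    have "P ?u" using simple_functionD[OF F(1)[of i]] by (intro P_simple) auto
    moreover have "?u x = F i x" if "x \<in> space M" for x
    proof -
      have "?u x = (\<Sum>y\<in>F i ` space M. if y = F i x then y else 0)"
        using that by (intro sum.cong) (auto simp: indicator_def)
      also have "\<dots> = F i x" using that simple_functionD(1)[OF F(1)[of i]] by simp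
      finally show ?thesis .
    qed
    ultimately show ?thesis by blast
  qed
  have "(\<lambda>i. \<integral>x. (h x - F i x)\<^sup>2 \<partial>M) \<longlonglongrightarrow> (\<integral>x. 0 \<partial>M)"
  proof (rule integral_dominated_convergence)
    show "integrable M (\<lambda>x. 9 * (h x)\<^sup>2)" using h by (simp add: L2_def)
    show "AE x in M. (\<lambda>i. (h x - F i x)\<^sup>2) \<longlonglongrightarrow> 0"
    proof (intro AE_I2)
      fix x assume "x \<in> space M"
      then have "(\<lambda>i. (h x - F i x)\<^sup>2) \<longlonglongrightarrow> (h x - h x)\<^sup>2" by (intro tendsto_intros F)
      then show "(\<lambda>i. (h x - F i x)\<^sup>2) \<longlonglongrightarrow> 0" by simp
    qed
    show "AE x in M. norm ((h x - F i x)\<^sup>2) \<le> 9 * (h x)\<^sup>2" for i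
    proof (intro AE_I2)
      fix x assume "x \<in> space M"
      \<comment> \<open>The source of the factor 9 in the dominating function.\<close>
      then have "\<bar>h x - F i x\<bar> \<le> 3 * \<bar>h x\<bar>" using F(3)[of x i] by simp
      then have "(h x - F i x)\<^sup>2 \<le> (3 * \<bar>h x\<bar>)\<^sup>2" by (metis abs_ge_zero power2_abs power_mono)
      then show "norm ((h x - F i x)\<^sup>2) \<le> 9 * (h x)\<^sup>2" by (simp add: power_mult_distrib)
    qed
  qed auto
  then have lim: "(\<lambda>i. \<integral>x. (h x - F i x)\<^sup>2 \<partial>M) \<longlonglongrightarrow> 0" by simp
  have "(e / 2)\<^sup>2 > 0" using e by simp
  from order_tendstoD(2)[OF lim this] obtain i where i: "(\<integral>x. (h x - F i x)\<^sup>2 \<partial>M) < (e / 2)\<^sup>2"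
    by (auto simp: eventually_sequentially)
  obtain u where u: "P u" "\<forall>x\<in>space M. u x = F i x" using FP by blast
  have uL: "u \<in> L2 M" using u by (simp add: P_def)
  have "(nrm (h - u))\<^sup>2 = (\<integral>x. (h x - F i x)\<^sup>2 \<partial>M)"
    using h uL u(2) by (subst nrm_square) (auto simp: L2_inner_self intro!: Bochner_Integration.integral_cong)
  then have "nrm (h - u) < e / 2" using i e by (metis half_gt_zero power_less_imp_less_base less_imp_le)
  moreover obtain f where f: "f \<in> G" "nrm (u - f) < e / 2" using u(1) e unfolding P_def by (meson half_gt_zero)
  moreover have "nrm (h - f) \<le> nrm (h - u) + nrm (u - f)"
    using h uL GL[OF f(1)] by (rule nrm_triangle_diff)
  ultimately show ?thesis by (intro bexI[of _ f]) auto
qed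

section \<open>Smooth bump functions on the manifold\<close>

lemma power2_norm_cart: "(norm (v :: real^'n))\<^sup>2 = (\<Sum>i\<in>UNIV. v $ i * v $ i)"
  by (simp add: power2_norm_eq_inner inner_vec_def)

context closed_manifold
begin

text \<open>The chart image is locally closed, so it meets small closed balls in compact sets. Their
  preimages are compact, hence closed in the Hausdorff manifold, which is what extension by zero
  requires.\<close>

lemma chart_closed_nbhd:
  assumes c: "c \<in> A" "p \<in> fst c" and V: "open V" "p \<in> V"
  obtains r0 where "r0 > 0"
    "\<forall>r\<le>r0. closed {q \<in> fst c. norm (snd c q - snd c p) \<le> r} \<and> {q \<in> fst c. norm (snd c q - snd c p) \<le> r} \<subseteq> V"
proof -
  note ch = chart[OF c(1)]
  obtain C Q where CQ: "closed C" "open Q" "chart_image c = C \<inter> Q"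
    by (rule lipschitz_domain_locally_closed[OF chart_lipschitz[OF ch]])
  obtain U where U: "open U" "snd c ` (fst c \<inter> V) = chart_image c \<inter> U"
    by (rule chart_image_relatively_open[OF ch V(1)])
  have "snd c p \<in> Q \<inter> U" "open (Q \<inter> U)" using CQ U c V by auto
  then obtain r0 where r0: "r0 > 0" "cball (snd c p) r0 \<subseteq> Q \<inter> U" using open_contains_cball by blast
  have "closed {q \<in> fst c. norm (snd c q - snd c p) \<le> r} \<and> {q \<in> fst c. norm (snd c q - snd c p) \<le> r} \<subseteq> V"
    if r: "r \<le> r0" for r
  proof
    let ?K = "{q \<in> fst c. norm (snd c q - snd c p) \<le> r}"
    have sub: "cball (snd c p) r \<subseteq> Q \<inter> U" using r0(2) subset_cball[OF r] by blast
    have eq: "chart_image c \<inter> cball (snd c p) r = C \<inter> cball (snd c p) r" using CQ(3) sub by blast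
    have "compact (chart_inv c ` (chart_image c \<inter> cball (snd c p) r))"
    proof (rule compact_continuous_image)
      show "continuous_on (chart_image c \<inter> cball (snd c p) r) (chart_inv c)"
        by (rule continuous_on_subset[OF continuous_on_chart_inv[OF ch]]) simp
      show "compact (chart_image c \<inter> cball (snd c p) r)"
        unfolding eq using CQ(1) by (intro closed_Int_compact) auto
    qed
    moreover have "chart_inv c ` (chart_image c \<inter> cball (snd c p) r) = ?K"
    proof (intro equalityI subsetI)
      fix q assume "q \<in> chart_inv c ` (chart_image c \<inter> cball (snd c p) r)"
      then obtain y where y: "y \<in> chart_image c" "y \<in> cball (snd c p) r" "q = chart_inv c y" by blast
      then show "q \<in> ?K"
        using chart_chart_inv[OF ch y(1)] chart_inv_mem[OF ch y(1)] by (simp add: dist_norm norm_minus_commute)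
    next
      fix q assume q: "q \<in> ?K"
      then have "snd c q \<in> chart_image c \<inter> cball (snd c p) r" by (simp add: dist_norm norm_minus_commute)
      moreover have "q = chart_inv c (snd c q)" using q chart_inv_chart[OF ch] by simp
      ultimately show "q \<in> chart_inv c ` (chart_image c \<inter> cball (snd c p) r)" by blast
    qed
    ultimately show "closed ?K" by (simp add: compact_imp_closed)
    show "?K \<subseteq> V"
    proof
      fix q assume q: "q \<in> ?K"
      then have "snd c q \<in> cball (snd c p) r" by (simp add: dist_norm norm_minus_commute)
      then have "snd c q \<in> U" "snd c q \<in> chart_image c" using q sub by auto
      then have "snd c q \<in> snd c ` (fst c \<inter> V)" using U(2) by blast
      then obtain q' where "q' \<in> fst c" "q' \<in> V" "snd c q = snd c q'" by blast
      then show "q \<in> V" using q chart_inv_chart[OF ch] by (metis mem_Collect_eq)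
    qed
  qed
  then show ?thesis by (intro that[OF r0(1)]) blast
qed

text \<open>The squared distance keeps the bump smooth at the centre. It is 1 up to squared
  coordinate radius 1/s and 0 beyond 2/s, so its gradient lives in an annulus whose shape does not
  depend on \<open>s\<close>.\<close>

definition bump :: "('a, 'n) chart \<Rightarrow> 'a \<Rightarrow> real \<Rightarrow> 'a \<Rightarrow> real" where
  "bump c p s q = (if q \<in> fst c then cutoff (s * (norm (snd c q - snd c p))\<^sup>2 - 1) else 0)"

definition bump_support :: "('a, 'n) chart \<Rightarrow> 'a \<Rightarrow> real \<Rightarrow> 'a set" where
  "bump_support c p s = {q \<in> fst c. s * (norm (snd c q - snd c p))\<^sup>2 \<le> 2}"

lemma bump_range: "0 \<le> bump c p s q" "bump c p s q \<le> 1"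
  by (simp_all add: bump_def cutoff_nonneg cutoff_le_1)

lemma bump_outside: "q \<notin> bump_support c p s \<Longrightarrow> bump c p s q = 0"
  by (auto simp: bump_def bump_support_def cutoff_eq_0)

lemma bump_center: "p \<in> fst c \<Longrightarrow> bump c p s p = 1"
  by (simp add: bump_def cutoff_eq_1)

lemma locally_zero_outside:
  assumes "closed K" "c' \<in> A" "y \<in> chart_image c'" "chart_inv c' y \<notin> K"
  obtains U where "open U" "y \<in> U" "\<forall>z\<in>chart_image c' \<inter> U. chart_inv c' z \<notin> K"
proof -
  note ch = chart[OF assms(2)]
  obtain U where U: "open U" "snd c' ` (fst c' \<inter> - K) = chart_image c' \<inter> U"
    by (rule chart_image_relatively_open[OF ch, of "- K"]) (use assms(1) in auto)
  have "y = snd c' (chart_inv c' y)" "chart_inv c' y \<in> fst c' \<inter> - K"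
    using chart_chart_inv[OF ch assms(3)] chart_inv_mem[OF ch assms(3)] assms(4) by auto
  then have "y \<in> snd c' ` (fst c' \<inter> - K)" by blast
  then have "y \<in> U" using U(2) by blast
  moreover have "chart_inv c' z \<notin> K" if "z \<in> chart_image c' \<inter> U" for z
  proof -
    have "z \<in> snd c' ` (fst c' \<inter> - K)" using that U(2) by blast
    then show ?thesis using chart_inv_chart[OF ch] by auto
  qed
  ultimately show ?thesis using U(1) by (intro that) auto
qed

text \<open>Where the charts overlap, the bump is an explicit smooth expression in the extended
  transition map. Elsewhere closedness of the support gives a neighbourhood on which it is
  0.\<close>

lemma bump_smooth:
  assumes c: "c \<in> A" "p \<in> fst c" and K: "closed (bump_support c p s)"
  shows "bump c p s \<in> smooth_functions A"
  unfolding smooth_functions_def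
proof (intro CollectI ballI smooth_on_setI)
  fix c' y assume c': "c' \<in> A" and y: "y \<in> chart_image c'"
  note ch = chart[OF c(1)] and ch' = chart[OF c']
  show "\<exists>U F. open U \<and> y \<in> U \<and> (\<forall>k. Ck_on k U F) \<and> (\<forall>z\<in>chart_image c' \<inter> U. F z = (bump c p s \<circ> chart_inv c') z)"
  proof (cases "chart_inv c' y \<in> fst c")
    case True
    then have yo: "y \<in> overlap c' c"
      using chart_chart_inv[OF ch' y] chart_inv_mem[OF ch' y] by (metis IntI imageI)
    have "\<forall>i. \<exists>UG. open (fst UG) \<and> y \<in> fst UG \<and> (\<forall>k. Ck_on k (fst UG) (snd UG)) \<and>
        (\<forall>z\<in>overlap c' c \<inter> fst UG. snd UG z = transition c' c z $ i)"
      using transition_smooth[OF c' c(1)] yo unfolding smooth_on_set_def by fastforce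
    from choice[OF this] obtain UG where UG: "\<And>i. open (fst (UG i))" "\<And>i. y \<in> fst (UG i)"
      "\<And>i k. Ck_on k (fst (UG i)) (snd (UG i))"
      "\<And>i z. z \<in> overlap c' c \<inter> fst (UG i) \<Longrightarrow> snd (UG i) z = transition c' c z $ i"
      by blast
    obtain U' where U': "open U'" "overlap c' c = chart_image c' \<inter> U'"
      by (rule overlap_relatively_open[OF c' c(1)])
    define U where "U = (\<Inter>i. fst (UG i)) \<inter> U'"
    define F where "F z = cutoff (s * (\<Sum>i\<in>UNIV. (snd (UG i) z + - (snd c p $ i)) * (snd (UG i) z + - (snd c p $ i))) + - 1)" for z
    have "open U" unfolding U_def by (intro open_Int open_INT ballI UG(1) U'(1)) simp
    moreover have "y \<in> U" using UG(2) U'(2) yo by (auto simp: U_def)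
    moreover have "Ck_on k U F" for k
    proof -
      have "Ck_on k U (snd (UG i))" for k i
        by (rule Ck_on_subset[OF UG(3)[of k i]]) (auto simp: U_def)
      then show ?thesis unfolding F_def
        by (intro Ck_on_cutoff Ck_on_add Ck_on_mult Ck_on_sum Ck_on_const \<open>open U\<close>)
    qed
    moreover have "F z = (bump c p s \<circ> chart_inv c') z" if z: "z \<in> chart_image c' \<inter> U" for z
    proof -
      have zo: "z \<in> overlap c' c" using z U'(2) by (auto simp: U_def)
      have "snd (UG i) z = snd c (chart_inv c' z) $ i" for i
        using UG(4)[of z i] zo z by (auto simp: U_def)
      then show ?thesis
        using overlap_mem(3)[OF c' c(1) zo] by (simp add: F_def bump_def power2_norm_cart)
    qed
    ultimately show ?thesis by blast
  next
    case False
    then have "chart_inv c' y \<notin> bump_support c p s" by (simp add: bump_support_def)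
    then obtain U where U: "open U" "y \<in> U" "\<forall>z\<in>chart_image c' \<inter> U. chart_inv c' z \<notin> bump_support c p s"
      by (rule locally_zero_outside[OF K c' y])
    then show ?thesis
      by (intro exI[of _ U] exI[of _ "\<lambda>_. 0"]) (auto simp: bump_outside Ck_on_const)
  qed
qed

lemma bump_support_sublevel:
  assumes "s > 0"
  shows "bump_support c p s = {q \<in> fst c. norm (snd c q - snd c p) \<le> sqrt (2 / s)}"
proof -
  have "s * (norm v)\<^sup>2 \<le> 2 \<longleftrightarrow> norm v \<le> sqrt (2 / s)" for v :: "real^'n"
  proof -
    have "s * (norm v)\<^sup>2 \<le> 2 \<longleftrightarrow> (norm v)\<^sup>2 \<le> 2 / s" using assms by (simp add: field_simps)
    also have "\<dots> \<longleftrightarrow> norm v \<le> sqrt (2 / s)"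
      using assms real_le_rsqrt[of "norm v" "2 / s"] power_mono[of "norm v" "sqrt (2 / s)" 2] by auto
    finally show ?thesis .
  qed
  then show ?thesis by (simp add: bump_support_def)
qed

lemma bump_nbhd:
  assumes c: "c \<in> A" "p \<in> fst c" and V: "open V" "p \<in> V"
  obtains s0 where "s0 > 0"
    "\<forall>s\<ge>s0. closed (bump_support c p s) \<and> bump_support c p s \<subseteq> V \<and> bump c p s \<in> smooth_functions A"
proof -
  obtain r0 where r0: "r0 > 0"
    "\<forall>r\<le>r0. closed {q \<in> fst c. norm (snd c q - snd c p) \<le> r} \<and> {q \<in> fst c. norm (snd c q - snd c p) \<le> r} \<subseteq> V"
    by (rule chart_closed_nbhd[OF c V])
  have "closed (bump_support c p s) \<and> bump_support c p s \<subseteq> V \<and> bump c p s \<in> smooth_functions A" if s: "s \<ge> 2 / r0\<^sup>2" for s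
  proof -
    have pos: "2 / r0\<^sup>2 > 0" using r0(1) by simp
    then have s0: "s > 0" using s by linarith
    have "2 / s \<le> r0\<^sup>2" using s s0 r0(1) by (simp add: field_simps)
    then have "sqrt (2 / s) \<le> r0" using r0(1) by (simp add: real_le_lsqrt)
    then have "closed (bump_support c p s) \<and> bump_support c p s \<subseteq> V"
      using r0(2) unfolding bump_support_sublevel[OF s0] by blast
    then show ?thesis using bump_smooth[OF c] by blast
  qed
  then show ?thesis using r0(1) by (intro that[of "2 / r0\<^sup>2"]) auto
qed

lemma smooth_bump:
  assumes "open V" "p \<in> V"
  shows "\<exists>u W. u \<in> smooth_functions A \<and> (\<forall>q. 0 \<le> u q \<and> u q \<le> 1) \<and> open W \<and> p \<in> W \<and>
    (\<forall>q\<in>W. u q = 1) \<and> (\<forall>q. q \<notin> V \<longrightarrow> u q = 0)"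
proof -
  obtain c where c: "c \<in> A" "p \<in> fst c" by (rule chart_cover)
  obtain s where s: "s > 0"
    "\<forall>s'\<ge>s. closed (bump_support c p s') \<and> bump_support c p s' \<subseteq> V \<and> bump c p s' \<in> smooth_functions A"
    by (rule bump_nbhd[OF c assms])
  define W where "W = {q \<in> fst c. snd c q \<in> {y. s * (norm (y - snd c p))\<^sup>2 < 1}}"
  have "open {y. s * (norm (y - snd c p))\<^sup>2 < 1}" by (intro open_Collect_less continuous_intros)
  then have "open W" unfolding W_def by (rule chart_preimage_open[OF chart[OF c(1)]])
  moreover have "p \<in> W" using c by (simp add: W_def)
  moreover have "bump c p s q = 1" if "q \<in> W" for q using that by (simp add: W_def bump_def cutoff_eq_1)
  moreover have "bump c p s q = 0" if "q \<notin> V" for q using that s by (intro bump_outside) auto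
  ultimately show ?thesis
    using s(2) bump_range by (intro exI[of _ "bump c p s"] exI[of _ W]) auto
qed

lemma smooth_functions_prod:
  "finite I \<Longrightarrow> (\<And>i. i \<in> I \<Longrightarrow> u i \<in> smooth_functions A) \<Longrightarrow> (\<lambda>q. \<Prod>i\<in>I. u i q) \<in> smooth_functions A"
  by (induction I rule: finite_induct) (auto intro: smooth_functions_const smooth_functions_mult)

text \<open>With finitely many bumps equal to 1 on a cover of \<open>K\<close>, take one minus the
  product of their complements. This is 1 where some bump is 1, 0 where all vanish, and stays in the
  unit interval without any normalization.\<close>

lemma smooth_urysohn:
  assumes K: "compact K" "K \<subseteq> V" and V: "open V"
  obtains u where "u \<in> smooth_functions A" "\<forall>q. 0 \<le> u q \<and> u q \<le> 1" "\<forall>q\<in>K. u q = 1" "\<forall>q. q \<notin> V \<longrightarrow> u q = 0"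
proof -
  have "\<forall>p\<in>K. \<exists>uW. fst uW \<in> smooth_functions A \<and> (\<forall>q. 0 \<le> fst uW q \<and> fst uW q \<le> 1) \<and> open (snd uW) \<and> p \<in> snd uW \<and>
      (\<forall>q\<in>snd uW. fst uW q = 1) \<and> (\<forall>q. q \<notin> V \<longrightarrow> fst uW q = 0)"
  proof
    fix p assume "p \<in> K"
    then have "p \<in> V" using K(2) by blast
    from smooth_bump[OF V this] obtain u W where "u \<in> smooth_functions A" "\<forall>q. 0 \<le> u q \<and> u q \<le> 1"
      "open W" "p \<in> W" "\<forall>q\<in>W. u q = 1" "\<forall>q. q \<notin> V \<longrightarrow> u q = 0" by blast
    then show "\<exists>uW. fst uW \<in> smooth_functions A \<and> (\<forall>q. 0 \<le> fst uW q \<and> fst uW q \<le> 1) \<and> open (snd uW) \<and> p \<in> snd uW \<and>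
        (\<forall>q\<in>snd uW. fst uW q = 1) \<and> (\<forall>q. q \<notin> V \<longrightarrow> fst uW q = 0)"
      by (intro exI[of _ "(u, W)"]) simp
  qed
  from bchoice[OF this] obtain uW where uW: "\<And>p. p \<in> K \<Longrightarrow> fst (uW p) \<in> smooth_functions A"
    "\<And>p q. p \<in> K \<Longrightarrow> 0 \<le> fst (uW p) q \<and> fst (uW p) q \<le> 1" "\<And>p. p \<in> K \<Longrightarrow> open (snd (uW p))"
    "\<And>p. p \<in> K \<Longrightarrow> p \<in> snd (uW p)" "\<And>p q. \<lbrakk>p \<in> K; q \<in> snd (uW p)\<rbrakk> \<Longrightarrow> fst (uW p) q = 1"
    "\<And>p q. \<lbrakk>p \<in> K; q \<notin> V\<rbrakk> \<Longrightarrow> fst (uW p) q = 0" by blast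
  have cover: "K \<subseteq> (\<Union>p\<in>K. snd (uW p))" using uW(4) by blast
  obtain I where I: "I \<subseteq> K" "finite I" "K \<subseteq> (\<Union>p\<in>I. snd (uW p))"
    by (rule compactE_image[OF K(1) uW(3) cover])
  define u where "u q = 1 + (-1) * (\<Prod>p\<in>I. 1 + (-1) * fst (uW p) q)" for q
  have "u \<in> smooth_functions A" unfolding u_def
    using I by (intro smooth_functions_add smooth_functions_mult smooth_functions_const smooth_functions_prod uW(1)) auto
  moreover have "0 \<le> u q \<and> u q \<le> 1" for q
  proof -
    have "0 \<le> (\<Prod>p\<in>I. 1 + (-1) * fst (uW p) q)" "(\<Prod>p\<in>I. 1 + (-1) * fst (uW p) q) \<le> 1"
      using uW(2) I(1) by (auto intro!: prod_nonneg prod_le_1)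
    then show ?thesis by (simp add: u_def)
  qed
  moreover have "u q = 1" if q: "q \<in> K" for q
  proof -
    obtain p where "p \<in> I" "q \<in> snd (uW p)" using I(3) q by blast
    then have "(\<Prod>p\<in>I. 1 + (-1) * fst (uW p) q) = 0"
      using uW(5) I by (intro prod_zero bexI[of _ p]) auto
    then show ?thesis by (simp add: u_def)
  qed
  moreover have "u q = 0" if "q \<notin> V" for q
  proof -
    have "(\<Prod>p\<in>I. 1 + (-1) * fst (uW p) q) = 1"
      using uW(6) that I(1) by (intro prod.neutral) auto
    then show ?thesis by (simp add: u_def)
  qed
  ultimately show ?thesis by (intro that) auto
qed

section \<open>Points have capacity zero\<close>

lemma bump_differential:
  assumes c: "c \<in> A" "p \<in> fst c" and q: "q \<in> fst c"
  shows "chart_differential c (bump c p s) q =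
    (cutoff_deriv (s * (norm (snd c q - snd c p))\<^sup>2 - 1) * (2 * s)) *\<^sub>R (snd c q - snd c p)"
proof (rule chart_differential_eqI[OF c(1) q])
  let ?x = "snd c p" and ?y = "snd c q"
  let ?D = "\<lambda>h. ((cutoff_deriv (s * (norm (?y - ?x))\<^sup>2 - 1) * (2 * s)) *\<^sub>R (?y - ?x)) \<bullet> h"
  have "((\<lambda>z. z - ?x) has_derivative (\<lambda>h. h - 0)) (at ?y within chart_image c)"
    by (intro has_derivative_diff has_derivative_ident has_derivative_const)
  from has_derivative_mult_right[OF has_derivative_inner[OF this this], of s]
  have "((\<lambda>z. s * ((z - ?x) \<bullet> (z - ?x))) has_derivative (\<lambda>h. s * ((?y - ?x) \<bullet> (h - 0) + (h - 0) \<bullet> (?y - ?x)))) (at ?y within chart_image c)" .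
  from has_derivative_diff[OF this has_derivative_const[of 1]]
  have "((\<lambda>z. s * ((z - ?x) \<bullet> (z - ?x)) - 1) has_derivative (\<lambda>h. 2 * s * ((?y - ?x) \<bullet> h))) (at ?y within chart_image c)"
  proof (rule has_derivative_eq_rhs)
    show "(\<lambda>h. s * ((?y - ?x) \<bullet> (h - 0) + (h - 0) \<bullet> (?y - ?x)) - 0) = (\<lambda>h. 2 * s * ((?y - ?x) \<bullet> h))"
      by (rule ext) (simp add: inner_commute[of _ "?y - ?x"])
  qed
  moreover have "(cutoff has_derivative (\<lambda>h. cutoff_deriv (s * ((?y - ?x) \<bullet> (?y - ?x)) - 1) * h)) (at (s * ((?y - ?x) \<bullet> (?y - ?x)) - 1))"
    using cutoff_has_derivative by (simp add: has_field_derivative_def)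
  ultimately have "((\<lambda>z. cutoff (s * ((z - ?x) \<bullet> (z - ?x)) - 1)) has_derivative
      (\<lambda>h. cutoff_deriv (s * ((?y - ?x) \<bullet> (?y - ?x)) - 1) * (2 * s * ((?y - ?x) \<bullet> h)))) (at ?y within chart_image c)"
    by (rule has_derivative_compose)
  then have D: "((\<lambda>z. cutoff (s * ((z - ?x) \<bullet> (z - ?x)) - 1)) has_derivative ?D) (at ?y within chart_image c)"
    by (simp only: power2_norm_eq_inner mult.assoc inner_scaleR_left)
  have y: "?y \<in> chart_image c" using q by (rule imageI)
  have eq: "(bump c p s \<circ> chart_inv c) z = cutoff (s * ((z - ?x) \<bullet> (z - ?x)) - 1)" if z: "z \<in> chart_image c" for z
    using chart_chart_inv[OF chart[OF c(1)] z] chart_inv_mem[OF chart[OF c(1)] z]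
    by (simp only: bump_def power2_norm_eq_inner o_apply if_True)
  show "((bump c p s \<circ> chart_inv c) has_derivative ?D) (at ?y within chart_image c)"
    by (rule has_derivative_transform[OF y eq D])
qed

text \<open>A point outside the chart domain lies off the closed support, so the bump vanishes near
  it and not merely at it.\<close>

lemma bump_gradient_outside:
  assumes c: "c \<in> A" "p \<in> fst c" and K: "closed (bump_support c p s)" and q: "q \<notin> fst c"
    and w: "w \<in> smooth_functions A"
  shows "gradient_inner A g (bump c p s) w q = 0"
proof -
  obtain c' where c': "c' \<in> A" "q \<in> fst c'" by (rule chart_cover)
  have y: "snd c' q \<in> chart_image c'" "chart_inv c' (snd c' q) \<notin> bump_support c p s"
    using c' q chart_inv_chart[OF chart[OF c'(1)]] by (auto simp: bump_support_def)
  obtain U where U: "open U" "snd c' q \<in> U" "\<forall>z\<in>chart_image c' \<inter> U. chart_inv c' z \<notin> bump_support c p s"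
    by (rule locally_zero_outside[OF K c'(1) y])
  have "((\<lambda>_. 0) has_derivative (\<lambda>h. 0 \<bullet> h)) (at (snd c' q) within (chart_image c' \<inter> U))"
    by (simp add: zero_fun_def)
  then have "((bump c p s \<circ> chart_inv c') has_derivative (\<lambda>h. 0 \<bullet> h)) (at (snd c' q) within (chart_image c' \<inter> U))"
    by (rule has_derivative_transform[rotated 2]) (use U y bump_outside in auto)
  then have "((bump c p s \<circ> chart_inv c') has_derivative (\<lambda>h. 0 \<bullet> h)) (at (snd c' q) within chart_image c')"
    by (simp only: at_within_Int_nhd[OF U(1,2)])
  from chart_differential_eqI[OF c' this] show ?thesis
    by (intro gradient_inner_zero_differential[OF bump_smooth[OF c K] w c'])
qed

lemma metric_dual_bound:
  assumes c: "c \<in> A" "p \<in> fst c"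
  obtains r L where "r > 0" "L \<ge> 0"
    "\<forall>q\<in>chart_ball c p r. \<forall>d. d \<bullet> (matrix_inv (g c (snd c q)) *v d) \<le> L * (norm d)\<^sup>2"
proof -
  \<comment> \<open>The sum of the column norms of the inverse metric, a continuous upper bound for
    its operator norm.\<close>
  define f where "f z = (\<Sum>i\<in>UNIV. norm (matrix_inv (g c z) *v axis i 1))" for z
  have "continuous_on (chart_image c) f" unfolding f_def
    by (intro continuous_on_sum continuous_on_norm continuous_on_matrix_inv_vector continuous_on_metric
        metric_invertible continuous_on_const c(1))
  moreover have "snd c p \<in> chart_image c" using c by simp
  ultimately have "continuous (at (snd c p) within chart_image c) f"
    unfolding continuous_on_eq_continuous_within by (rule bspec)
  then obtain r where r: "r > 0" "\<And>y. \<lbrakk>y \<in> chart_image c; dist y (snd c p) < r\<rbrakk> \<Longrightarrow> dist (f y) (f (snd c p)) < 1"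
    unfolding continuous_within_eps_delta by (meson zero_less_one)
  define L where "L = f (snd c p) + 1"
  have L: "L \<ge> 0" by (simp add: L_def f_def sum_nonneg)
  have "d \<bullet> (matrix_inv (g c (snd c q)) *v d) \<le> L * (norm d)\<^sup>2" if q: "q \<in> chart_ball c p r" for q d
  proof -
    let ?M = "matrix_inv (g c (snd c q))"
    have "dist (f (snd c q)) (f (snd c p)) < 1" using q r(2) by (simp add: chart_ball_def)
    then have fL: "f (snd c q) \<le> L" by (simp add: L_def dist_real_def)
    have "?M *v d = ?M *v (\<Sum>i\<in>UNIV. d $ i *\<^sub>R axis i 1)"
      using basis_expansion[of d] by (simp add: scalar_mult_eq_scaleR)
    also have "\<dots> = (\<Sum>i\<in>UNIV. d $ i *\<^sub>R (?M *v axis i 1))"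
      by (simp add: linear_sum[OF matrix_vector_mul_linear] matrix_vector_mult_scaleR)
    finally have "norm (?M *v d) \<le> (\<Sum>i\<in>UNIV. \<bar>d $ i\<bar> * norm (?M *v axis i 1))"
      using norm_sum[of "\<lambda>i. d $ i *\<^sub>R (?M *v axis i 1)" UNIV] by simp
    also have "\<dots> \<le> (\<Sum>i\<in>UNIV. norm d * norm (?M *v axis i 1))"
      by (intro sum_mono mult_right_mono component_le_norm_cart) auto
    also have "\<dots> = norm d * f (snd c q)" by (simp add: f_def sum_distrib_left)
    also have "\<dots> \<le> norm d * L" using fL by (intro mult_left_mono) auto
    finally have "norm d * norm (?M *v d) \<le> norm d * (norm d * L)" by (intro mult_left_mono) auto
    then show ?thesis using norm_cauchy_schwarz[of d "?M *v d"] by (simp add: power2_eq_square mult_ac)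
  qed
  then show ?thesis by (intro that[OF r(1) L]) blast
qed

text \<open>The squared gradient is of order \<open>s\<close> on a ball of radius of order 1 / sqrt
  s, whose volume is of order s^(-d/2). Their product stays bounded as \<open>s\<close> grows
  because d \<ge> 2.\<close>

lemma bump_energy:
  assumes c: "c \<in> A" "p \<in> fst c" and dim: "CARD('n) \<ge> 2"
  obtains s0 E where "s0 > 0"
    "\<forall>s\<ge>s0. closed (bump_support c p s) \<and> bump c p s \<in> smooth_functions A \<and>
      dirichlet_form A g (bump c p s) (bump c p s) \<le> E"
proof -
  obtain s1 where s1: "s1 > 0"
    "\<forall>s\<ge>s1. closed (bump_support c p s) \<and> bump_support c p s \<subseteq> UNIV \<and> bump c p s \<in> smooth_functions A"
    by (rule bump_nbhd[OF c open_UNIV UNIV_I])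
  obtain r1 L where r1: "r1 > 0" and L: "L \<ge> 0"
    "\<forall>q\<in>chart_ball c p r1. \<forall>d. d \<bullet> (matrix_inv (g c (snd c q)) *v d) \<le> L * (norm d)\<^sup>2"
    by (rule metric_dual_bound[OF c])
  obtain r2 m where r2: "r2 > 0" and m: "m \<ge> 0"
    "\<forall>r\<le>r2. emeasure vol (chart_ball c p r) \<le> ennreal m * emeasure lborel (ball (snd c p) r)"
    by (rule chart_ball_volume[OF c])
  obtain C where C: "C > 0" "\<And>t. \<bar>cutoff_deriv t\<bar> \<le> C" using cutoff_deriv_bounded by blast
  \<comment> \<open>The cap at 1 lets the volume power \<open>r ^ CARD('n)\<close> be replaced by
    \<open>r\<^sup>2\<close>; the other two keep the ball where the metric and volume bounds
    hold.\<close>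
  define \<rho> where "\<rho> = min (min r1 r2) 1"
  have \<rho>: "\<rho> > 0" "\<rho> \<le> r1" "\<rho> \<le> r2" "\<rho> \<le> 1" using r1 r2 by (auto simp: \<rho>_def)
  define \<omega> where "\<omega> = unit_ball_vol (real CARD('n))"
  have \<omega>: "\<omega> \<ge> 0" by (simp add: \<omega>_def)
  define E where "E = 8 * L * C\<^sup>2 * (m * (\<omega> * 4))"
  have main: "dirichlet_form A g (bump c p s) (bump c p s) \<le> E" if s: "s \<ge> s1" "s \<ge> 4 / \<rho>\<^sup>2" for s
  proof -
    have "s > 0" using s(1) s1(1) by linarith
    have K: "closed (bump_support c p s)" and sm: "bump c p s \<in> smooth_functions A" using s1(2) s(1) by auto
    \<comment> \<open>Slightly larger than the support radius sqrt (2 / s), so the open chart ball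
      contains the support. Its square 4 / s is the factor 4 in \<open>E\<close>, and the factor 8
      comes from \<open>(2 * s)\<^sup>2\<close> times a squared distance of at most 2 / s.\<close>
    define r where "r = 2 / sqrt s"
    have r: "r > 0" "r\<^sup>2 = 4 / s" using \<open>s > 0\<close> by (auto simp: r_def power_divide)
    have "4 / s \<le> \<rho>\<^sup>2" using s(2) \<open>s > 0\<close> \<rho>(1) by (simp add: field_simps)
    then have "r\<^sup>2 \<le> \<rho>\<^sup>2" by (simp add: r)
    then have r\<rho>: "r \<le> \<rho>" using \<rho>(1) by (rule power2_le_imp_le[OF _ less_imp_le])
    have pt: "gradient_inner A g (bump c p s) (bump c p s) q \<le> 8 * L * C\<^sup>2 * s * indicator (chart_ball c p r) q" for q
    proof (cases "q \<in> fst c \<and> s * (norm (snd c q - snd c p))\<^sup>2 - 1 \<in> {0..1}")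
      case True
      let ?v = "snd c q - snd c p"
      let ?d = "(cutoff_deriv (s * (norm ?v)\<^sup>2 - 1) * (2 * s)) *\<^sub>R ?v"
      have qc: "q \<in> fst c" and sv: "s * (norm ?v)\<^sup>2 \<le> 2" using True by auto
      then have "(norm ?v)\<^sup>2 \<le> 2 / s" using \<open>s > 0\<close> by (simp add: field_simps)
      also have "\<dots> < r\<^sup>2" using r \<open>s > 0\<close> by (simp add: divide_strict_right_mono)
      finally have "norm ?v < r" using r(1) by (simp add: power_less_imp_less_base)
      then have qb: "q \<in> chart_ball c p r" "q \<in> chart_ball c p r1"
        using qc r\<rho> \<rho> by (auto simp: chart_ball_def dist_norm)
      have "gradient_inner A g (bump c p s) (bump c p s) q =
          chart_differential c (bump c p s) q \<bullet> chart_gradient g c (bump c p s) q"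
        by (simp only: gradient_inner_eq[OF sm sm c(1) qc] ginner_def metric_chart_gradient[OF c(1) qc] inner_commute)
      also have "\<dots> = ?d \<bullet> (matrix_inv (g c (snd c q)) *v ?d)"
        by (simp only: chart_gradient_def bump_differential[OF c qc])
      finally have le: "gradient_inner A g (bump c p s) (bump c p s) q \<le> L * (norm ?d)\<^sup>2"
        using L(2) qb(2) by (metis (no_types, lifting))
      have "(norm ?d)\<^sup>2 = (cutoff_deriv (s * (norm ?v)\<^sup>2 - 1))\<^sup>2 * (4 * s * (s * (norm ?v)\<^sup>2))"
        by (simp add: power_mult_distrib power2_eq_square)
      also have "\<dots> \<le> C\<^sup>2 * (4 * s * 2)"
      proof (intro mult_mono)
        show "(cutoff_deriv (s * (norm ?v)\<^sup>2 - 1))\<^sup>2 \<le> C\<^sup>2"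
          using power_mono[OF C(2)[of "s * (norm ?v)\<^sup>2 - 1"] abs_ge_zero, of 2] by (simp only: power2_abs)
      qed (use sv \<open>s > 0\<close> in auto)
      finally have "L * (norm ?d)\<^sup>2 \<le> L * (C\<^sup>2 * (4 * s * 2))" using L(1) by (rule mult_left_mono)
      with le have "gradient_inner A g (bump c p s) (bump c p s) q \<le> L * (C\<^sup>2 * (4 * s * 2))" by (rule order_trans)
      then show ?thesis using qb(1) by (simp add: mult_ac)
    next
      case False
      have "gradient_inner A g (bump c p s) (bump c p s) q = 0"
      proof (cases "q \<in> fst c")
        case qc: True
        have "chart_differential c (bump c p s) q = 0"
          using bump_differential[OF c qc] cutoff_deriv_support False qc by simp
        then show ?thesis by (rule gradient_inner_zero_differential[OF sm sm c(1) qc])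
      qed (rule bump_gradient_outside[OF c K _ sm])
      then show ?thesis using L(1) \<open>s > 0\<close> by simp
    qed
    interpret finite_measure vol by (rule finite_measure_vol)
    have ball: "chart_ball c p r \<in> sets vol" using open_chart_ball[OF c(1)] by simp
    have "dirichlet_form A g (bump c p s) (bump c p s) \<le> (\<integral>q. 8 * L * C\<^sup>2 * s * indicator (chart_ball c p r) q \<partial>vol)"
      unfolding dirichlet_form_def using ball pt
      by (intro integral_mono integrable_gradient_inner sm) (auto simp: emeasure_eq_measure)
    also have "\<dots> = 8 * L * C\<^sup>2 * s * measure vol (chart_ball c p r)" by simp
    also have "\<dots> \<le> 8 * L * C\<^sup>2 * s * (m * (\<omega> * r\<^sup>2))"
    proof (intro mult_left_mono)
      have "ennreal (measure vol (chart_ball c p r)) \<le> ennreal m * emeasure lborel (ball (snd c p) r)"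
        using m(2) r\<rho> \<rho> by (simp add: emeasure_eq_measure[symmetric])
      also have "emeasure lborel (ball (snd c p) r) = ennreal (\<omega> * r ^ CARD('n))"
        using r(1) by (simp add: emeasure_ball \<omega>_def)
      also have "ennreal m * \<dots> = ennreal (m * (\<omega> * r ^ CARD('n)))"
        using m(1) \<omega> r(1) by (simp add: ennreal_mult)
      finally have "measure vol (chart_ball c p r) \<le> m * (\<omega> * r ^ CARD('n))"
        using m(1) \<omega> r(1) by (simp add: ennreal_le_iff)
      also have "r ^ CARD('n) \<le> r\<^sup>2" using r r\<rho> \<rho> dim by (intro power_decreasing) auto
      finally show "measure vol (chart_ball c p r) \<le> m * (\<omega> * r\<^sup>2)" using m(1) \<omega> by (simp add: mult_left_mono)
    qed (use L(1) \<open>s > 0\<close> in auto)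
    also have "\<dots> = E" using r(2) \<open>s > 0\<close> by (simp add: E_def)
    finally show ?thesis .
  qed
  show ?thesis
  proof (rule that[of "max s1 (4 / \<rho>\<^sup>2)" E])
    show "0 < max s1 (4 / \<rho>\<^sup>2)" using s1(1) by simp
    show "\<forall>s\<ge>max s1 (4 / \<rho>\<^sup>2). closed (bump_support c p s) \<and> bump c p s \<in> smooth_functions A \<and>
        dirichlet_form A g (bump c p s) (bump c p s) \<le> E"
      using s1(2) main by (meson max.boundedE)
  qed
qed

text \<open>Averaging \<open>N + 1\<close> bumps at dyadic scales, whose gradients have disjoint supports and bounded
  energies, gives energy of order \<open>1 / N\<close>; this is where \<open>d \<ge> 2\<close> enters.\<close>

lemma point_capacity_zero:
  assumes dim: "CARD('n) \<ge> 2"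
  obtains u where "\<forall>N::nat. u N \<in> smooth_functions A \<and> (\<forall>q. 0 \<le> u N q \<and> u N q \<le> 1) \<and> u N p = 1"
    "\<forall>q. q \<noteq> p \<longrightarrow> (\<lambda>N. u N q) \<longlonglongrightarrow> 0" "(\<lambda>N. dirichlet_form A g (u N) (u N)) \<longlonglongrightarrow> 0"
proof -
  obtain c where c: "c \<in> A" "p \<in> fst c" by (rule chart_cover)
  obtain s0 E where s0: "s0 > 0" "\<forall>s\<ge>s0. closed (bump_support c p s) \<and> bump c p s \<in> smooth_functions A \<and>
      dirichlet_form A g (bump c p s) (bump c p s) \<le> E"
    by (rule bump_energy[OF c dim])
  obtain k0 :: nat where k0: "s0 < 4 ^ k0" using real_arch_pow[of 4 s0] by auto
  define b where "b k = bump c p (4 ^ (k0 + k))" for k :: nat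
  have large: "s0 \<le> 4 ^ (k0 + k)" for k
  proof -
    have "(4::real) ^ k0 \<le> 4 ^ (k0 + k)" by (intro power_increasing) auto
    then show ?thesis using k0 by linarith
  qed
  have K: "closed (bump_support c p (4 ^ (k0 + k)))" for k using s0(2) large by blast
  have bs [simp]: "b k \<in> smooth_functions A" for k using s0(2) large unfolding b_def by blast
  have bE: "dirichlet_form A g (b k) (b k) \<le> E" for k using s0(2) large unfolding b_def by blast
  \<comment> \<open>Where the gradient of the coarser bump is nonzero, its scaled squared distance
    is at least 1. At any finer scale it is then at least 4, past the value 2 where the finer cutoff
    has ended.\<close>
  have orth: "dirichlet_form A g (b j) (b k) = 0" if "j < k" for j k
  proof -
    have "gradient_inner A g (b j) (b k) q = 0" for q
    proof (cases "q \<in> fst c")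
      case False
      then show ?thesis unfolding b_def by (intro bump_gradient_outside c K bs[unfolded b_def])
    next
      case q: True
      let ?t = "(norm (snd c q - snd c p))\<^sup>2"
      have "chart_differential c (b j) q = 0 \<or> chart_differential c (b k) q = 0"
      proof (cases "4 ^ (k0 + j) * ?t - 1 \<in> {0..1}")
        case True
        then have ge: "1 \<le> 4 ^ (k0 + j) * ?t" by simp
        have "(4::real) ^ (k0 + j) * 4 \<le> 4 ^ (k0 + k)"
          using power_increasing[of "Suc (k0 + j)" "k0 + k" "4::real"] \<open>j < k\<close> by simp
        then have "(4 ^ (k0 + j) * 4) * ?t \<le> 4 ^ (k0 + k) * ?t" by (rule mult_right_mono) simp
        then have "4 ^ (k0 + k) * ?t - 1 \<notin> {0..1}" using ge by simp
        then show ?thesis using bump_differential[OF c q] cutoff_deriv_support by (simp add: b_def)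
      next
        case False
        then show ?thesis using bump_differential[OF c q] cutoff_deriv_support by (simp add: b_def)
      qed
      then show ?thesis
        using gradient_inner_zero_differential[OF bs bs c(1) q] gradient_inner_sym[OF bs bs] by metis
    qed
    then show ?thesis by (simp add: dirichlet_form_def)
  qed
  \<comment> \<open>The average starts at scale \<open>N\<close>, so the supports shrink to
    \<open>p\<close> and the functions tend to 0 at every other point.\<close>
  define u where "u N = (\<Sum>k<Suc N. (1 / real (Suc N)) *\<^sub>R b (N + k))" for N
  have u_smooth: "u N \<in> smooth_functions A" for N unfolding u_def by simp
  have u_apply: "u N q = (\<Sum>k<Suc N. b (N + k) q) / real (Suc N)" for N q
    unfolding u_def sum_fun_apply by (simp add: sum_divide_distrib del: sum.lessThan_Suc)
  have u_range: "0 \<le> u N q \<and> u N q \<le> 1" for N q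
  proof -
    have "0 \<le> (\<Sum>k<Suc N. b (N + k) q)" "(\<Sum>k<Suc N. b (N + k) q) \<le> (\<Sum>k<Suc N. 1)"
      by (intro sum_nonneg sum_mono; simp add: b_def bump_range)+
    then show ?thesis unfolding u_apply by (simp add: divide_le_eq)
  qed
  have u_p: "u N p = 1" for N
    unfolding u_apply using c by (simp add: b_def bump_center)
  have u_lim: "(\<lambda>N. u N q) \<longlonglongrightarrow> 0" if q: "q \<noteq> p" for q
  proof (cases "q \<in> fst c")
    case False
    then have "u N q = 0" for N unfolding u_apply by (simp add: b_def bump_def)
    then show ?thesis by simp
  next
    case True
    then have "snd c q \<noteq> snd c p" using q c chart_inv_chart[OF chart[OF c(1)]] by metis
    then have t: "(norm (snd c q - snd c p))\<^sup>2 > 0" (is "?t > 0") by simp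
    obtain n :: nat where n: "2 / ?t < 4 ^ n" using real_arch_pow[of 4 "2 / ?t"] by auto
    have "u N q = 0" if "N \<ge> n" for N
    proof -
      have "b (N + k) q = 0" for k
      proof -
        have "(4::real) ^ n \<le> 4 ^ (k0 + (N + k))" using that by (intro power_increasing) auto
        then have "2 / ?t < 4 ^ (k0 + (N + k))" using n by linarith
        then have "2 < 4 ^ (k0 + (N + k)) * ?t" using t by (simp add: pos_divide_less_eq)
        then show ?thesis unfolding b_def by (intro bump_outside) (simp add: bump_support_def)
      qed
      then show ?thesis unfolding u_apply by simp
    qed
    then show ?thesis by (intro tendsto_eventually) (auto simp: eventually_sequentially)
  qed
  have le: "dirichlet_form A g (u N) (u N) \<le> E * inverse (real (Suc N))" for N
  proof -
    let ?n = "real (Suc N)"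
    have "dirichlet_form A g (u N) (u N) = (\<Sum>i<Suc N. \<Sum>j<Suc N. (1 / ?n) * (1 / ?n) * dirichlet_form A g (b (N + i)) (b (N + j)))"
      unfolding u_def by (rule D.lincomb) simp
    also have "\<dots> = (\<Sum>i<Suc N. \<Sum>j<Suc N. if i = j then (1 / ?n) * (1 / ?n) * dirichlet_form A g (b (N + i)) (b (N + i)) else 0)"
    proof (intro sum.cong refl)
      fix i j
      show "(1 / ?n) * (1 / ?n) * dirichlet_form A g (b (N + i)) (b (N + j)) =
          (if i = j then (1 / ?n) * (1 / ?n) * dirichlet_form A g (b (N + i)) (b (N + i)) else 0)"
        using orth[of "N + i" "N + j"] orth[of "N + j" "N + i"] D.sym[OF bs[of "N + i"] bs[of "N + j"]]
        by (cases i j rule: linorder_cases) simp_all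
    qed
    also have "\<dots> = (\<Sum>i<Suc N. (1 / ?n) * (1 / ?n) * dirichlet_form A g (b (N + i)) (b (N + i)))"
      by (intro sum.cong refl) (simp del: sum.lessThan_Suc)
    also have "\<dots> \<le> (\<Sum>i<Suc N. (1 / ?n) * (1 / ?n) * E)"
      by (intro sum_mono mult_left_mono bE) auto
    also have "\<dots> = E * inverse ?n" by (simp add: field_simps del: of_nat_Suc)
    finally show ?thesis .
  qed
  have lim: "(\<lambda>N. E * inverse (real (Suc N))) \<longlonglongrightarrow> 0"
    by (rule tendsto_mult_right_zero[OF LIMSEQ_inverse_real_of_nat])
  have "(\<lambda>N. dirichlet_form A g (u N) (u N)) \<longlonglongrightarrow> 0"
  proof (rule Lim_null_comparison[OF always_eventually lim], rule allI)
    fix N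
    show "norm (dirichlet_form A g (u N) (u N)) \<le> E * inverse (real (Suc N))"
      using D.nonneg[OF u_smooth[of N]] le[of N] by (simp only: real_norm_def abs_of_nonneg)
  qed
  with u_smooth u_range u_p u_lim show ?thesis by (intro that[of u] allI impI conjI) simp_all
qed

end

section \<open>Comparing representatives of limit forms\<close>

lemma psd_form_subspace:
  assumes "psd_form V f" "subspace W" "W \<subseteq> V"
  shows "psd_form W f"
proof -
  interpret psd_form V f by fact
  show ?thesis
    using assms(2,3) by unfold_locales (auto simp: subset_iff expand nonneg intro: sym)
qed

context psd_form
begin

lemma nrm_tendsto_zero_lim_form:
  assumes "s \<in> cauchy_seqs" "t \<in> cauchy_seqs" "(\<lambda>n. nrm (s n)) \<longlonglongrightarrow> 0"
  shows "lim_form s t = 0"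
proof (rule lim_form_eqI[OF assms(1,2)])
  have "(\<lambda>n. nrm (s n) * nrm (t n)) \<longlonglongrightarrow> 0 * lim (\<lambda>n. nrm (t n))"
    using convergent_nrm[OF assms(2)] by (intro tendsto_mult assms(3)) (simp add: convergent_LIMSEQ_iff)
  then have lim: "(\<lambda>n. nrm (s n) * nrm (t n)) \<longlonglongrightarrow> 0" by simp
  show "(\<lambda>n. f (s n) (t n)) \<longlonglongrightarrow> 0"
  proof (rule Lim_null_comparison[OF always_eventually lim], rule allI)
    fix n
    show "norm (f (s n) (t n)) \<le> nrm (s n) * nrm (t n)"
      using abs_le_nrm[OF cauchy_seqs_mem[OF assms(1)] cauchy_seqs_mem[OF assms(2)], of n n] by simp
  qed
qed

text \<open>Limit forms depend only on classes modulo null sequences. This evaluates the Dirichlet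
  form on Sobolev classes, and it lets a sequence be replaced by the constant sequence of its L2
  limit.\<close>

lemma lim_form_cong:
  assumes s: "s \<in> cauchy_seqs" "s' \<in> cauchy_seqs" "(\<lambda>n. nrm (s' n - s n)) \<longlonglongrightarrow> 0"
    and t: "t \<in> cauchy_seqs" "t' \<in> cauchy_seqs" "(\<lambda>n. nrm (t' n - t n)) \<longlonglongrightarrow> 0"
  shows "lim_form s' t' = lim_form s t"
proof -
  interpret lim: psd_form cauchy_seqs lim_form
    by (intro psd_form_lim_form subspace_cauchy_seqs order_refl)
  have "lim_form (s' - s) t' = 0" "lim_form (t' - t) s = 0"
    using s t by (intro nrm_tendsto_zero_lim_form; simp)+
  then have "lim_form s' t' = lim_form s t'" "lim_form t' s = lim_form t s"
    using s t by (simp_all add: lim.diff_left)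
  then show ?thesis using lim.sym[OF t(2) s(1)] lim.sym[OF t(1) s(1)] by simp
qed

text \<open>The right side involves only values of the form, so families in different spaces with
  equal values have residuals of equal length. This turns expansions in \<open>b\<close> into
  expansions in L2.\<close>

lemma residual_expand:
  assumes "x \<in> V" "\<And>i. i \<in> I \<Longrightarrow> y i \<in> V"
  shows "f (x - (\<Sum>i\<in>I. c i *\<^sub>R y i)) (x - (\<Sum>i\<in>I. c i *\<^sub>R y i)) =
    f x x - 2 * (\<Sum>i\<in>I. c i * f x (y i)) + (\<Sum>i\<in>I. \<Sum>j\<in>I. c i * c j * f (y i) (y j))"
proof -
  let ?S = "\<Sum>i\<in>I. c i *\<^sub>R y i"
  have S: "?S \<in> V" using assms(2) by simp
  have "f x ?S = (\<Sum>i\<in>I. c i * f x (y i))"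
    using assms by (simp add: sum_right scale_right)
  then show ?thesis
    using square_add_scale[OF assms(1) S, of "-1"] lincomb[of I y c c, OF assms(2)] by simp
qed

end

lemma cauchy_seqs_mono: "V \<subseteq> W \<Longrightarrow> psd_form V f \<Longrightarrow> psd_form W f \<Longrightarrow> psd_form.cauchy_seqs V f \<subseteq> psd_form.cauchy_seqs W f"
  by (auto simp: psd_form.cauchy_seqs_def)

section \<open>The Sobolev space of an admissible measure\<close>

locale admissible_measure = closed_manifold A g
  for A :: "('a::{t2_space, second_countable_topology}, 'n::finite) chart set" and g :: "('a, 'n) metric" +
  fixes \<mu> :: "'a measure"
  assumes dim: "CARD('n) \<ge> 2"
    and admissible: "admissible A g \<mu>"
begin

lemma radon: "radon_measure \<mu>" and not_point: "\<not> supported_on_point \<mu>"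
  and poincare: "supports_poincare A g \<mu>" and compact_tau: "tau_compact A g \<mu>"
  using admissible by (auto simp: admissible_def)

lemma sets_mu [simp]: "sets \<mu> = sets borel" "space \<mu> = UNIV"
  using radon sets_eq_imp_space_eq[of \<mu> borel] by (auto simp: radon_measure_def)

lemma finite_measure_mu: "finite_measure \<mu>"
proof
  have "\<forall>K. compact K \<longrightarrow> emeasure \<mu> K < \<infinity>" using radon unfolding radon_measure_def by blast
  then have "emeasure \<mu> UNIV < \<infinity>" using compact_UNIV by blast
  then show "emeasure \<mu> (space \<mu>) \<noteq> \<infinity>" by simp
qed

sublocale finite_measure \<mu> by (rule finite_measure_mu)

lemma total_mass_pos: "measure \<mu> UNIV > 0"
proof -
  have "emeasure \<mu> UNIV \<noteq> 0"
  proof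
    assume "emeasure \<mu> UNIV = 0"
    then have "emeasure \<mu> (UNIV - {undefined}) \<le> 0" by (metis emeasure_space sets_mu(2))
    then show False using not_point by (auto simp: supported_on_point_def)
  qed
  then show ?thesis using measure_nonneg[of \<mu> UNIV] by (auto simp: emeasure_eq_measure less_le)
qed

lemma smooth_measurable: "u \<in> smooth_functions A \<Longrightarrow> u \<in> borel_measurable \<mu>"
  using borel_measurable_continuous_onI[OF smooth_functions_continuous]
  by (simp add: measurable_cong_sets[OF sets_mu(1) refl])

lemma smooth_in_L2: "smooth_functions A \<subseteq> L2 \<mu>"
proof
  fix u assume u: "u \<in> smooth_functions A"
  have "bounded (range u)"
    using compact_continuous_image[OF smooth_functions_continuous[OF u] compact_UNIV] by (rule compact_imp_bounded)
  then obtain C where "\<And>x. \<bar>u x\<bar> \<le> C" by (auto simp: bounded_iff)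
  then show "u \<in> L2 \<mu>" by (rule bounded_in_L2[OF smooth_measurable[OF u]])
qed

sublocale H: psd_form "L2 \<mu>" "L2_inner \<mu>" by (rule psd_form_L2)

lemma psd_form_smooth: "psd_form (smooth_functions A) (L2_inner \<mu>)"
  by (rule psd_form_subspace[OF psd_form_L2 subspace_smooth_functions smooth_in_L2])

sublocale P: psd_pair "smooth_functions A" "dirichlet_form A g" "L2_inner \<mu>"
  by (intro psd_pair.intro D.psd_form_axioms psd_form_smooth)

abbreviation V where "V \<equiv> P.Q.cauchy_seqs"
abbreviation a where "a \<equiv> D.lim_form"
abbreviation b where "b \<equiv> P.B.lim_form"

lemma sobolev_norm_smooth_eq: "sobolev_norm_smooth A g \<mu> u = P.Q.nrm u"
  by (simp add: sobolev_norm_smooth_def P.Q.nrm_def P.q_def L2_inner_self add.commute)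

lemma sobolev_cauchy_eq: "sobolev_cauchy A g \<mu> = V"
  by (simp add: sobolev_cauchy_def P.Q.cauchy_seqs_def sobolev_norm_smooth_eq fun_diff_def)

definition cls :: "(nat \<Rightarrow> 'a \<Rightarrow> real) \<Rightarrow> 'a sobolev" where
  "cls s = {t \<in> V. (\<lambda>n. P.Q.nrm (s n - t n)) \<longlonglongrightarrow> 0}"

lemma sobolev_space_eq: "sobolev_space A g \<mu> = cls ` V"
proof -
  have "sobolev_null_rel A g \<mu> `` {s} = cls s" if "s \<in> V" for s
    using that by (auto simp: sobolev_null_rel_def cls_def sobolev_cauchy_eq sobolev_norm_smooth_eq fun_diff_def)
  then show ?thesis unfolding sobolev_space_def quotient_def sobolev_cauchy_eq by auto
qed

lemma V_mem: "s \<in> V \<Longrightarrow> s n \<in> smooth_functions A"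
  by (rule P.Q.cauchy_seqs_mem)

lemma V_A: "s \<in> V \<Longrightarrow> s \<in> D.cauchy_seqs" and V_B: "s \<in> V \<Longrightarrow> s \<in> P.B.cauchy_seqs"
  using P.cauchy_seqs_Q by auto

lemma V_H: "s \<in> V \<Longrightarrow> s \<in> H.cauchy_seqs"
  using V_B cauchy_seqs_mono[OF smooth_in_L2 psd_form_smooth psd_form_L2] by blast

lemma cls_self: "s \<in> V \<Longrightarrow> s \<in> cls s"
  by (simp add: cls_def P.Q.nrm_def)

lemma clsD:
  assumes "s \<in> V" "t \<in> cls s"
  shows "t \<in> V" "(\<lambda>n. P.Q.nrm (t n - s n)) \<longlonglongrightarrow> 0" "(\<lambda>n. D.nrm (t n - s n)) \<longlonglongrightarrow> 0" "(\<lambda>n. P.B.nrm (t n - s n)) \<longlonglongrightarrow> 0"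
proof -
  show t: "t \<in> V" using assms by (simp add: cls_def)
  note [simp] = V_mem[OF t] V_mem[OF assms(1)]
  have "(\<lambda>n. P.Q.nrm (s n - t n)) \<longlonglongrightarrow> 0" using assms by (simp add: cls_def)
  moreover have "P.Q.nrm (s n - t n) = P.Q.nrm (t n - s n)" for n by (rule P.Q.nrm_minus_commute) simp_all
  ultimately show lim: "(\<lambda>n. P.Q.nrm (t n - s n)) \<longlonglongrightarrow> 0" by simp
  show "(\<lambda>n. D.nrm (t n - s n)) \<longlonglongrightarrow> 0" "(\<lambda>n. P.B.nrm (t n - s n)) \<longlonglongrightarrow> 0"
    by (rule Lim_null_comparison[OF always_eventually lim]; simp add: P.nrm_le_Q)+
qed

text \<open>The definite description is met: equivalent representatives have the same limit, and the
  class contains \<open>s\<close>.\<close>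

lemma sobolev_norm_cls:
  assumes "s \<in> V"
  shows "sobolev_norm A g \<mu> (cls s) = psd_form.nrm P.Q.lim_form s"
  unfolding sobolev_norm_def sobolev_norm_smooth_eq
proof (rule the_equality)
  let ?l = "psd_form.nrm P.Q.lim_form s"
  have lim: "(\<lambda>n. P.Q.nrm (s n)) \<longlonglongrightarrow> ?l" by (rule P.Q.tendsto_lim_nrm[OF assms])
  show "\<forall>t\<in>cls s. (\<lambda>n. P.Q.nrm (t n)) \<longlonglongrightarrow> ?l"
  proof
    fix t assume t: "t \<in> cls s"
    show "(\<lambda>n. P.Q.nrm (t n)) \<longlonglongrightarrow> ?l"
      using t by (intro P.Q.nrm_tendsto_unique[OF _ _ _ lim]) (auto simp: cls_def V_mem assms)
  qed
  show "l = ?l" if "\<forall>t\<in>cls s. (\<lambda>n. P.Q.nrm (t n)) \<longlonglongrightarrow> l" for l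
    using LIMSEQ_unique[OF bspec[OF that cls_self[OF assms]] lim] .
qed

lemma sobolev_dirichlet_cls:
  assumes s: "s \<in> V" and t: "t \<in> V"
  shows "sobolev_dirichlet A g (cls s) (cls t) = a s t"
  unfolding sobolev_dirichlet_def
proof (rule the_equality)
  show "\<forall>s'\<in>cls s. \<forall>t'\<in>cls t. (\<lambda>n. dirichlet_form A g (s' n) (t' n)) \<longlonglongrightarrow> a s t"
  proof (intro ballI)
    fix s' t' assume s': "s' \<in> cls s" and t': "t' \<in> cls t"
    have "a s' t' = a s t"
      using clsD[OF s s'] clsD[OF t t'] s t by (intro D.lim_form_cong V_A) auto
    then show "(\<lambda>n. dirichlet_form A g (s' n) (t' n)) \<longlonglongrightarrow> a s t"
      using D.tendsto_lim_form[OF V_A[OF clsD(1)[OF s s']] V_A[OF clsD(1)[OF t t']]] by simp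
  qed
  show "l = a s t" if "\<forall>s'\<in>cls s. \<forall>t'\<in>cls t. (\<lambda>n. dirichlet_form A g (s' n) (t' n)) \<longlonglongrightarrow> l" for l
    using that cls_self[OF s] cls_self[OF t] D.tendsto_lim_form[OF V_A[OF s] V_A[OF t]] LIMSEQ_unique by blast
qed

lemma L2_tendsto_iff:
  assumes "\<And>n. s n \<in> L2 \<mu>" "f \<in> L2 \<mu>"
  shows "L2_tendsto \<mu> s f \<longleftrightarrow> (\<lambda>n. H.nrm (s n - f)) \<longlonglongrightarrow> 0"
proof -
  have eq: "(\<integral>x. (s n x - f x)\<^sup>2 \<partial>\<mu>) = (H.nrm (s n - f))\<^sup>2" for n
    using assms by (simp add: H.nrm_square L2_inner_self)
  have "(\<lambda>n. (H.nrm (s n - f))\<^sup>2) \<longlonglongrightarrow> 0 \<longleftrightarrow> (\<lambda>n. H.nrm (s n - f)) \<longlonglongrightarrow> 0"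
  proof
    assume "(\<lambda>n. (H.nrm (s n - f))\<^sup>2) \<longlonglongrightarrow> 0"
    then have "(\<lambda>n. sqrt ((H.nrm (s n - f))\<^sup>2)) \<longlonglongrightarrow> sqrt 0" by (rule tendsto_real_sqrt)
    then show "(\<lambda>n. H.nrm (s n - f)) \<longlonglongrightarrow> 0" using assms by simp
  next
    assume "(\<lambda>n. H.nrm (s n - f)) \<longlonglongrightarrow> 0"
    from tendsto_power[OF this, of 2] show "(\<lambda>n. (H.nrm (s n - f))\<^sup>2) \<longlonglongrightarrow> 0" by simp
  qed
  then show ?thesis by (simp add: L2_tendsto_def eq)
qed

text \<open>Completeness of L2 supplies a witness for the choice in \<open>tau\<close>; the same
  limit serves every representative, as equivalence is stronger than being close in L2.\<close>

lemma tau_cls: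
  assumes s: "s \<in> V"
  shows "tau \<mu> (cls s) \<in> L2 \<mu>" "(\<lambda>n. H.nrm (s n - tau \<mu> (cls s))) \<longlonglongrightarrow> 0"
proof -
  have sL [simp]: "s n \<in> L2 \<mu>" for n using V_mem[OF s] smooth_in_L2 by blast
  obtain f where f: "f \<in> L2 \<mu>" "L2_tendsto \<mu> s f"
    using L2_complete[OF V_H[OF s] finite_measure_mu] by blast
  have lim: "(\<lambda>n. H.nrm (s n - f)) \<longlonglongrightarrow> 0" using f L2_tendsto_iff[of s f] by simp
  have "\<forall>t\<in>cls s. L2_tendsto \<mu> t f"
  proof
    fix t assume t: "t \<in> cls s"
    have tL [simp]: "t n \<in> L2 \<mu>" for n using V_mem[OF clsD(1)[OF s t]] smooth_in_L2 by blast
    have sum0: "(\<lambda>n. H.nrm (t n - s n) + H.nrm (s n - f)) \<longlonglongrightarrow> 0"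
      using tendsto_add[OF clsD(4)[OF s t] lim] by simp
    have "(\<lambda>n. H.nrm (t n - f)) \<longlonglongrightarrow> 0"
    proof (rule Lim_null_comparison[OF always_eventually sum0], rule allI)
      fix n
      show "norm (H.nrm (t n - f)) \<le> H.nrm (t n - s n) + H.nrm (s n - f)"
        using H.nrm_triangle_diff[of "t n" "s n" f] f(1) by simp
    qed
    then show "L2_tendsto \<mu> t f" using L2_tendsto_iff[of t f] f(1) by simp
  qed
  with f(1) have "f \<in> L2 \<mu> \<and> (\<forall>t\<in>cls s. L2_tendsto \<mu> t f)" by blast
  then have spec: "tau \<mu> (cls s) \<in> L2 \<mu> \<and> (\<forall>t\<in>cls s. L2_tendsto \<mu> t (tau \<mu> (cls s)))"
    unfolding tau_def by (rule someI[where P = "\<lambda>f. f \<in> L2 \<mu> \<and> (\<forall>t\<in>cls s. L2_tendsto \<mu> t f)"])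
  then show "tau \<mu> (cls s) \<in> L2 \<mu>" by blast
  with spec show "(\<lambda>n. H.nrm (s n - tau \<mu> (cls s))) \<longlonglongrightarrow> 0"
    using cls_self[OF s] L2_tendsto_iff[of s "tau \<mu> (cls s)"] by simp
qed

text \<open>The bridge between the abstract form and actual functions: in L2 a sequence and the
  constant sequence of its limit are equivalent.\<close>

lemma L2_inner_tau:
  assumes s: "s \<in> V" and t: "t \<in> V"
  shows "L2_inner \<mu> (tau \<mu> (cls s)) (tau \<mu> (cls t)) = b s t"
proof -
  have "H.lim_form (\<lambda>_. tau \<mu> (cls s)) (\<lambda>_. tau \<mu> (cls t)) = H.lim_form s t"
  proof (rule H.lim_form_cong[OF V_H[OF s] H.const_cauchy_seqs[OF tau_cls(1)[OF s]] _
        V_H[OF t] H.const_cauchy_seqs[OF tau_cls(1)[OF t]]])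
    have sL: "s n \<in> L2 \<mu>" "t n \<in> L2 \<mu>" for n using V_mem s t smooth_in_L2 by blast+
    show "(\<lambda>n. H.nrm (tau \<mu> (cls s) - s n)) \<longlonglongrightarrow> 0"
      using tau_cls(2)[OF s] H.nrm_minus_commute[OF sL(1) tau_cls(1)[OF s]] by simp
    show "(\<lambda>n. H.nrm (tau \<mu> (cls t) - t n)) \<longlonglongrightarrow> 0"
      using tau_cls(2)[OF t] H.nrm_minus_commute[OF sL(2) tau_cls(1)[OF t]] by simp
  qed
  then show ?thesis using H.lim_form_const[OF tau_cls(1)[OF s] tau_cls(1)[OF t]] by simp
qed

lemma subspace_V: "subspace V" by (rule P.Q.subspace_cauchy_seqs)

lemma const_V: "u \<in> smooth_functions A \<Longrightarrow> (\<lambda>_. u) \<in> V" by (rule P.Q.const_cauchy_seqs)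

lemma a_const: "\<lbrakk>u \<in> smooth_functions A; w \<in> smooth_functions A\<rbrakk> \<Longrightarrow> a (\<lambda>_. u) (\<lambda>_. w) = dirichlet_form A g u w"
  by (rule D.lim_form_const)

lemma b_const: "\<lbrakk>u \<in> smooth_functions A; w \<in> smooth_functions A\<rbrakk> \<Longrightarrow> b (\<lambda>_. u) (\<lambda>_. w) = L2_inner \<mu> u w"
  by (rule P.B.lim_form_const)

lemma tau_const:
  assumes "u \<in> smooth_functions A"
  shows "H.nrm (u - tau \<mu> (cls (\<lambda>_. u))) = 0" "AE x in \<mu>. tau \<mu> (cls (\<lambda>_. u)) x = u x"
proof -
  have lim: "(\<lambda>n. H.nrm (u - tau \<mu> (cls (\<lambda>_. u)))) \<longlonglongrightarrow> 0" by (rule tau_cls(2)[OF const_V[OF assms]])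
  then show 0: "H.nrm (u - tau \<mu> (cls (\<lambda>_. u))) = 0" by (simp add: LIMSEQ_const_iff)
  have mem: "u - tau \<mu> (cls (\<lambda>_. u)) \<in> L2 \<mu>"
    using assms smooth_in_L2 tau_cls(1)[OF const_V[OF assms]] by (intro H.mem_simps) auto
  have "L2_inner \<mu> (u - tau \<mu> (cls (\<lambda>_. u))) (u - tau \<mu> (cls (\<lambda>_. u))) = 0"
    using 0 H.nrm_square[OF mem] by simp
  then have "AE x in \<mu>. (u - tau \<mu> (cls (\<lambda>_. u))) x = 0" using AE_zero_iff_L2[OF mem] by simp
  then show "AE x in \<mu>. tau \<mu> (cls (\<lambda>_. u)) x = u x" by eventually_elim simp
qed

lemma H_nrm_tau_residual:
  assumes s: "s \<in> V" and t: "\<And>i. i \<in> I \<Longrightarrow> t i \<in> V"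
  shows "H.nrm (tau \<mu> (cls s) - (\<Sum>i\<in>I. c i *\<^sub>R tau \<mu> (cls (t i)))) = psd_form.nrm b (s - (\<Sum>i\<in>I. c i *\<^sub>R t i))"
proof -
  interpret L: psd_pair V a b by (rule P.psd_pair_lim)
  have "L2_inner \<mu> (tau \<mu> (cls s) - (\<Sum>i\<in>I. c i *\<^sub>R tau \<mu> (cls (t i)))) (tau \<mu> (cls s) - (\<Sum>i\<in>I. c i *\<^sub>R tau \<mu> (cls (t i)))) =
      b (s - (\<Sum>i\<in>I. c i *\<^sub>R t i)) (s - (\<Sum>i\<in>I. c i *\<^sub>R t i))"
    using s t tau_cls(1)
    by (simp add: H.residual_expand L.B.residual_expand L2_inner_tau)
  then show ?thesis by (simp add: H.nrm_def L.B.nrm_def)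
qed

section \<open>Density of smooth functions\<close>

lemma radon_compact_inside:
  assumes B: "B \<in> sets borel" and e: "e > 0"
  obtains K where "compact K" "K \<subseteq> B" "measure \<mu> (B - K) < e"
proof (cases "measure \<mu> B = 0")
  case True
  show ?thesis by (rule that[of "{}"]) (use True e in auto)
next
  case False
  then have pos: "measure \<mu> B > 0" using measure_nonneg[of \<mu> B] by (simp add: less_le)
  have "ennreal (measure \<mu> B - e) < ennreal (measure \<mu> B)" using pos e by (intro ennreal_lessI) auto
  also have "\<dots> = (SUP K\<in>{K. compact K \<and> K \<subseteq> B}. emeasure \<mu> K)"
    using radon B by (simp add: radon_measure_def emeasure_eq_measure[symmetric])
  finally have "\<exists>K\<in>{K. compact K \<and> K \<subseteq> B}. ennreal (measure \<mu> B - e) < emeasure \<mu> K"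
    by (simp only: less_SUP_iff)
  then obtain K where K: "compact K" "K \<subseteq> B" "ennreal (measure \<mu> B - e) < emeasure \<mu> K" by blast
  have "measure \<mu> B - e < measure \<mu> K"
    using K(3) by (metis emeasure_eq_measure ennreal_leI not_le)
  moreover have "measure \<mu> (B - K) = measure \<mu> B - measure \<mu> K"
    using K B by (intro finite_measure_Diff) (auto intro: borel_compact)
  ultimately show ?thesis using K by (intro that) auto
qed

text \<open>Inner regularity of both \<open>B\<close> and its complement gives disjoint compact sets
  \<open>K\<close> and \<open>K'\<close>. A smooth function separating them differs from the
  indicator by at most 1, and only on what the two sets leave over.\<close>

lemma indicator_approx:
  assumes B: "B \<in> sets borel" and e: "e > 0"
  shows "\<exists>u\<in>smooth_functions A. H.nrm (indicator B - u) < e"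
proof -
  \<comment> \<open>There are two leftover sets, and the squared error is bounded by their total
    mass.\<close>
  define d where "d = e\<^sup>2 / 2"
  have d: "d > 0" using e by (simp add: d_def)
  obtain K where K: "compact K" "K \<subseteq> B" "measure \<mu> (B - K) < d" by (rule radon_compact_inside[OF B d])
  have "- B \<in> sets borel" using B by auto
  then obtain K' where K': "compact K'" "K' \<subseteq> - B" "measure \<mu> (- B - K') < d" by (rule radon_compact_inside[OF _ d])
  have op: "open (- K')" using K'(1) compact_imp_closed by auto
  have "K \<subseteq> - K'" using K K' by auto
  then obtain u where u: "u \<in> smooth_functions A" "\<forall>q. 0 \<le> u q \<and> u q \<le> 1" "\<forall>q\<in>K. u q = 1" "\<forall>q. q \<notin> - K' \<longrightarrow> u q = 0"
    by (rule smooth_urysohn[OF K(1) _ op])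
  let ?R = "(B - K) \<union> (- B - K')"
  have Kb: "K \<in> sets borel" "K' \<in> sets borel" using K K' by (auto intro: borel_compact)
  have R: "?R \<in> sets \<mu>" using Kb B by auto
  have uL: "u \<in> L2 \<mu>" using u(1) smooth_in_L2 by blast
  have BL: "indicator B \<in> L2 \<mu>"
  proof (rule bounded_in_L2[of _ 1])
    show "indicator B \<in> borel_measurable \<mu>" using B by (intro borel_measurable_indicator) simp
  qed (simp add: indicator_def)
  have mem: "indicator B - u \<in> L2 \<mu>" using uL BL by simp
  have "(H.nrm (indicator B - u))\<^sup>2 = (\<integral>x. ((indicator B - u) x)\<^sup>2 \<partial>\<mu>)"
    using mem by (simp add: H.nrm_square L2_inner_self)
  also have "\<dots> \<le> (\<integral>x. indicator ?R x \<partial>\<mu>)"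
  proof (rule integral_mono)
    show "integrable \<mu> (\<lambda>x. ((indicator B - u) x)\<^sup>2)" using mem by (simp add: L2_def)
    show "integrable \<mu> (indicator ?R :: 'a \<Rightarrow> real)" using R by (simp add: emeasure_eq_measure)
    fix x
    have "\<bar>indicator B x - u x\<bar> \<le> indicator ?R x"
      using u(2)[rule_format, of x] u(3,4) K(2) K'(2) by (auto simp: indicator_def)
    then have "\<bar>indicator B x - u x\<bar>\<^sup>2 \<le> (indicator ?R x)\<^sup>2" by (intro power_mono) auto
    moreover have "(indicator ?R x :: real)\<^sup>2 = indicator ?R x" by (simp add: indicator_def)
    ultimately show "((indicator B - u) x)\<^sup>2 \<le> indicator ?R x" by (simp only: power2_abs fun_diff_def)
  qed
  also have "\<dots> = measure \<mu> ?R" using R by simp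
  also have "\<dots> \<le> measure \<mu> (B - K) + measure \<mu> (- B - K')"
    using Kb B by (intro measure_Un_le) auto
  also have "\<dots> < e\<^sup>2" using K(3) K'(3) by (simp add: d_def)
  finally have "H.nrm (indicator B - u) < e" using e by (simp add: power_less_imp_less_base)
  then show ?thesis using u(1) by blast
qed

lemma smooth_dense:
  assumes "h \<in> L2 \<mu>" "e > 0"
  shows "\<exists>u\<in>smooth_functions A. H.nrm (h - u) < e"
proof (rule L2_dense[OF finite_measure_mu subspace_smooth_functions smooth_in_L2 _ assms])
  fix B and e :: real assume "B \<in> sets \<mu>" "e > 0"
  then show "\<exists>u\<in>smooth_functions A. H.nrm (indicator B - u) < e"
    using indicator_approx[of B e] by simp
qed

section \<open>The measure has no atoms\<close>

lemma square_mean_value: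
  assumes f: "f \<in> L2 \<mu>"
  shows "(\<integral>x. (f x - mean_value \<mu> f)\<^sup>2 \<partial>\<mu>) = (\<integral>x. (f x)\<^sup>2 \<partial>\<mu>) - (\<integral>x. f x \<partial>\<mu>)\<^sup>2 / measure \<mu> UNIV"
proof -
  let ?m = "mean_value \<mu> f" and ?T = "measure \<mu> UNIV"
  have int: "integrable \<mu> f" "integrable \<mu> (\<lambda>x. (f x)\<^sup>2)" using L2_integrable[OF f] f by (auto simp: L2_def)
  have "(\<integral>x. (f x - ?m)\<^sup>2 \<partial>\<mu>) = (\<integral>x. (f x)\<^sup>2 + ?m\<^sup>2 - (2 * ?m) * f x \<partial>\<mu>)"
    by (simp add: power2_diff mult_ac)
  also have "\<dots> = (\<integral>x. (f x)\<^sup>2 \<partial>\<mu>) + ?m\<^sup>2 * ?T - (2 * ?m) * (\<integral>x. f x \<partial>\<mu>)"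
    using int by simp
  also have "\<dots> = (\<integral>x. (f x)\<^sup>2 \<partial>\<mu>) - (\<integral>x. f x \<partial>\<mu>)\<^sup>2 / ?T"
    using total_mass_pos by (simp add: mean_value_def power2_eq_square field_simps)
  finally show ?thesis .
qed

lemma smooth_poincare:
  obtains K where "K > 0" "\<forall>u\<in>smooth_functions A.
    (\<integral>x. (u x)\<^sup>2 \<partial>\<mu>) - (\<integral>x. u x \<partial>\<mu>)\<^sup>2 / measure \<mu> UNIV \<le> K * dirichlet_form A g u u"
proof -
  obtain K where K: "K > 0" "\<forall>X\<in>sobolev_space A g \<mu>.
     (\<integral>x. (tau \<mu> X x - mean_value \<mu> (tau \<mu> X))\<^sup>2 \<partial>\<mu>) \<le> K * sobolev_dirichlet A g X X"
    using poincare unfolding supports_poincare_def by blast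
  have "(\<integral>x. (u x)\<^sup>2 \<partial>\<mu>) - (\<integral>x. u x \<partial>\<mu>)\<^sup>2 / measure \<mu> UNIV \<le> K * dirichlet_form A g u u"
    if u: "u \<in> smooth_functions A" for u
  proof -
    let ?X = "cls (\<lambda>_. u)"
    have X: "?X \<in> sobolev_space A g \<mu>" using const_V[OF u] by (simp add: sobolev_space_eq)
    have m: "tau \<mu> ?X \<in> borel_measurable \<mu>" using tau_cls(1)[OF const_V[OF u]] by (simp add: L2_def)
    have "(\<integral>x. (tau \<mu> ?X x)\<^sup>2 \<partial>\<mu>) = (\<integral>x. (u x)\<^sup>2 \<partial>\<mu>)"
      using m smooth_measurable[OF u] tau_const(2)[OF u] by (intro integral_cong_AE) auto
    moreover have "(\<integral>x. tau \<mu> ?X x \<partial>\<mu>) = (\<integral>x. u x \<partial>\<mu>)"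
      using m smooth_measurable[OF u] tau_const(2)[OF u] by (intro integral_cong_AE) auto
    ultimately show ?thesis
      using K(2)[rule_format, OF X] square_mean_value[OF tau_cls(1)[OF const_V[OF u]]]
        sobolev_dirichlet_cls[OF const_V[OF u] const_V[OF u]] a_const[OF u u] by simp
  qed
  then show ?thesis by (intro that[OF K(1)]) blast
qed

text \<open>The variances of the capacity functions tend to the variance of the indicator of the
  point, and the Poincare inequality bounds them by energies tending to 0. Not all mass sits at the
  point, so none does.\<close>

lemma no_atoms: "measure \<mu> {p} = 0"
proof -
  obtain K where K: "K > 0" "\<forall>u\<in>smooth_functions A.
      (\<integral>x. (u x)\<^sup>2 \<partial>\<mu>) - (\<integral>x. u x \<partial>\<mu>)\<^sup>2 / measure \<mu> UNIV \<le> K * dirichlet_form A g u u"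
    by (rule smooth_poincare)
  obtain u where u: "\<forall>N::nat. u N \<in> smooth_functions A \<and> (\<forall>q. 0 \<le> u N q \<and> u N q \<le> 1) \<and> u N p = 1"
    "\<forall>q. q \<noteq> p \<longrightarrow> (\<lambda>N. u N q) \<longlonglongrightarrow> 0" "(\<lambda>N. dirichlet_form A g (u N) (u N)) \<longlonglongrightarrow> 0"
    by (rule point_capacity_zero[OF dim])
  let ?m = "measure \<mu> {p}" and ?T = "measure \<mu> UNIV"
  have lim: "(\<lambda>N. u N q) \<longlonglongrightarrow> indicator {p} q" for q
    using u(1,2) by (cases "q = p") auto
  have um: "u N \<in> borel_measurable \<mu>" for N using u(1) smooth_measurable by blast
  have im: "indicator {p} \<in> borel_measurable \<mu>" by (intro borel_measurable_indicator) simp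
  have int1: "(\<lambda>N. \<integral>x. u N x \<partial>\<mu>) \<longlonglongrightarrow> (\<integral>x. indicator {p} x \<partial>\<mu>)"
  proof (rule integral_dominated_convergence[where w = "\<lambda>_. 1"])
    show "AE x in \<mu>. norm (u N x) \<le> 1" for N using u(1) by (intro AE_I2) simp
    show "AE x in \<mu>. (\<lambda>N. u N x) \<longlonglongrightarrow> indicator {p} x" using lim by (intro AE_I2)
  qed (simp_all add: um im)
  have int2: "(\<lambda>N. \<integral>x. (u N x)\<^sup>2 \<partial>\<mu>) \<longlonglongrightarrow> (\<integral>x. (indicator {p} x)\<^sup>2 \<partial>\<mu>)"
  proof (rule integral_dominated_convergence[where w = "\<lambda>_. 1"])
    show "AE x in \<mu>. norm ((u N x)\<^sup>2) \<le> 1" for N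
      using u(1) by (intro AE_I2) (simp add: power_le_one)
    show "AE x in \<mu>. (\<lambda>N. (u N x)\<^sup>2) \<longlonglongrightarrow> (indicator {p} x)\<^sup>2" using lim by (intro AE_I2 tendsto_power)
  qed (simp_all add: um im borel_measurable_power)
  have "(\<integral>x. (indicator {p} x :: real)\<^sup>2 \<partial>\<mu>) = (\<integral>x. indicator {p} x \<partial>\<mu>)"
    by (intro Bochner_Integration.integral_cong) (auto simp: indicator_def)
  then have lhs: "(\<lambda>N. (\<integral>x. (u N x)\<^sup>2 \<partial>\<mu>) - (\<integral>x. u N x \<partial>\<mu>)\<^sup>2 / ?T) \<longlonglongrightarrow> ?m - ?m\<^sup>2 / ?T"
    using int1 int2 total_mass_pos by (intro tendsto_intros) auto
  have "(\<lambda>N. K * dirichlet_form A g (u N) (u N)) \<longlonglongrightarrow> 0"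
    by (rule tendsto_mult_right_zero[OF u(3)])
  then have "?m - ?m\<^sup>2 / ?T \<le> 0"
    by (rule LIMSEQ_le[OF lhs]) (use K(2) u(1) in blast)
  then have "?m * (?T - ?m) \<le> 0" using total_mass_pos by (simp add: field_simps power2_eq_square)
  moreover have "?m < ?T"
  proof -
    have "measure \<mu> (UNIV - {p}) = ?T - ?m" by (intro finite_measure_Diff) auto
    moreover have "measure \<mu> (UNIV - {p}) \<noteq> 0"
      using not_point by (auto simp: supported_on_point_def emeasure_eq_measure)
    ultimately show ?thesis using measure_nonneg[of \<mu> "UNIV - {p}"] by simp
  qed
  ultimately have "?m \<le> 0" by (simp add: mult_le_0_iff)
  then show ?thesis using measure_nonneg[of \<mu> "{p}"] by simp
qed

definition supp :: "'a set" where
  "supp = {p. \<forall>U. open U \<longrightarrow> p \<in> U \<longrightarrow> measure \<mu> U > 0}"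

text \<open>Without atoms a finite support is null. Its complement is null as well: compact subsets
  are covered by finitely many null open sets, and inner regularity passes this to the
  complement.\<close>

lemma infinite_supp: "infinite supp"
proof
  assume fin: "finite supp"
  have "measure \<mu> supp = (\<Sum>p\<in>supp. measure \<mu> {p})"
    using fin by (intro measure_eq_sum_singleton) auto
  then have 0: "measure \<mu> supp = 0" by (simp add: no_atoms)
  have sb: "supp \<in> sets borel" using fin by (simp add: finite_imp_closed)
  then have "- supp \<in> sets borel" by auto
  have "measure \<mu> (- supp) < e" if e: "e > 0" for e
  proof -
    obtain K where K: "compact K" "K \<subseteq> - supp" "measure \<mu> (- supp - K) < e"
      by (rule radon_compact_inside[OF \<open>- supp \<in> sets borel\<close> e])
    have "\<forall>p\<in>K. \<exists>U. open U \<and> p \<in> U \<and> measure \<mu> U = 0"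
    proof
      fix p assume "p \<in> K"
      then have "p \<notin> supp" using K(2) by blast
      then obtain U where "open U" "p \<in> U" "\<not> measure \<mu> U > 0" by (auto simp: supp_def)
      then show "\<exists>U. open U \<and> p \<in> U \<and> measure \<mu> U = 0"
        using measure_nonneg[of \<mu> U] by (intro exI[of _ U]) auto
    qed
    from bchoice[OF this] obtain U where U: "\<And>p. p \<in> K \<Longrightarrow> open (U p)" "\<And>p. p \<in> K \<Longrightarrow> p \<in> U p"
      "\<And>p. p \<in> K \<Longrightarrow> measure \<mu> (U p) = 0" by blast
    have cover: "K \<subseteq> (\<Union>p\<in>K. U p)" using U(2) by blast
    obtain I where I: "I \<subseteq> K" "finite I" "K \<subseteq> (\<Union>p\<in>I. U p)"
      by (rule compactE_image[OF K(1) U(1) cover])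
    have "measure \<mu> K \<le> measure \<mu> (\<Union>p\<in>I. U p)"
      using I U(1) by (intro finite_measure_mono) (auto intro!: borel_open)
    also have "\<dots> \<le> (\<Sum>p\<in>I. measure \<mu> (U p))"
      using I U(1) by (intro finite_measure_subadditive_finite) auto
    also have "\<dots> = 0" using I(1) U(3) by (intro sum.neutral) auto
    finally have "measure \<mu> K = 0" using measure_nonneg[of \<mu> K] by simp
    moreover have "measure \<mu> (- supp - K) = measure \<mu> (- supp) - measure \<mu> K"
      using K sb by (intro finite_measure_Diff) (auto intro: borel_compact)
    ultimately show ?thesis using K(3) by simp
  qed
  then have "measure \<mu> (- supp) = 0" using measure_nonneg[of \<mu> "- supp"] by (metis less_irrefl less_le)
  moreover have "measure \<mu> (- supp) = measure \<mu> UNIV - measure \<mu> supp"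
    using finite_measure_compl[of supp] sb by (simp add: Compl_eq_Diff_UNIV)
  ultimately show False using 0 total_mass_pos by simp
qed

lemma continuous_AE_zero:
  fixes f :: "'a \<Rightarrow> real"
  assumes f: "continuous_on UNIV f" "AE x in \<mu>. f x = 0" and p: "p \<in> supp"
  shows "f p = 0"
proof (rule ccontr)
  assume "f p \<noteq> 0"
  let ?U = "{x. f x \<noteq> 0}"
  have "open ?U" using f(1) by (intro open_Collect_neq continuous_intros)
  then have "measure \<mu> ?U > 0" using p \<open>f p \<noteq> 0\<close> by (auto simp: supp_def)
  moreover have "emeasure \<mu> ?U = 0"
    using f(2) AE_iff_measurable[of ?U \<mu> "\<lambda>x. f x = 0"] \<open>open ?U\<close> by simp
  ultimately show False by (simp add: measure_def)
qed

text \<open>Choose \<open>k\<close> support points and bumps dual to them. A combination vanishing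
  almost everywhere is continuous, hence vanishes at these points, where it takes its coefficients
  as values.\<close>

lemma smooth_infinite_dim:
  "\<exists>w. (\<forall>i<k::nat. w i \<in> smooth_functions A) \<and>
    (\<forall>c. L2_inner \<mu> (\<Sum>i<k. c i *\<^sub>R w i) (\<Sum>i<k. c i *\<^sub>R w i) = 0 \<longrightarrow> (\<forall>i<k. c i = 0))"
proof -
  obtain T where T: "T \<subseteq> supp" "finite T" "card T = k"
    using infinite_arbitrarily_large[OF infinite_supp] by blast
  obtain p where "bij_betw p {..<k} T" using ex_bij_betw_nat_finite[OF T(2)] T(3) by (auto simp: atLeast0LessThan)
  then have inj: "inj_on p {..<k}" and pT: "p ` {..<k} = T" by (auto simp: bij_betw_def)
  have "\<forall>i. \<exists>u. i < k \<longrightarrow> u \<in> smooth_functions A \<and> u (p i) = 1 \<and> (\<forall>j<k. j \<noteq> i \<longrightarrow> u (p j) = 0)"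
  proof
    fix i
    show "\<exists>u. i < k \<longrightarrow> u \<in> smooth_functions A \<and> u (p i) = 1 \<and> (\<forall>j<k. j \<noteq> i \<longrightarrow> u (p j) = 0)"
    proof (cases "i < k")
      case True
      have "open (- (T - {p i}))" by (intro open_Compl finite_imp_closed finite_Diff T(2))
      from smooth_bump[OF this, of "p i"] obtain u W where u: "u \<in> smooth_functions A" "p i \<in> W" "\<forall>q\<in>W. u q = 1"
        "\<forall>q. q \<notin> - (T - {p i}) \<longrightarrow> u q = 0" by auto
      have "u (p j) = 0" if j: "j < k" "j \<noteq> i" for j
      proof -
        have "p j \<in> T" using pT j by auto
        moreover have "p j \<noteq> p i" using inj_onD[OF inj, of j i] j True by auto
        ultimately show ?thesis using u(4) by simp
      qed
      then show ?thesis using u(1,2,3) by (intro exI[of _ u]) simp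
    qed simp
  qed
  from choice[OF this] obtain w where w: "\<And>i. i < k \<Longrightarrow> w i \<in> smooth_functions A" "\<And>i. i < k \<Longrightarrow> w i (p i) = 1"
    "\<And>i j. \<lbrakk>i < k; j < k; j \<noteq> i\<rbrakk> \<Longrightarrow> w i (p j) = 0" by blast
  have "c j = 0" if 0: "L2_inner \<mu> (\<Sum>i<k. c i *\<^sub>R w i) (\<Sum>i<k. c i *\<^sub>R w i) = 0" and j: "j < k" for c j
  proof -
    let ?f = "\<Sum>i<k. c i *\<^sub>R w i"
    have f: "?f \<in> smooth_functions A" using w(1) by (intro D.mem_sum D.mem_simps) auto
    then have AE0: "AE x in \<mu>. ?f x = 0" using 0 AE_zero_iff_L2[of ?f \<mu>] smooth_in_L2 by blast
    have "p j \<in> supp" using T(1) pT j by auto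
    then have "?f (p j) = 0" by (rule continuous_AE_zero[OF smooth_functions_continuous[OF f] AE0])
    moreover have "?f (p j) = (\<Sum>i<k. if i = j then c j else 0)"
      unfolding sum_fun_apply using w(2,3) j by (intro sum.cong) auto
    ultimately show ?thesis using j by simp
  qed
  then have "\<forall>c. L2_inner \<mu> (\<Sum>i<k. c i *\<^sub>R w i) (\<Sum>i<k. c i *\<^sub>R w i) = 0 \<longrightarrow> (\<forall>i<k. c i = 0)" by (intro allI impI)
  moreover have "\<forall>i<k. w i \<in> smooth_functions A" using w(1) by simp
  ultimately show ?thesis by (intro exI[of _ w] conjI)
qed

section \<open>Spectral decomposition\<close>

text \<open>Completeness is \<open>lim_complete\<close>, once the sum of the limit forms is
  identified with the limit of the sum. Compactness is that of \<tau>, as \<open>b\<close>-distances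
  are L2 distances of images. Smooth functions, as constant sequences, give the dimension.\<close>

lemma compact_pair_V: "compact_pair V a b"
proof -
  interpret L: psd_pair V a b by (rule P.psd_pair_lim)
  interpret LQ: psd_form V P.Q.lim_form
    by (intro P.Q.psd_form_lim_form subspace_V order_refl)
  have nrm_eq: "L.Q.nrm s = LQ.nrm s" if "s \<in> V" for s
    using that by (simp add: L.Q.nrm_def LQ.nrm_def L.q_def P.lim_form_Q)
  have cs: "L.Q.cauchy_seqs = LQ.cauchy_seqs"
  proof -
    have "(range S \<subseteq> V \<and> (\<forall>e>0. \<exists>N. \<forall>m\<ge>N. \<forall>n\<ge>N. L.Q.nrm (S m - S n) < e)) \<longleftrightarrow>
        (range S \<subseteq> V \<and> (\<forall>e>0. \<exists>N. \<forall>m\<ge>N. \<forall>n\<ge>N. LQ.nrm (S m - S n) < e))" for S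
    proof (rule conj_cong[OF refl])
      assume "range S \<subseteq> V"
      then have "S m - S n \<in> V" for m n by (meson rangeI subsetD subspace_diff subspace_V)
      then show "(\<forall>e>0. \<exists>N. \<forall>m\<ge>N. \<forall>n\<ge>N. L.Q.nrm (S m - S n) < e) \<longleftrightarrow> (\<forall>e>0. \<exists>N. \<forall>m\<ge>N. \<forall>n\<ge>N. LQ.nrm (S m - S n) < e)"
        by (simp only: nrm_eq)
    qed
    then show ?thesis unfolding L.Q.cauchy_seqs_def LQ.cauchy_seqs_def by (rule Collect_cong)
  qed
  show ?thesis
  proof unfold_locales
    fix S assume S: "S \<in> L.Q.cauchy_seqs"
    then have SV: "S n \<in> V" for n by (rule L.Q.cauchy_seqs_mem)
    obtain l where l: "l \<in> V" "(\<lambda>n. LQ.nrm (S n - l)) \<longlonglongrightarrow> 0"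
      using P.Q.lim_complete[of S] S[unfolded cs] by blast
    have "S n - l \<in> V" for n using SV l(1) by simp
    then show "\<exists>l\<in>V. (\<lambda>n. L.Q.nrm (S n - l)) \<longlonglongrightarrow> 0" using l by (intro bexI[of _ l]) (simp_all only: nrm_eq)
  next
    fix S :: "nat \<Rightarrow> nat \<Rightarrow> 'a \<Rightarrow> real" and C assume SV: "\<And>n. S n \<in> V" and C: "\<And>n. L.Q.nrm (S n) \<le> C"
    have "sobolev_norm A g \<mu> (cls (S n)) \<le> C" for n
      using C[of n] nrm_eq[OF SV[of n]] sobolev_norm_cls[OF SV[of n]] by simp
    have "cls (S n) \<in> sobolev_space A g \<mu>" for n using SV by (simp add: sobolev_space_eq)
    obtain r :: "nat \<Rightarrow> nat" and f where r: "strict_mono r" "f \<in> L2 \<mu>"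
      "L2_tendsto \<mu> (\<lambda>n. tau \<mu> (cls (S (r n)))) f"
    proof -
      have bd: "(\<forall>n. cls (S n) \<in> sobolev_space A g \<mu>) \<and> (\<exists>C. \<forall>n. sobolev_norm A g \<mu> (cls (S n)) \<le> C)"
        using \<open>\<And>n. sobolev_norm A g \<mu> (cls (S n)) \<le> C\<close> \<open>\<And>n. cls (S n) \<in> sobolev_space A g \<mu>\<close> by blast
      from mp[OF spec[OF compact_tau[unfolded tau_compact_def], of "\<lambda>n. cls (S n)"] bd] show ?thesis
        by (elim exE conjE) (rule that)
    qed
    define T where "T n = tau \<mu> (cls (S (r n)))" for n
    have TL [simp]: "T n \<in> L2 \<mu>" for n unfolding T_def by (rule tau_cls(1)[OF SV])
    have lim: "(\<lambda>n. H.nrm (T n - f)) \<longlonglongrightarrow> 0"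
      using r(2,3) L2_tendsto_iff[of T f] TL by (simp add: T_def[abs_def])
    \<comment> \<open>The L2 limit need not be an image under \<tau>, so only the Cauchy property is
      carried back.\<close>
    have "S \<circ> r \<in> L.B.cauchy_seqs" unfolding L.B.cauchy_seqs_def
    proof (intro CollectI conjI allI impI)
      show "range (S \<circ> r) \<subseteq> V" using SV by auto
      fix e :: real assume "e > 0"
      then have "e / 2 > 0" by simp
      from order_tendstoD(2)[OF lim this] obtain N where N: "\<And>n. n \<ge> N \<Longrightarrow> H.nrm (T n - f) < e / 2"
        by (auto simp: eventually_sequentially)
      show "\<exists>N. \<forall>m\<ge>N. \<forall>n\<ge>N. L.B.nrm ((S \<circ> r) m - (S \<circ> r) n) < e"
      proof (intro exI[of _ N] allI impI)
        fix m n assume mn: "m \<ge> N" "n \<ge> N"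
        have "L.B.nrm ((S \<circ> r) m - (S \<circ> r) n) = H.nrm (T m - T n)"
          using H_nrm_tau_residual[OF SV[of "r m"], of "{n}" "\<lambda>n. S (r n)" "\<lambda>_. 1"] SV by (simp add: T_def)
        also have "\<dots> \<le> H.nrm (T m - f) + H.nrm (f - T n)" using r(2) by (intro H.nrm_triangle_diff) simp_all
        also have "H.nrm (f - T n) = H.nrm (T n - f)" using r(2) by (intro H.nrm_minus_commute) simp_all
        finally show "L.B.nrm ((S \<circ> r) m - (S \<circ> r) n) < e" using N[OF mn(1)] N[OF mn(2)] by linarith
      qed
    qed
    then show "\<exists>r::nat \<Rightarrow> nat. strict_mono r \<and> S \<circ> r \<in> L.B.cauchy_seqs" using r(1) by blast
  next
    fix k :: nat
    obtain w where w: "\<forall>i<k. w i \<in> smooth_functions A"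
      "\<forall>c. L2_inner \<mu> (\<Sum>i<k. c i *\<^sub>R w i) (\<Sum>i<k. c i *\<^sub>R w i) = 0 \<longrightarrow> (\<forall>i<k. c i = 0)"
      using smooth_infinite_dim[of k] by (elim exE conjE) (rule that)
    have "(\<Sum>i<k. c i *\<^sub>R (\<lambda>_. w i)) = (\<lambda>_::nat. \<Sum>i<k. c i *\<^sub>R w i)" for c
      by (rule ext) (simp add: sum_fun_apply)
    moreover have "(\<Sum>i<k. c i *\<^sub>R w i) \<in> smooth_functions A" for c
      using w(1) by (intro D.mem_sum D.mem_simps) auto
    ultimately have "b (\<Sum>i<k. c i *\<^sub>R (\<lambda>_. w i)) (\<Sum>i<k. c i *\<^sub>R (\<lambda>_. w i)) = L2_inner \<mu> (\<Sum>i<k. c i *\<^sub>R w i) (\<Sum>i<k. c i *\<^sub>R w i)" for c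
      by (simp add: b_const)
    then show "\<exists>w. (\<forall>i<k. w i \<in> V) \<and> (\<forall>c. b (\<Sum>i<k. c i *\<^sub>R w i) (\<Sum>i<k. c i *\<^sub>R w i) = 0 \<longrightarrow> (\<forall>i<k. c i = 0))"
      using w const_V by (intro exI[of _ "\<lambda>i _. w i"] conjI) simp_all
  qed
qed

end

text \<open>Entrywise closeness of matrices controls their quadratic forms, at the cost of the
  factor \<open>card I\<close>. It is applied to Gram matrices of approximate
  eigenfunctions.\<close>

lemma quadratic_form_bound:
  fixes M :: "'i \<Rightarrow> 'i \<Rightarrow> real"
  assumes M: "\<And>i j. \<lbrakk>i \<in> I; j \<in> I\<rbrakk> \<Longrightarrow> \<bar>M i j\<bar> \<le> \<eta>"
  shows "\<bar>\<Sum>i\<in>I. \<Sum>j\<in>I. c i * c j * M i j\<bar> \<le> \<eta> * real (card I) * (\<Sum>i\<in>I. (c i)\<^sup>2)"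
proof -
  have pt: "\<bar>c i * c j * M i j\<bar> \<le> \<eta> / 2 * (c i)\<^sup>2 + \<eta> / 2 * (c j)\<^sup>2" if "i \<in> I" "j \<in> I" for i j
  proof -
    have \<eta>: "0 \<le> \<eta>" using M[OF that] by linarith
    have "2 * (\<bar>c i\<bar> * \<bar>c j\<bar>) \<le> (c i)\<^sup>2 + (c j)\<^sup>2" using sum_squares_bound[of "\<bar>c i\<bar>" "\<bar>c j\<bar>"] by simp
    then have "\<eta> * (2 * (\<bar>c i\<bar> * \<bar>c j\<bar>)) \<le> \<eta> * ((c i)\<^sup>2 + (c j)\<^sup>2)" using \<eta> by (rule mult_left_mono)
    moreover have "\<bar>c i * c j * M i j\<bar> \<le> (\<bar>c i\<bar> * \<bar>c j\<bar>) * \<eta>"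
      unfolding abs_mult using M[OF that] by (intro mult_left_mono) auto
    ultimately show ?thesis by (simp add: algebra_simps)
  qed
  have "\<bar>\<Sum>i\<in>I. \<Sum>j\<in>I. c i * c j * M i j\<bar> \<le> (\<Sum>i\<in>I. \<Sum>j\<in>I. \<bar>c i * c j * M i j\<bar>)"
    by (rule order_trans[OF sum_abs sum_mono]) (rule sum_abs)
  also have "\<dots> \<le> (\<Sum>i\<in>I. \<Sum>j\<in>I. \<eta> / 2 * (c i)\<^sup>2 + \<eta> / 2 * (c j)\<^sup>2)"
    by (intro sum_mono pt)
  also have "\<dots> = 2 * real (card I) * (\<Sum>i\<in>I. \<eta> / 2 * (c i)\<^sup>2)"
    by (simp only: sum.distrib sum_constant sum_distrib_left[symmetric])
  also have "\<dots> = \<eta> * real (card I) * (\<Sum>i\<in>I. (c i)\<^sup>2)"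
    by (simp only: sum_distrib_left[symmetric]) simp
  finally show ?thesis .
qed

section \<open>The spectrum and the variational eigenvalues\<close>

locale eigensystem = admissible_measure A g \<mu>
  for A :: "('a::{t2_space, second_countable_topology}, 'n::finite) chart set" and g :: "('a, 'n) metric"
    and \<mu> :: "'a measure" +
  fixes e :: "nat \<Rightarrow> nat \<Rightarrow> 'a \<Rightarrow> real" and \<nu> :: "nat \<Rightarrow> real"
  assumes e_V: "e i \<in> V"
    and orthonormal: "b (e i) (e j) = (if i = j then 1 else 0)"
    and eigen: "w \<in> V \<Longrightarrow> a (e i) w = \<nu> i * b (e i) w"
    and incseq: "incseq \<nu>"
    and nu_nonneg: "0 \<le> \<nu> i"
    and nu_top: "filterlim \<nu> at_top sequentially"
    and minimum: "\<lbrakk>w \<in> V; \<forall>i<k. b w (e i) = 0\<rbrakk> \<Longrightarrow> \<nu> k * b w w \<le> a w w"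
    and expansion: "w \<in> V \<Longrightarrow> (\<lambda>n. psd_form.nrm b (w - (\<Sum>i<n. b w (e i) *\<^sub>R e i))) \<longlonglongrightarrow> 0"

lemma (in admissible_measure) ex_eigensystem: "\<exists>e \<nu>. eigensystem A g \<mu> e \<nu>"
proof -
  interpret S: compact_pair V a b by (rule compact_pair_V)
  show ?thesis
  proof (rule S.spectral_theorem)
    fix e \<nu> assume *: "\<And>i. e i \<in> V"
    "\<And>i j. b (e i) (e j) = (if i = j then 1 else 0)"
    "\<And>i w. w \<in> V \<Longrightarrow> a (e i) w = \<nu> i * b (e i) w"
    "incseq \<nu>" "\<And>i. 0 \<le> \<nu> i" "filterlim \<nu> at_top sequentially"
    "\<And>k w. w \<in> S.perp e k \<Longrightarrow> \<nu> k * b w w \<le> a w w"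
    "\<And>w. w \<in> V \<Longrightarrow> (\<lambda>n. S.B.nrm (w - (\<Sum>i<n. b w (e i) *\<^sub>R e i))) \<longlonglongrightarrow> 0"
    have "eigensystem A g \<mu> e \<nu>"
    proof unfold_locales
      show "\<nu> k * b w w \<le> a w w" if "w \<in> V" "\<forall>i<k. b w (e i) = 0" for k w
        by (rule *(7)) (use that in \<open>simp add: S.perp_def\<close>)
    qed (rule *; assumption?)+
    then show ?thesis by blast
  qed
qed

context eigensystem
begin

interpretation L: psd_pair V a b by (rule P.psd_pair_lim)

abbreviation T where "T j \<equiv> tau \<mu> (cls (e j))"

lemma T_L2: "T j \<in> L2 \<mu>" by (rule tau_cls(1)[OF e_V])

lemma T_inner: "L2_inner \<mu> (T i) (T j) = (if i = j then 1 else 0)"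
  by (simp add: L2_inner_tau[OF e_V e_V] orthonormal)

text \<open>For \<open>k = 0\<close> there are no orthogonality conditions, so the constant function
  may be tested: it has zero energy and positive mass.\<close>

lemma nu_0: "\<nu> 0 = 0"
proof -
  have one: "(\<lambda>_. 1) \<in> smooth_functions A" by (rule smooth_functions_const)
  have "\<nu> 0 * b (\<lambda>_. (\<lambda>_. 1)) (\<lambda>_. (\<lambda>_. 1)) \<le> a (\<lambda>_. (\<lambda>_. 1)) (\<lambda>_. (\<lambda>_. 1))"
    by (rule minimum[OF const_V[OF one]]) simp
  then have "\<nu> 0 * measure \<mu> UNIV \<le> 0"
    by (simp add: a_const[OF one one] b_const[OF one one] dirichlet_const[OF one] L2_inner_def)
  then show ?thesis using total_mass_pos nu_nonneg[of 0] by (simp add: mult_le_0_iff)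
qed

text \<open>The eigenfunction has energy 0, and the Poincare inequality on the Sobolev space then
  makes its variance 0.\<close>

lemma zero_eigenfunction_constant:
  assumes "\<nu> i = 0"
  obtains m where "AE x in \<mu>. T i x = m"
proof -
  let ?X = "cls (e i)" and ?m = "mean_value \<mu> (T i)"
  obtain K where K: "K > 0" "\<forall>X\<in>sobolev_space A g \<mu>.
     (\<integral>x. (tau \<mu> X x - mean_value \<mu> (tau \<mu> X))\<^sup>2 \<partial>\<mu>) \<le> K * sobolev_dirichlet A g X X"
    using poincare unfolding supports_poincare_def by blast
  have "?X \<in> sobolev_space A g \<mu>" using e_V by (simp add: sobolev_space_eq)
  then have "(\<integral>x. (T i x - ?m)\<^sup>2 \<partial>\<mu>) \<le> K * sobolev_dirichlet A g ?X ?X" using K(2) by blast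
  also have "\<dots> = 0" using assms by (simp add: sobolev_dirichlet_cls[OF e_V e_V] eigen[OF e_V])
  finally have le: "(\<integral>x. (T i x - ?m)\<^sup>2 \<partial>\<mu>) \<le> 0" .
  have cL: "(\<lambda>_. ?m) \<in> L2 \<mu>" by (rule bounded_in_L2[of _ "\<bar>?m\<bar>"]) auto
  have mem: "T i - (\<lambda>_. ?m) \<in> L2 \<mu>" by (rule H.mem_simps(3)[OF T_L2 cL])
  have "0 \<le> (\<integral>x. (T i x - ?m)\<^sup>2 \<partial>\<mu>)" by simp
  with le have "(\<integral>x. (T i x - ?m)\<^sup>2 \<partial>\<mu>) = 0" by (rule antisym)
  then have "L2_inner \<mu> (T i - (\<lambda>_. ?m)) (T i - (\<lambda>_. ?m)) = 0" by (simp add: L2_inner_self)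
  then have "AE x in \<mu>. (T i - (\<lambda>_. ?m)) x = 0" using AE_zero_iff_L2[OF mem] by simp
  then have "AE x in \<mu>. T i x = ?m" by eventually_elim simp
  then show ?thesis by (rule that)
qed

text \<open>Otherwise \<open>T 0\<close> and \<open>T 1\<close> would both be constant almost
  everywhere, and two such functions cannot be orthonormal.\<close>

lemma nu_1_pos: "0 < \<nu> 1"
proof (rule ccontr)
  assume "\<not> 0 < \<nu> 1"
  then have "\<nu> 1 = 0" using nu_nonneg[of 1] by simp
  then obtain m1 where m1: "AE x in \<mu>. T 1 x = m1" by (rule zero_eigenfunction_constant)
  obtain m0 where m0: "AE x in \<mu>. T 0 x = m0" by (rule zero_eigenfunction_constant[OF nu_0])
  have inner: "L2_inner \<mu> f h = k * l * measure \<mu> UNIV"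
    if "f \<in> L2 \<mu>" "h \<in> L2 \<mu>" "AE x in \<mu>. f x = k" "AE x in \<mu>. h x = l" for f h k l
  proof -
    have "(\<integral>x. f x * h x \<partial>\<mu>) = (\<integral>x. k * l \<partial>\<mu>)"
    proof (rule integral_cong_AE)
      show "AE x in \<mu>. f x * h x = k * l" using that(3,4) by eventually_elim simp
    qed (use that(1,2) in \<open>auto simp: L2_def\<close>)
    then show ?thesis by (simp add: L2_inner_def)
  qed
  have "m0 * m0 * measure \<mu> UNIV = 1" "m1 * m1 * measure \<mu> UNIV = 1" "m0 * m1 * measure \<mu> UNIV = 0"
    using inner[OF T_L2 T_L2 m0 m0] inner[OF T_L2 T_L2 m1 m1] inner[OF T_L2 T_L2 m0 m1]
    by (simp_all add: T_inner)
  then show False using total_mass_pos by auto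
qed

text \<open>Linear independence modulo null sets is exactly independence for \<open>b\<close>. The
  resulting vector has positive \<open>b\<close>-length, so its quotient is a genuine one and it is
  not the excluded zero function.\<close>

lemma rayleigh_quotient_ge:
  assumes F: "F \<in> test_spaces A \<mu> (k + 1)"
  shows "ereal (\<nu> k) \<le> (SUP f\<in>F - {0}. ereal (dirichlet_form A g f f / (\<integral>x. (f x)\<^sup>2 \<partial>\<mu>)))"
proof -
  obtain B where B: "L2_basis_of \<mu> F B" "card B = k + 1" and Fs: "F \<subseteq> smooth_functions A" and sub: "fun_vs.subspace F"
    using F by (auto simp: test_spaces_def)
  have fin: "finite B" and BF: "B \<subseteq> F" using B(1) by (auto simp: L2_basis_of_def)
  have comb: "(\<Sum>u\<in>B. c u *\<^sub>R u) \<in> F" for c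
  proof (rule fun_vs.subspace_sum[OF sub])
    fix u assume "u \<in> B"
    then have "(\<lambda>x. c u * u x) \<in> F" using BF by (intro fun_vs.subspace_scale[OF sub]) auto
    then show "c u *\<^sub>R u \<in> F" by (simp add: scaleR_fun_def)
  qed
  have const_comb: "(\<Sum>u\<in>B. c u *\<^sub>R (\<lambda>_. u)) = (\<lambda>_::nat. \<Sum>u\<in>B. c u *\<^sub>R u)" for c
    by (rule ext) (simp add: sum_fun_apply)
  have b_comb: "b (\<Sum>u\<in>B. c u *\<^sub>R (\<lambda>_. u)) (\<Sum>u\<in>B. c u *\<^sub>R (\<lambda>_. u)) = L2_inner \<mu> (\<Sum>u\<in>B. c u *\<^sub>R u) (\<Sum>u\<in>B. c u *\<^sub>R u)" for c
    unfolding const_comb using comb Fs by (intro b_const) auto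
  have indep: "\<forall>u\<in>B. c u = 0" if 0: "b (\<Sum>u\<in>B. c u *\<^sub>R (\<lambda>_. u)) (\<Sum>u\<in>B. c u *\<^sub>R (\<lambda>_. u)) = 0" for c
  proof -
    let ?f = "\<Sum>u\<in>B. c u *\<^sub>R u"
    have "?f \<in> L2 \<mu>" using comb Fs smooth_in_L2 by blast
    then have "AE x in \<mu>. ?f x = 0" using 0 AE_zero_iff_L2 unfolding b_comb by blast
    then have "AE x in \<mu>. (\<Sum>u\<in>B. c u * u x) = 0" by (simp add: sum_fun_apply)
    then show ?thesis using B(1) unfolding L2_basis_of_def by blast
  qed
  have BV: "(\<lambda>_. u) \<in> V" if "u \<in> B" for u using that BF Fs by (intro const_V) auto
  have card: "k < card B" using B(2) by simp
  have "\<exists>c. b (\<Sum>u\<in>B. c u *\<^sub>R (\<lambda>_. u)) (\<Sum>u\<in>B. c u *\<^sub>R (\<lambda>_. u)) > 0 \<and>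
    (\<forall>j<k. b (\<Sum>u\<in>B. c u *\<^sub>R (\<lambda>_. u)) (e j) = 0)"
  proof (rule L.B.independent_orthogonal[of B "\<lambda>u _. u" k e, OF BV e_V fin card indep])
    fix c assume "b (\<Sum>u\<in>B. c u *\<^sub>R (\<lambda>_. u)) (\<Sum>u\<in>B. c u *\<^sub>R (\<lambda>_. u)) > 0"
      "\<And>j. j < k \<Longrightarrow> b (\<Sum>u\<in>B. c u *\<^sub>R (\<lambda>_. u)) (e j) = 0"
    then show ?thesis by (intro exI[of _ c] conjI allI impI)
  qed
  then obtain c where c: "b (\<Sum>u\<in>B. c u *\<^sub>R (\<lambda>_. u)) (\<Sum>u\<in>B. c u *\<^sub>R (\<lambda>_. u)) > 0"
    "\<forall>j<k. b (\<Sum>u\<in>B. c u *\<^sub>R (\<lambda>_. u)) (e j) = 0" by (elim exE conjE) (rule that)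
  let ?f = "\<Sum>u\<in>B. c u *\<^sub>R u"
  have f: "?f \<in> F" "?f \<in> smooth_functions A" using comb Fs by auto
  have pos: "L2_inner \<mu> ?f ?f > 0" using c(1) by (simp only: b_comb)
  have "\<nu> k * b (\<lambda>_. ?f) (\<lambda>_. ?f) \<le> a (\<lambda>_. ?f) (\<lambda>_. ?f)"
    using c(2) unfolding const_comb by (intro minimum const_V f) simp
  then have "\<nu> k * L2_inner \<mu> ?f ?f \<le> dirichlet_form A g ?f ?f" by (simp only: a_const[OF f(2,2)] b_const[OF f(2,2)])
  then have "\<nu> k \<le> dirichlet_form A g ?f ?f / L2_inner \<mu> ?f ?f" using pos by (simp add: pos_le_divide_eq)
  then have q: "ereal (\<nu> k) \<le> ereal (dirichlet_form A g ?f ?f / (\<integral>x. (?f x)\<^sup>2 \<partial>\<mu>))"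
    by (simp only: L2_inner_self ereal_less_eq)
  have "?f \<noteq> 0"
  proof
    assume "?f = 0"
    then show False using pos by (simp add: H.zero_left)
  qed
  then have "?f \<in> F - {0}" using f(1) by blast
  then have "ereal (dirichlet_form A g ?f ?f / (\<integral>x. (?f x)\<^sup>2 \<partial>\<mu>)) \<le>
      (SUP f\<in>F - {0}. ereal (dirichlet_form A g f f / (\<integral>x. (f x)\<^sup>2 \<partial>\<mu>)))"
    by (rule SUP_upper[of ?f "F - {0}" "\<lambda>f. ereal (dirichlet_form A g f f / (\<integral>x. (f x)\<^sup>2 \<partial>\<mu>))"])
  with q show ?thesis by (rule order_trans)
qed

text \<open>At a late index \<open>n\<close> the members \<open>e i n\<close> are smooth, and their
  Gram matrices for \<open>b\<close> and \<open>a\<close> are entrywise close to the identity and to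
  the diagonal matrix of \<nu>. Their span is the test space; the numerator gains at most \<delta>
  and the denominator loses at most \<delta>, relative to the sum of squared coefficients.\<close>

lemma eigenvalue_le_perturbed:
  assumes \<delta>: "0 < \<delta>" "\<delta> < 1"
  shows "eigenvalue A g \<mu> k \<le> ereal ((\<nu> k + \<delta>) / (1 - \<delta>))"
proof -
  \<comment> \<open>Divided by the number of vectors, which \<open>quadratic_form_bound\<close>
    multiplies back.\<close>
  define \<eta> where "\<eta> = \<delta> / real (Suc k)"
  have \<eta>: "\<eta> > 0" using \<delta> by (simp add: \<eta>_def)
  have lim_b: "(\<lambda>n. L2_inner \<mu> (e i n) (e j n)) \<longlonglongrightarrow> (if i = j then 1 else 0)" for i j
    using P.B.tendsto_lim_form[OF V_B[OF e_V] V_B[OF e_V], of i j] by (simp add: orthonormal)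
  have lim_a: "(\<lambda>n. dirichlet_form A g (e i n) (e j n)) \<longlonglongrightarrow> (if i = j then \<nu> i else 0)" for i j
    using D.tendsto_lim_form[OF V_A[OF e_V] V_A[OF e_V], of i j] by (simp add: eigen[OF e_V] orthonormal if_distrib cong: if_cong)
  have "eventually (\<lambda>n. \<forall>i\<in>{..k}. \<forall>j\<in>{..k}. \<bar>L2_inner \<mu> (e i n) (e j n) - (if i = j then 1 else 0)\<bar> < \<eta> \<and>
      \<bar>dirichlet_form A g (e i n) (e j n) - (if i = j then \<nu> i else 0)\<bar> < \<eta>) sequentially"
  proof (intro eventually_ball_finite ballI eventually_conj)
    fix i j
    show "eventually (\<lambda>n. \<bar>L2_inner \<mu> (e i n) (e j n) - (if i = j then 1 else 0)\<bar> < \<eta>) sequentially"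
      using tendstoD[OF lim_b[of i j] \<eta>] by (simp add: dist_real_def)
    show "eventually (\<lambda>n. \<bar>dirichlet_form A g (e i n) (e j n) - (if i = j then \<nu> i else 0)\<bar> < \<eta>) sequentially"
      using tendstoD[OF lim_a[of i j] \<eta>] by (simp add: dist_real_def)
  qed auto
  then obtain n where n: "\<forall>i\<in>{..k}. \<forall>j\<in>{..k}. \<bar>L2_inner \<mu> (e i n) (e j n) - (if i = j then 1 else 0)\<bar> < \<eta> \<and>
      \<bar>dirichlet_form A g (e i n) (e j n) - (if i = j then \<nu> i else 0)\<bar> < \<eta>"
    by (auto simp: eventually_sequentially)
  define v where "v i = e i n" for i
  have near_b: "\<bar>L2_inner \<mu> (v i) (v j) - (if i = j then 1 else 0)\<bar> \<le> \<eta>"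
    and near_a: "\<bar>dirichlet_form A g (v i) (v j) - (if i = j then \<nu> i else 0)\<bar> \<le> \<eta>"
    if "i \<in> {..k}" "j \<in> {..k}" for i j
    using bspec[OF bspec[OF n that(1)] that(2)] unfolding v_def by linarith+
  have vs: "v i \<in> smooth_functions A" for i unfolding v_def by (rule V_mem[OF e_V])
  define f where "f c = (\<Sum>i\<le>k. c i *\<^sub>R v i)" for c
  have fs: "f c \<in> smooth_functions A" for c unfolding f_def using vs by simp
  have diag: "(\<Sum>i\<le>k. \<Sum>j\<le>k. c i * c j * (if i = j then r i else 0)) = (\<Sum>i\<le>k. r i * (c i)\<^sup>2)" for c r :: "nat \<Rightarrow> real"
  proof (rule sum.cong[OF refl])
    fix i assume "i \<in> {..k}"
    have "(\<Sum>j\<le>k. c i * c j * (if i = j then r i else 0)) = (\<Sum>j\<le>k. if j = i then c i * c i * r i else 0)"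
      by (intro sum.cong) auto
    then show "(\<Sum>j\<le>k. c i * c j * (if i = j then r i else 0)) = r i * (c i)\<^sup>2"
      using \<open>i \<in> {..k}\<close> by (simp add: power2_eq_square)
  qed
  have perturb: "\<bar>(\<Sum>i\<le>k. \<Sum>j\<le>k. c i * c j * N i j) - (\<Sum>i\<le>k. r i * (c i)\<^sup>2)\<bar> \<le> \<delta> * (\<Sum>i\<le>k. (c i)\<^sup>2)"
    if N: "\<And>i j. \<lbrakk>i \<in> {..k}; j \<in> {..k}\<rbrakk> \<Longrightarrow> \<bar>N i j - (if i = j then r i else 0)\<bar> \<le> \<eta>" for N r and c :: "nat \<Rightarrow> real"
  proof -
    have "(\<Sum>i\<le>k. \<Sum>j\<le>k. c i * c j * N i j) - (\<Sum>i\<le>k. r i * (c i)\<^sup>2) =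
        (\<Sum>i\<le>k. \<Sum>j\<le>k. c i * c j * (N i j - (if i = j then r i else 0)))"
      unfolding diag[symmetric] by (simp only: right_diff_distrib sum_subtractf)
    also have "\<bar>\<dots>\<bar> \<le> \<eta> * real (card {..k}) * (\<Sum>i\<le>k. (c i)\<^sup>2)"
      by (rule quadratic_form_bound[OF N])
    also have "\<eta> * real (card {..k}) = \<delta>" by (simp add: \<eta>_def del: of_nat_Suc)
    finally show ?thesis .
  qed
  have B_ge: "(1 - \<delta>) * (\<Sum>i\<le>k. (c i)\<^sup>2) \<le> L2_inner \<mu> (f c) (f c)" for c
  proof -
    have "L2_inner \<mu> (f c) (f c) = (\<Sum>i\<le>k. \<Sum>j\<le>k. c i * c j * L2_inner \<mu> (v i) (v j))"
      unfolding f_def by (rule P.B.lincomb[OF vs])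
    moreover have "\<bar>(\<Sum>i\<le>k. \<Sum>j\<le>k. c i * c j * L2_inner \<mu> (v i) (v j)) - (\<Sum>i\<le>k. 1 * (c i)\<^sup>2)\<bar> \<le> \<delta> * (\<Sum>i\<le>k. (c i)\<^sup>2)"
      by (rule perturb[of "\<lambda>i j. L2_inner \<mu> (v i) (v j)" "\<lambda>_. 1"]) (rule near_b)
    ultimately show ?thesis by (simp add: algebra_simps)
  qed
  have A_le: "dirichlet_form A g (f c) (f c) \<le> (\<nu> k + \<delta>) * (\<Sum>i\<le>k. (c i)\<^sup>2)" for c
  proof -
    have "dirichlet_form A g (f c) (f c) = (\<Sum>i\<le>k. \<Sum>j\<le>k. c i * c j * dirichlet_form A g (v i) (v j))"
      unfolding f_def by (rule D.lincomb[OF vs])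
    moreover have "\<bar>(\<Sum>i\<le>k. \<Sum>j\<le>k. c i * c j * dirichlet_form A g (v i) (v j)) - (\<Sum>i\<le>k. \<nu> i * (c i)\<^sup>2)\<bar> \<le> \<delta> * (\<Sum>i\<le>k. (c i)\<^sup>2)"
      by (rule perturb[of "\<lambda>i j. dirichlet_form A g (v i) (v j)" \<nu>]) (rule near_a)
    moreover have "(\<Sum>i\<le>k. \<nu> i * (c i)\<^sup>2) \<le> \<nu> k * (\<Sum>i\<le>k. (c i)\<^sup>2)"
      unfolding sum_distrib_left using incseqD[OF incseq] by (intro sum_mono mult_right_mono) auto
    ultimately show ?thesis by (simp add: algebra_simps)
  qed
  have zero: "c i = 0" if "L2_inner \<mu> (f c) (f c) = 0" "i \<le> k" for c i
  proof -
    have "(1 - \<delta>) * (\<Sum>i\<le>k. (c i)\<^sup>2) \<le> 0" using B_ge[of c] that(1) by simp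
    then have "(\<Sum>i\<le>k. (c i)\<^sup>2) \<le> 0" using \<delta> by (simp add: mult_le_0_iff)
    moreover have "(c i)\<^sup>2 \<le> (\<Sum>i\<le>k. (c i)\<^sup>2)" using that(2) by (intro member_le_sum) auto
    ultimately have "(c i)\<^sup>2 \<le> 0" by linarith
    then show ?thesis by simp
  qed
  \<comment> \<open>The basis is a set, so its cardinality \<open>k + 1\<close> requires distinct
    functions.\<close>
  have inj: "inj_on v {..k}"
  proof (rule inj_onI, rule ccontr)
    fix i j assume ij: "i \<in> {..k}" "j \<in> {..k}" "v i = v j" "i \<noteq> j"
    define c :: "nat \<Rightarrow> real" where "c l = (if l = i then 1 else 0) - (if l = j then 1 else 0)" for l
    have "c l *\<^sub>R v l = (if l = i then v i else 0) - (if l = j then v j else 0)" for l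
      using ij by (auto simp: c_def)
    then have "f c = 0" unfolding f_def using ij by (simp add: sum_subtractf)
    then have "L2_inner \<mu> (f c) (f c) = 0" by (simp add: H.zero_left)
    then have "c i = 0" by (rule zero) (use ij(1) in simp)
    then show False using ij(4) by (simp add: c_def)
  qed
  define B where "B = v ` {..k}"
  have fin: "finite B" and card: "card B = k + 1" using inj by (auto simp: B_def card_image)
  have sum_B: "(\<Sum>u\<in>B. (\<lambda>x. c u * u x)) = f (\<lambda>i. c (v i))" for c
    unfolding B_def f_def using inj by (simp add: sum.reindex scaleR_fun_def)
  have sum_B_apply: "(\<Sum>u\<in>B. c u * u x) = f (\<lambda>i. c (v i)) x" for c x
    unfolding sum_B[symmetric] by (simp add: sum_fun_apply)
  have indep_B: "\<forall>u\<in>B. c u = 0" if "L2_inner \<mu> (f (\<lambda>i. c (v i))) (f (\<lambda>i. c (v i))) = 0" for c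
    using zero[OF that] by (auto simp: B_def)
  define F where "F = fun_vs.span B"
  have F_f: "\<exists>c. u = f (\<lambda>i. c (v i))" if "u \<in> F" for u
    using that unfolding F_def fun_vs.span_finite[OF fin] sum_B by auto
  have "F \<in> test_spaces A \<mu> (k + 1)" unfolding test_spaces_def
  proof (intro CollectI conjI exI[of _ B] card)
    show "F \<subseteq> smooth_functions A" using F_f fs by blast
    show "fun_vs.subspace F" unfolding F_def by (rule fun_vs.subspace_span)
    have "fun_vs.independent B"
    proof (rule fun_vs.independent_if_scalars_zero[OF fin])
      fix c u assume "(\<Sum>u\<in>B. (\<lambda>x. c u * u x)) = 0" "u \<in> B"
      then have "f (\<lambda>i. c (v i)) = 0" unfolding sum_B by simp
      then have "L2_inner \<mu> (f (\<lambda>i. c (v i))) (f (\<lambda>i. c (v i))) = 0" by (simp add: H.zero_left)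
      from indep_B[OF this] show "c u = 0" using \<open>u \<in> B\<close> by blast
    qed
    then show "fun_vs.dim F = k + 1"
      unfolding F_def card[symmetric] by (rule fun_vs.dim_span_eq_card_independent)
    show "L2_basis_of \<mu> F B" unfolding L2_basis_of_def
    proof (intro conjI fin allI impI)
      show "B \<subseteq> F" unfolding F_def by (rule fun_vs.span_superset)
      show "\<forall>u\<in>B. c u = 0" if "AE x in \<mu>. (\<Sum>u\<in>B. c u * u x) = 0" for c
      proof (rule indep_B)
        have "f (\<lambda>i. c (v i)) \<in> L2 \<mu>" using fs smooth_in_L2 by blast
        then show "L2_inner \<mu> (f (\<lambda>i. c (v i))) (f (\<lambda>i. c (v i))) = 0"
          using that AE_zero_iff_L2 unfolding sum_B_apply by blast
      qed
      show "\<forall>u\<in>F. \<exists>c. AE x in \<mu>. u x = (\<Sum>w\<in>B. c w * w x)"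
      proof
        fix u assume "u \<in> F"
        then obtain c where "u = f (\<lambda>i. c (v i))" using F_f by blast
        then show "\<exists>c. AE x in \<mu>. u x = (\<Sum>w\<in>B. c w * w x)"
          unfolding sum_B_apply by (intro exI[of _ c]) simp
      qed
    qed
  qed
  moreover have "(SUP u\<in>F - {0}. ereal (dirichlet_form A g u u / (\<integral>x. (u x)\<^sup>2 \<partial>\<mu>))) \<le> ereal ((\<nu> k + \<delta>) / (1 - \<delta>))"
  proof (rule SUP_least)
    fix u assume u: "u \<in> F - {0}"
    then obtain d where d: "u = f (\<lambda>i. d (v i))" using F_f by blast
    define c where "c i = d (v i)" for i
    have uc: "u = f c" using d by (simp add: c_def[abs_def])
    have "(\<Sum>i\<le>k. (c i)\<^sup>2) \<noteq> 0"
    proof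
      assume "(\<Sum>i\<le>k. (c i)\<^sup>2) = 0"
      then have "\<forall>i\<in>{..k}. (c i)\<^sup>2 = 0" by (subst (asm) sum_nonneg_eq_0_iff) auto
      then have "f c = 0" unfolding f_def by simp
      then show False using u uc by simp
    qed
    then have pos: "(\<Sum>i\<le>k. (c i)\<^sup>2) > 0" using sum_nonneg[of "{..k}" "\<lambda>i. (c i)\<^sup>2"] by (simp add: less_le)
    let ?q = "(\<nu> k + \<delta>) / (1 - \<delta>)"
    have q: "?q \<ge> 0" using nu_nonneg[of k] \<delta> by simp
    have "(1 - \<delta>) * (\<Sum>i\<le>k. (c i)\<^sup>2) > 0" using pos \<delta> by simp
    then have Bpos: "L2_inner \<mu> u u > 0" using B_ge[of c] uc by simp
    have "dirichlet_form A g u u \<le> (\<nu> k + \<delta>) * (\<Sum>i\<le>k. (c i)\<^sup>2)" using A_le[of c] uc by simp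
    also have "\<dots> = ?q * ((1 - \<delta>) * (\<Sum>i\<le>k. (c i)\<^sup>2))" using \<delta> by simp
    also have "\<dots> \<le> ?q * L2_inner \<mu> u u" using B_ge[of c] uc q by (intro mult_left_mono) auto
    finally have "dirichlet_form A g u u / L2_inner \<mu> u u \<le> ?q" using Bpos by (simp add: pos_divide_le_eq)
    then show "ereal (dirichlet_form A g u u / (\<integral>x. (u x)\<^sup>2 \<partial>\<mu>)) \<le> ereal ?q"
      by (simp only: L2_inner_self ereal_less_eq)
  qed
  ultimately show ?thesis unfolding eigenvalue_def by (rule INF_lower2)
qed

lemma eigenvalue_eq: "eigenvalue A g \<mu> k = ereal (\<nu> k)"
proof (rule antisym)
  show "ereal (\<nu> k) \<le> eigenvalue A g \<mu> k"
    unfolding eigenvalue_def by (intro INF_greatest rayleigh_quotient_ge)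
  \<comment> \<open>These are the values of \<delta>; the second \<open>Suc\<close> keeps the first
    of them below 1.\<close>
  have "(\<lambda>n. inverse (real (Suc (Suc n)))) \<longlonglongrightarrow> 0"
    by (rule LIMSEQ_Suc[OF LIMSEQ_inverse_real_of_nat])
  then have "(\<lambda>n. (\<nu> k + inverse (real (Suc (Suc n)))) / (1 - inverse (real (Suc (Suc n))))) \<longlonglongrightarrow> (\<nu> k + 0) / (1 - 0)"
    by (intro tendsto_intros) auto
  then have lim: "(\<lambda>n. ereal ((\<nu> k + inverse (real (Suc (Suc n)))) / (1 - inverse (real (Suc (Suc n)))))) \<longlonglongrightarrow> ereal (\<nu> k)"
    by simp
  show "eigenvalue A g \<mu> k \<le> ereal (\<nu> k)"
  proof (rule LIMSEQ_le_const[OF lim], intro exI[of _ 0] allI impI)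
    fix n :: nat
    have "inverse (real (Suc (Suc n))) < 1" by (simp add: inverse_less_1_iff)
    then show "eigenvalue A g \<mu> k \<le> ereal ((\<nu> k + inverse (real (Suc (Suc n)))) / (1 - inverse (real (Suc (Suc n)))))"
      by (intro eigenvalue_le_perturbed) auto
  qed
qed

text \<open>A general \<open>h\<close> in L2 has no Sobolev representative. It is first approximated
  by a smooth \<open>u\<close>, whose constant sequence is expanded in the eigenfunctions; each of
  the two errors gets half of the square root of \<epsilon>.\<close>

lemma orthogonal_basis: "L2_orthogonal_basis \<mu> T"
  unfolding L2_orthogonal_basis_def
proof (intro conjI allI impI ballI)
  fix i j
  show "T j \<in> L2 \<mu>" by (rule T_L2)
  show "(\<integral>x. (T j x)\<^sup>2 \<partial>\<mu>) \<noteq> 0" using T_inner[of j j] by (simp add: L2_inner_self)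
  show "i \<noteq> j \<Longrightarrow> (\<integral>x. T i x * T j x \<partial>\<mu>) = 0" using T_inner[of i j] by (simp add: L2_inner_def)
next
  fix h and \<epsilon> :: real assume h: "h \<in> L2 \<mu>" and \<epsilon>: "\<epsilon> > 0"
  define d where "d = sqrt \<epsilon>"
  have d: "d > 0" "d\<^sup>2 = \<epsilon>" using \<epsilon> by (simp_all add: d_def)
  then have d2: "d / 2 > 0" by simp
  obtain u where u: "u \<in> smooth_functions A" "H.nrm (h - u) < d / 2" using smooth_dense[OF h d2] by blast
  let ?u = "\<lambda>_. u"
  have uV: "?u \<in> V" by (rule const_V[OF u(1)])
  have uL: "u \<in> L2 \<mu>" using u(1) smooth_in_L2 by blast
  obtain n where n: "psd_form.nrm b (?u - (\<Sum>i<n. b ?u (e i) *\<^sub>R e i)) < d / 2"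
    using order_tendstoD(2)[OF expansion[OF uV] d2] by (auto simp: eventually_sequentially)
  define S where "S = (\<Sum>i<n. b ?u (e i) *\<^sub>R T i)"
  have SL: "S \<in> L2 \<mu>" unfolding S_def using T_L2 by simp
  have tL: "tau \<mu> (cls ?u) \<in> L2 \<mu>" by (rule tau_cls(1)[OF uV])
  have "H.nrm (tau \<mu> (cls ?u) - S) < d / 2"
    using n H_nrm_tau_residual[OF uV e_V, where I = "{..<n}" and c = "\<lambda>i. b ?u (e i)"] by (simp add: S_def)
  moreover have "H.nrm (u - S) \<le> H.nrm (u - tau \<mu> (cls ?u)) + H.nrm (tau \<mu> (cls ?u) - S)"
    using uL tL SL by (rule H.nrm_triangle_diff)
  moreover have "H.nrm (h - S) \<le> H.nrm (h - u) + H.nrm (u - S)"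
    using h uL SL by (rule H.nrm_triangle_diff)
  ultimately have "H.nrm (h - S) < d" using u(2) tau_const(1)[OF u(1)] by linarith
  then have "(H.nrm (h - S))\<^sup>2 < d\<^sup>2" using H.nrm_nonneg[OF H.mem_simps(3)[OF h SL]] by (intro power_strict_mono) auto
  then have "(\<integral>x. ((h - S) x)\<^sup>2 \<partial>\<mu>) < \<epsilon>"
    using h SL d(2) by (simp add: H.nrm_square L2_inner_self)
  then show "\<exists>n c. (\<integral>x. (h x - (\<Sum>j<n. c j * T j x))\<^sup>2 \<partial>\<mu>) < \<epsilon>"
    by (intro exI[of _ n] exI[of _ "\<lambda>i. b ?u (e i)"]) (simp add: S_def sum_fun_apply)
qed

lemma finite_level_set: "finite {k. \<nu> k = l}"
proof -
  obtain N where "\<And>n. n \<ge> N \<Longrightarrow> \<nu> n > l"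
    using nu_top by (auto simp: filterlim_at_top_dense eventually_sequentially)
  then have "{k. \<nu> k = l} \<subseteq> {..<N}" by (metis (mono_tags) lessThan_iff mem_Collect_eq not_le order_less_irrefl subsetI)
  then show ?thesis by (rule finite_subset) simp
qed

text \<open>By symmetry the energy of an eigenvector against \<open>e i\<close> is both
  \<open>l\<close> and \<nu> i times the same \<open>b\<close>-value, so only indices with \<nu> i =
  l have coefficients. The expansion is then eventually constant and its residual must be 0. For
  \<open>l\<close> outside the spectrum the basis is empty.\<close>

lemma eigenspace_basis: "\<exists>B. L2_basis_of \<mu> (tau \<mu> ` eigenspace A g \<mu> l) B"
proof -
  define J where "J = {k. \<nu> k = l}"
  have fin: "finite J" unfolding J_def by (rule finite_level_set)
  have inj: "inj_on T J"
  proof (rule inj_onI, rule ccontr)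
    fix i j assume "T i = T j" "i \<noteq> j"
    then show False using T_inner[of i j] T_inner[of j j] by simp
  qed
  have sum_T: "(\<Sum>u\<in>T ` J. c u * u x) = (\<Sum>j\<in>J. c (T j) * T j x)" for c x
    using inj by (simp add: sum.reindex)
  have "L2_basis_of \<mu> (tau \<mu> ` eigenspace A g \<mu> l) (T ` J)"
    unfolding L2_basis_of_def
  proof (intro conjI allI impI ballI)
    show "finite (T ` J)" using fin by simp
    show "T ` J \<subseteq> tau \<mu> ` eigenspace A g \<mu> l"
    proof (intro image_subsetI imageI)
      fix j assume "j \<in> J"
      then have "\<nu> j = l" by (simp add: J_def)
      then show "cls (e j) \<in> eigenspace A g \<mu> l"
        using L2_inner_tau[OF e_V, of _ j]
        by (auto simp: eigenspace_def sobolev_space_eq e_V sobolev_dirichlet_cls eigen L2_inner_def)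
    qed
  next
    fix c u assume ae: "AE x in \<mu>. (\<Sum>u\<in>T ` J. c u * u x) = 0" and "u \<in> T ` J"
    then obtain j where j: "j \<in> J" "u = T j" by blast
    let ?S = "\<Sum>i\<in>J. c (T i) *\<^sub>R T i"
    have SL: "?S \<in> L2 \<mu>" using T_L2 by simp
    have ae': "AE x in \<mu>. ?S x = 0" using ae unfolding sum_T by (simp add: sum_fun_apply)
    have "L2_inner \<mu> ?S (T j) = (\<integral>x. 0 \<partial>\<mu>)"
      unfolding L2_inner_def
    proof (rule integral_cong_AE)
      show "AE x in \<mu>. ?S x * T j x = 0" using ae' by eventually_elim simp
      show "(\<lambda>x. ?S x * T j x) \<in> borel_measurable \<mu>"
        using SL T_L2[of j] unfolding L2_def by (intro borel_measurable_times) auto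
    qed simp
    moreover have "L2_inner \<mu> ?S (T j) = (\<Sum>i\<in>J. if i = j then c (T j) else 0)"
      using T_L2 by (subst H.sum_left) (auto simp: H.scale_left T_inner intro!: sum.cong)
    ultimately show "c u = 0" using j fin by simp
  next
    fix h assume "h \<in> tau \<mu> ` eigenspace A g \<mu> l"
    then obtain X where "X \<in> eigenspace A g \<mu> l" "h = tau \<mu> X" by blast
    then obtain s where s: "s \<in> V" "h = tau \<mu> (cls s)" and X: "cls s \<in> eigenspace A g \<mu> l"
      by (auto simp: eigenspace_def sobolev_space_eq)
    define c where "c i = b s (e i)" for i
    have c0: "c i = 0" if "i \<notin> J" for i
    proof -
      have "a s (e i) = l * b s (e i)"
        using X s(1) e_V[of i] L2_inner_tau[OF s(1) e_V, of i] sobolev_dirichlet_cls[OF s(1) e_V, of i]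
        by (auto simp: eigenspace_def sobolev_space_eq L2_inner_def)
      moreover have "a s (e i) = \<nu> i * b s (e i)"
        using eigen[OF s(1), of i] L.A.sym[OF s(1) e_V, of i] L.B.sym[OF s(1) e_V, of i] by simp
      ultimately show ?thesis using that by (auto simp: c_def J_def)
    qed
    define R where "R = h - (\<Sum>i\<in>J. c i *\<^sub>R T i)"
    have RL: "R \<in> L2 \<mu>" unfolding R_def using tau_cls(1)[OF s(1)] s(2) T_L2 by simp
    obtain N where N: "J \<subseteq> {..<N}" using fin finite_nat_iff_bounded by blast
    have "psd_form.nrm b (s - (\<Sum>i<n. b s (e i) *\<^sub>R e i)) = H.nrm R" if "n \<ge> N" for n
    proof -
      \<comment> \<open>Past \<open>N\<close> all of \<open>J\<close> has been summed and every
        further coefficient is 0.\<close>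
      have "(\<Sum>i<n. b s (e i) *\<^sub>R e i) = (\<Sum>i\<in>J. c i *\<^sub>R e i)"
        using N that c0 by (intro sum.mono_neutral_cong_right) (auto simp: c_def)
      then show ?thesis
        using H_nrm_tau_residual[OF s(1) e_V, where I = J and c = c] s(2) by (simp add: R_def)
    qed
    then have "(\<lambda>n. psd_form.nrm b (s - (\<Sum>i<n. b s (e i) *\<^sub>R e i))) \<longlonglongrightarrow> H.nrm R"
      by (intro tendsto_eventually) (auto simp: eventually_sequentially)
    then have "H.nrm R = 0" using LIMSEQ_unique expansion[OF s(1)] by blast
    then have "L2_inner \<mu> R R = 0" using H.nrm_square[OF RL] by simp
    then have "AE x in \<mu>. R x = 0" using AE_zero_iff_L2[OF RL] by simp
    then have "AE x in \<mu>. h x = (\<Sum>u\<in>T ` J. c (inv_into J T u) * u x)"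
    proof eventually_elim
      case (elim x)
      have "(\<Sum>u\<in>T ` J. c (inv_into J T u) * u x) = (\<Sum>j\<in>J. c j * T j x)"
        unfolding sum_T by (intro sum.cong) (simp_all add: inv_into_f_f[OF inj])
      then show ?case using elim by (simp add: R_def sum_fun_apply)
    qed
    then show "\<exists>c. AE x in \<mu>. h x = (\<Sum>u\<in>T ` J. c u * u x)"
      by (rule exI[of _ "\<lambda>u. c (inv_into J T u)"])
  qed
  then show ?thesis by blast
qed

end

theorem proposition4p1:
  fixes A :: "('a::{t2_space, second_countable_topology}, 'n::finite) chart set"
    and g :: "('a, 'n) metric"
    and \<mu> :: "'a measure"
  assumes "riemannian_manifold A g"
    and "compact (UNIV :: 'a set)"
    and "CARD('n) \<ge> 2"
    and "admissible A g \<mu>"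
  shows "eigenvalue A g \<mu> 0 = 0
    \<and> 0 < eigenvalue A g \<mu> 1
    \<and> (\<forall>k. eigenvalue A g \<mu> k \<le> eigenvalue A g \<mu> (Suc k))
    \<and> (\<forall>k. eigenvalue A g \<mu> k < \<infinity>)
    \<and> eigenvalue A g \<mu> \<longlonglongrightarrow> \<infinity>
    \<and> (\<forall>l. finite {k. eigenvalue A g \<mu> k = ereal l})
    \<and> (\<forall>l. \<exists>B. L2_basis_of \<mu> (tau \<mu> ` eigenspace A g \<mu> l) B)
    \<and> (\<exists>f. (\<forall>j. f j \<in> sobolev_space A g \<mu>)
         \<and> L2_orthogonal_basis \<mu> (\<lambda>j. tau \<mu> (f j))
         \<and> (\<forall>j. \<forall>u\<in>sobolev_space A g \<mu>.
              sobolev_dirichlet A g (f j) u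
                = real_of_ereal (eigenvalue A g \<mu> j) * (\<integral>x. tau \<mu> (f j) x * tau \<mu> u x \<partial>\<mu>)))"
proof -
  interpret admissible_measure A g \<mu> using assms by unfold_locales
  obtain e \<nu> where "eigensystem A g \<mu> e \<nu>" using ex_eigensystem by blast
  then interpret eigensystem A g \<mu> e \<nu> .
  have top: "eigenvalue A g \<mu> \<longlonglongrightarrow> \<infinity>"
    unfolding eigenvalue_eq tendsto_PInfty_eq_at_top by (rule nu_top)
  have "sobolev_dirichlet A g (cls (e j)) u = real_of_ereal (eigenvalue A g \<mu> j) * (\<integral>x. tau \<mu> (cls (e j)) x * tau \<mu> u x \<partial>\<mu>)"
    if u: "u \<in> sobolev_space A g \<mu>" for j u
  proof -
    obtain s where s: "s \<in> V" "u = cls s" using u by (auto simp: sobolev_space_eq)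
    show ?thesis
      using L2_inner_tau[OF e_V s(1), of j]
      by (simp add: s(2) sobolev_dirichlet_cls[OF e_V s(1)] eigen[OF s(1)] eigenvalue_eq L2_inner_def)
  qed
  moreover have "cls (e j) \<in> sobolev_space A g \<mu>" for j using e_V by (simp add: sobolev_space_eq)
  ultimately have "\<exists>f. (\<forall>j. f j \<in> sobolev_space A g \<mu>)
         \<and> L2_orthogonal_basis \<mu> (\<lambda>j. tau \<mu> (f j))
         \<and> (\<forall>j. \<forall>u\<in>sobolev_space A g \<mu>.
              sobolev_dirichlet A g (f j) u
                = real_of_ereal (eigenvalue A g \<mu> j) * (\<integral>x. tau \<mu> (f j) x * tau \<mu> u x \<partial>\<mu>))"
    using orthogonal_basis by (intro exI[of _ "\<lambda>j. cls (e j)"]) simp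
  moreover have "eigenvalue A g \<mu> k \<le> eigenvalue A g \<mu> (Suc k)" for k
    using incseq_SucD[OF incseq] by (simp add: eigenvalue_eq)
  moreover have "eigenvalue A g \<mu> 0 = 0" "0 < eigenvalue A g \<mu> 1" "eigenvalue A g \<mu> k < \<infinity>" for k
    using nu_1_pos by (simp_all add: eigenvalue_eq nu_0)
  moreover have "finite {k. eigenvalue A g \<mu> k = ereal l}" for l
    using finite_level_set[of l] by (simp add: eigenvalue_eq)
  ultimately show ?thesis using top eigenspace_basis by (intro conjI allI) assumption+
qed

end
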